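(* Let $\alpha,K>0$, $\beta\in(0,1]$, and let $p^\star=e^{-u+a}$ be an $(\alpha,\beta,K)$-weakly log-concave probability density on $\mathbb R^d$. Let $Y\sim p^\star$ and $\xi\sim\mathcal N(0,I_d)$ be independent, let $p_t$ be the density of $X_t=tY+\sqrt{1-t^2}\,\xi$ for $t\in(0,1)$, and let $s(t,x)=\nabla\log p_t(x)$ be its score. Then there exists a constant $C>0$ independent of the dimension (depending only on $\alpha,\beta,K$) such that for all $z\in[0,1]$, $$\int_z^1\frac1t\,\sup_{x\in\mathbb R^d}\lambda_{\max}\big(\mathrm{Id}+\nabla s(t,x)\big)\,dt\le C.$$
   Context: Weak log-concavity. For $\alpha,K>0$ and $\beta\in(0,1]$, a probability density $p$ on $\mathbb R^d$ is $(\alpha,\beta,K)$-weakly log-concave if $p=\exp(-u+a)$ where (1) $u:\mathbb R^d\to\mathbb R\cup\{+\infty\}$ is convex, $C^2$ on the interior of the support, with $\nabla^2u\succeq\alpha\,\mathrm{Id}$ there; (2) $|a(x)-a(y)|\le K\|x-y\|^\beta$ for all $x,y\in\mathbb R^d$. $\nabla s(t,x)$ is the Jacobian in $x$ (the Hessian of $\log p_t$), and $\lambda_{\max}$ is the largest eigenvalue of a symmetric matrix. *)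

theory Defs
  imports "HOL-Probability.Probability" "Jordan_Normal_Form.Spectral_Radius"
begin

text \<open>
  The constant in the theorem has to be uniform in the dimension \<open>d\<close>, so \<open>d\<close> is a natural number
  and not a type. A point of \<open>\<real>\<^sup>d\<close> is a function \<open>nat \<Rightarrow> real\<close> that is \<open>undefined\<close> off \<open>{..<d}\<close>;
  these points are both the space of the product measure \<open>PiM {..<d}\<close> and the carrier of the
  product topology over \<open>{..<d}\<close>.
\<close>

type_synonym point = "nat \<Rightarrow> real"

definition Rd :: "nat \<Rightarrow> point set" where
  "Rd d = (\<Pi>\<^sub>E i\<in>{..<d}. UNIV)"

definition Rd_top :: "nat \<Rightarrow> point topology" where
  "Rd_top d = product_topology (\<lambda>_. euclideanreal) {..<d}"

definition lebesgue_Rd :: "nat \<Rightarrow> point measure" where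
  "lebesgue_Rd d = (\<Pi>\<^sub>M i\<in>{..<d}. lborel)"

lemma topspace_Rd_top: "topspace (Rd_top d) = Rd d"
  by (simp add: Rd_top_def Rd_def)

lemma space_lebesgue_Rd: "space (lebesgue_Rd d) = Rd d"
  by (simp add: lebesgue_Rd_def Rd_def space_PiM)

definition dist_Rd :: "nat \<Rightarrow> point \<Rightarrow> point \<Rightarrow> real" where
  "dist_Rd d x y = sqrt (\<Sum>i<d. (x i - y i)\<^sup>2)"

definition lincomb :: "nat \<Rightarrow> real \<Rightarrow> point \<Rightarrow> real \<Rightarrow> point \<Rightarrow> point" where
  "lincomb d r x s y = (\<lambda>i\<in>{..<d}. r * x i + s * y i)"


subsection \<open>Differential calculus\<close>

definition partial :: "nat \<Rightarrow> (point \<Rightarrow> real) \<Rightarrow> point \<Rightarrow> real" where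
  "partial i f x = deriv (\<lambda>r. f (x(i := r))) (x i)"

definition grad :: "nat \<Rightarrow> (point \<Rightarrow> real) \<Rightarrow> point \<Rightarrow> point" where
  "grad d f x = (\<lambda>i\<in>{..<d}. partial i f x)"

definition jacobian_mat :: "nat \<Rightarrow> (point \<Rightarrow> point) \<Rightarrow> point \<Rightarrow> real mat" where
  "jacobian_mat d F x = mat d d (\<lambda>(i, j). partial j (\<lambda>y. F y i) x)"

definition hessian :: "nat \<Rightarrow> (point \<Rightarrow> real) \<Rightarrow> point \<Rightarrow> real mat" where
  "hessian d f x = jacobian_mat d (grad d f) x"

text \<open>\<open>f\<close> is of class \<open>C\<^sup>k\<close> on the set \<open>S\<close>, which is meant to be open in \<open>\<real>\<^sup>d\<close>.\<close>

primrec Ck_on :: "nat \<Rightarrow> nat \<Rightarrow> point set \<Rightarrow> (point \<Rightarrow> real) \<Rightarrow> bool" where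
  "Ck_on 0 d S f \<longleftrightarrow> continuous_map (subtopology (Rd_top d) S) euclideanreal f"
| "Ck_on (Suc k) d S f \<longleftrightarrow>
     continuous_map (subtopology (Rd_top d) S) euclideanreal f \<and>
     (\<forall>i<d. (\<forall>x\<in>S. (\<lambda>r. f (x(i := r))) differentiable at (x i)) \<and> Ck_on k d S (partial i f))"

definition loewner_le :: "real mat \<Rightarrow> real mat \<Rightarrow> bool" where
  "loewner_le A B \<longleftrightarrow>
     (\<forall>v\<in>carrier_vec (dim_row A). scalar_prod v (A *\<^sub>v v) \<le> scalar_prod v (B *\<^sub>v v))"

definition lambda_max :: "real mat \<Rightarrow> real" where
  "lambda_max A = Max (spectrum A)"


subsection \<open>Weakly log-concave densities\<close>

definition prob_density :: "nat \<Rightarrow> (point \<Rightarrow> real) \<Rightarrow> bool" where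
  "prob_density d p \<longleftrightarrow>
     p \<in> borel_measurable (lebesgue_Rd d) \<and> (\<forall>x\<in>Rd d. 0 \<le> p x) \<and>
     (\<integral>\<^sup>+ x. ennreal (p x) \<partial>lebesgue_Rd d) = 1"

definition supp :: "nat \<Rightarrow> (point \<Rightarrow> real) \<Rightarrow> point set" where
  "supp d p = Rd_top d closure_of {x \<in> Rd d. p x \<noteq> 0}"

text \<open>Convexity for functions with values in \<open>\<real> \<union> {+\<infinity>}\<close>.\<close>

definition convex_ext :: "nat \<Rightarrow> (point \<Rightarrow> ereal) \<Rightarrow> bool" where
  "convex_ext d u \<longleftrightarrow>
     (\<forall>x\<in>Rd d. u x \<noteq> -\<infinity>) \<and>
     (\<forall>x\<in>Rd d. \<forall>y\<in>Rd d. \<forall>r. 0 < r \<and> r < 1 \<longrightarrow>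
        u (lincomb d (1 - r) x r y) \<le> ereal (1 - r) * u x + ereal r * u y)"

definition weakly_log_concave ::
  "nat \<Rightarrow> real \<Rightarrow> real \<Rightarrow> real \<Rightarrow> (point \<Rightarrow> real) \<Rightarrow> bool" where
  "weakly_log_concave d \<alpha> \<beta> K p \<longleftrightarrow>
     prob_density d p \<and>
     (\<exists>(u :: point \<Rightarrow> ereal) (a :: point \<Rightarrow> real).
        (\<forall>x\<in>Rd d. p x = (if u x = \<infinity> then 0 else exp (- real_of_ereal (u x) + a x))) \<and>
        convex_ext d u \<and>
        (let S = Rd_top d interior_of supp d p; v = (\<lambda>x. real_of_ereal (u x)) in
           Ck_on 2 d S v \<and> (\<forall>x\<in>S. loewner_le (\<alpha> \<cdot>\<^sub>m 1\<^sub>m d) (hessian d v x))) \<and>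
        (\<forall>x\<in>Rd d. \<forall>y\<in>Rd d. \<bar>a x - a y\<bar> \<le> K * dist_Rd d x y powr \<beta>))"


subsection \<open>The noised variable and its score\<close>

definition std_gaussian :: "nat \<Rightarrow> point measure" where
  "std_gaussian d = density (lebesgue_Rd d) (\<lambda>x. ennreal (\<Prod>i<d. std_normal_density (x i)))"

text \<open>
  The law of \<open>t Y + sqrt (1 - t\<^sup>2) \<xi>\<close> for independent \<open>Y\<close> with density \<open>p\<close> and \<open>\<xi>\<close> standard
  Gaussian; the lemma below is the version with random variables.
\<close>

definition noised_law :: "nat \<Rightarrow> (point \<Rightarrow> real) \<Rightarrow> real \<Rightarrow> point measure" where
  "noised_law d p t =
     distr (density (lebesgue_Rd d) (\<lambda>x. ennreal (p x)) \<Otimes>\<^sub>M std_gaussian d) (lebesgue_Rd d)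
       (\<lambda>(y, \<xi>). lincomb d t y (sqrt (1 - t\<^sup>2)) \<xi>)"

lemma measurable_lincomb [measurable]:
  "(\<lambda>(x, y). lincomb d r x s y) \<in> lebesgue_Rd d \<Otimes>\<^sub>M lebesgue_Rd d \<rightarrow>\<^sub>M lebesgue_Rd d"
  unfolding lincomb_def lebesgue_Rd_def by measurable

lemma (in prob_space) distr_noised:
  assumes Y: "distributed M (lebesgue_Rd d) Y (\<lambda>x. ennreal (p x))"
    and \<xi>: "distr M (lebesgue_Rd d) \<xi> = std_gaussian d"
    and indep: "indep_var (lebesgue_Rd d) Y (lebesgue_Rd d) \<xi>"
  shows "distr M (lebesgue_Rd d) (\<lambda>\<omega>. lincomb d t (Y \<omega>) (sqrt (1 - t\<^sup>2)) (\<xi> \<omega>)) = noised_law d p t"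
proof -
  let ?L = "lebesgue_Rd d"
  have rv [measurable]: "Y \<in> M \<rightarrow>\<^sub>M ?L" "\<xi> \<in> M \<rightarrow>\<^sub>M ?L"
    and joint: "distr M ?L Y \<Otimes>\<^sub>M distr M ?L \<xi> = distr M (?L \<Otimes>\<^sub>M ?L) (\<lambda>\<omega>. (Y \<omega>, \<xi> \<omega>))"
    using indep unfolding indep_var_distribution_eq by auto
  have "distr M ?L Y = density ?L (\<lambda>x. ennreal (p x))"
    using Y by (simp add: distributed_def)
  then have "noised_law d p t =
      distr (distr M (?L \<Otimes>\<^sub>M ?L) (\<lambda>\<omega>. (Y \<omega>, \<xi> \<omega>))) ?L
        (\<lambda>(y, \<xi>). lincomb d t y (sqrt (1 - t\<^sup>2)) \<xi>)"
    unfolding noised_law_def joint[symmetric] \<xi> by simp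
  also have "\<dots> = distr M ?L (\<lambda>\<omega>. lincomb d t (Y \<omega>) (sqrt (1 - t\<^sup>2)) (\<xi> \<omega>))"
    by (subst distr_distr) (auto simp: comp_def)
  finally show ?thesis by simp
qed

text \<open>
  Densities are unique only up to null sets. As the score is defined pointwise, the density of a
  law means its continuous density, which is unique.
\<close>

definition continuous_density :: "nat \<Rightarrow> point measure \<Rightarrow> (point \<Rightarrow> real) \<Rightarrow> bool" where
  "continuous_density d P f \<longleftrightarrow>
     prob_density d f \<and> continuous_map (Rd_top d) euclideanreal f \<and>
     P = density (lebesgue_Rd d) (\<lambda>x. ennreal (f x))"

definition score :: "nat \<Rightarrow> (point \<Rightarrow> real) \<Rightarrow> point \<Rightarrow> point" where
  "score d f = grad d (\<lambda>x. ln (f x))"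

end

theory Submission
  imports Defs
begin

text \<open>
  Put \<open>\<sigma>\<^sup>2 = 1 - t\<^sup>2\<close>. For a unit vector \<open>v\<close>, the quadratic form of \<open>Id + \<nabla>s(t,x)\<close> at \<open>v\<close> is
  \<open>- t\<^sup>2 / \<sigma>\<^sup>2 + (t / \<sigma>\<^sup>2)\<^sup>2 Var \<langle>v, y\<rangle>\<close> with the variance taken under the posterior
  \<open>f(y) = p(y) exp (- t\<^sup>2 |y|\<^sup>2 / (2 \<sigma>\<^sup>2) + t \<langle>x, y\<rangle> / \<sigma>\<^sup>2)\<close>, up to normalisation. The Prekopa--Leindler
  inequality for \<open>f exp (h \<langle>v, y\<rangle>)\<close> and \<open>f exp (- h \<langle>v, y\<rangle>)\<close> sees the Hoelder perturbation only through the
  distance of two points, so it bounds \<open>M(h) M(-h) \<le> e\<^sup>E M(0)\<^sup>2\<close> for the moment generating function \<open>M\<close>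
  without any dependence on the dimension, and \<open>h\<^sup>2 Var \<le> M(h) M(-h) / M(0)\<^sup>2 - 1\<close>. With
  \<open>h = w / \<sigma>\<close>, \<open>w = \<sigma> powr (\<beta>/4)\<close>, the variance is at most \<open>\<sigma>\<^sup>2 (1 + C w\<^sup>2)\<close>, hence the
  integrand is at most \<open>C t (1 - t\<^sup>2) powr (\<beta>/4 - 1)\<close>.

  Integrability also needs a lower bound near \<open>t = 1\<close>, where the trivial bound \<open>- t / \<sigma>\<^sup>2\<close> is not
  enough: if the supremum of the eigenvalues is \<open>1 - \<kappa>\<close>, then the density of \<open>X\<^sub>t\<close> is \<open>\<kappa>\<close>-strongly
  log-concave, and the same inequality keeps \<open>\<kappa>\<close> bounded because \<open>Y\<close> is not constant.
\<close>

subsection \<open>The Prekopa--Leindler inequality\<close>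

text \<open>The summand - t^2 / \<sigma>^2 must be cancelled exactly: a variance bound c \<sigma>^2
  with c > 1 would leave a multiple of t / (1 - t^2) under the integral, which diverges at t = 1. So
  the leading constant has to be 1, with an error that is a positive power of \<sigma>. Letting h
  tend to 0 cannot give this, since the Hoelder term contributes to E even at h = 0; hence a finite
  step h. In the scale R = \<sigma> r the exponent is 2 w r - \<rho> r^2 + 2 K \<sigma>^\<beta>
  r^\<beta> with \<rho> = 1 + O(\<sigma>^2). Therefore E = w^2 + O(\<sigma>^\<beta>) up to smaller
  terms, and (exp E - 1) / w^2 = 1 + O(w^2) + O(\<sigma>^\<beta> / w^2). The two errors balance at
  w^4 = \<sigma>^\<beta>, which is the choice of w. A second obstacle is that Prekopa--Leindler
  wants its hypothesis at every pair of points, while p may violate it on the frontier of {p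
  \<noteq> 0}. This is why convex sets are shown to have a null frontier part.\<close>

lemma emeasure_lborel_halve:
  fixes A :: "real set"
  assumes [measurable]: "A \<in> sets borel"
  shows "emeasure lborel A = 2 * emeasure lborel {z. 2 * z - b \<in> A}"
proof -
  have "emeasure lborel A = (\<integral>\<^sup>+x. indicator A x \<partial>lborel)" by simp
  also have "\<dots> = 2 * (\<integral>\<^sup>+x. indicator A (- b + 2 * x) \<partial>lborel)"
    by (subst nn_integral_real_affine[where c = 2 and t = "- b"]) auto
  also have "(\<integral>\<^sup>+x. indicator A (- b + 2 * x) \<partial>lborel) =
      (\<integral>\<^sup>+x. indicator {z. 2 * z - b \<in> A} x \<partial>lborel)"
    by (intro nn_integral_cong) (auto simp: indicator_def add.commute)
  also have "\<dots> = emeasure lborel {z. 2 * z - b \<in> A}"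
    by (intro nn_integral_indicator) simp
  finally show ?thesis .
qed

text \<open>Stands in for inner regularity in \<open>brunn_minkowski_real\<close>, where the cut has
  to be made at a point of the set itself. If the supremum is attained, cut there. Otherwise the
  parts of \<open>A\<close> below levels tending to the supremum, or to infinity, exhaust
  \<open>A\<close>, and some point of \<open>A\<close> lies above each level.\<close>

lemma emeasure_cut_above:
  fixes A :: "real set"
  assumes [measurable]: "A \<in> sets borel" and ne: "A \<noteq> {}" and c: "c < emeasure lborel A"
  obtains a where "a \<in> A" "c < emeasure lborel (A \<inter> {..a})"
proof (cases "bdd_above A")
  case True
  show ?thesis
  proof (cases "Sup A \<in> A")
    case s: True
    have "A \<inter> {..Sup A} = A" using cSup_upper[OF _ True] by auto
    then show ?thesis using that[OF s] c by simp
  next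
    case False
    let ?B = "\<lambda>n::nat. A \<inter> {..Sup A - 1 / Suc n}"
    have lt: "x < Sup A" if "x \<in> A" for x
      using cSup_upper[OF that True] False that by (cases "x = Sup A") auto
    have "(\<Union>n. ?B n) = A"
    proof (intro equalityI subsetI)
      fix x assume x: "x \<in> A"
      then obtain n where "1 / Suc n < Sup A - x"
        using lt[OF x] reals_Archimedean[of "Sup A - x"] by (auto simp: inverse_eq_divide)
      then show "x \<in> (\<Union>n. ?B n)" using x by (auto intro!: exI[of _ n])
    qed auto
    moreover have "incseq ?B"
    proof (rule incseq_SucI)
      fix n
      have "(1::real) / Suc (Suc n) \<le> 1 / Suc n" by (intro divide_left_mono) auto
      then show "?B n \<subseteq> ?B (Suc n)" by auto
    qed
    ultimately have "(SUP n. emeasure lborel (?B n)) = emeasure lborel A"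
      by (subst SUP_emeasure_incseq) auto
    with c have "c < (SUP n. emeasure lborel (?B n))" by simp
    then obtain n where n: "c < emeasure lborel (?B n)" unfolding less_SUP_iff by blast
    obtain a where a: "a \<in> A" "Sup A - 1 / Suc n < a"
      using less_cSup_iff[OF ne True, of "Sup A - 1 / Suc n"] by auto
    have "emeasure lborel (?B n) \<le> emeasure lborel (A \<inter> {..a})"
      using a by (intro emeasure_mono) auto
    with n a that show ?thesis by (meson less_le_trans)
  qed
next
  case False
  let ?B = "\<lambda>n::nat. A \<inter> {..real n}"
  have "(\<Union>n. ?B n) = A" using real_arch_simple by auto
  moreover have "incseq ?B" by (rule incseq_SucI) auto
  ultimately have "(SUP n. emeasure lborel (?B n)) = emeasure lborel A"
    by (subst SUP_emeasure_incseq) auto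
  with c have "c < (SUP n. emeasure lborel (?B n))" by simp
  then obtain n where n: "c < emeasure lborel (?B n)" unfolding less_SUP_iff by blast
  obtain a where a: "a \<in> A" "real n < a"
    using False by (auto simp: bdd_above_def not_le)
  have "emeasure lborel (?B n) \<le> emeasure lborel (A \<inter> {..a})"
    using a by (intro emeasure_mono) auto
  with n a that show ?thesis by (meson less_le_trans)
qed

lemma emeasure_lborel_uminus:
  fixes A :: "real set"
  assumes [measurable]: "A \<in> sets borel"
  shows "emeasure lborel (uminus ` A) = emeasure lborel A"
proof -
  have "emeasure lborel (uminus ` A) = emeasure (distr lborel borel uminus) (uminus ` A)"
    by (subst lborel_distr_uminus) simp
  also have "\<dots> = emeasure lborel (uminus -` (uminus ` A) \<inter> space lborel)"
  proof (rule emeasure_distr)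
    have "uminus ` A = uminus -` A" by (auto simp: image_iff) (metis minus_minus)
    then show "uminus ` A \<in> sets borel"
      using measurable_sets[of uminus borel borel A] by simp
  qed auto
  also have "uminus -` (uminus ` A) \<inter> space lborel = A" by auto
  finally show ?thesis .
qed

lemma emeasure_cut_below:
  fixes A :: "real set"
  assumes A[measurable]: "A \<in> sets borel" and ne: "A \<noteq> {}" and c: "c < emeasure lborel A"
  obtains a where "a \<in> A" "c < emeasure lborel (A \<inter> {a..})"
proof -
  have "uminus ` A = uminus -` A" by (auto simp: image_iff) (metis minus_minus)
  then have m: "uminus ` A \<in> sets borel"
    using measurable_sets[of uminus borel borel A] A by simp
  obtain a where a: "a \<in> uminus ` A" "c < emeasure lborel (uminus ` A \<inter> {..a})"
    by (rule emeasure_cut_above[OF m, of c]) (use ne c emeasure_lborel_uminus[OF A] in simp_all)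
  have eq: "uminus ` A \<inter> {..a} = uminus ` (A \<inter> {-a..})"
    by (auto simp: image_iff)
  have "c < emeasure lborel (A \<inter> {-a..})"
    using a(2) unfolding eq by (subst (asm) emeasure_lborel_uminus) auto
  with a(1) that[of "-a"] show ?thesis by auto
qed

text \<open>For \<open>X = 0\<close> no \<open>c\<close> lies below \<open>X\<close> and the first
  assumption is void, hence the separate \<open>Y \<le> Z\<close>.\<close>

lemma ennreal_add_le_dense:
  fixes X Y Z :: ennreal
  assumes d: "\<And>c. c < X \<Longrightarrow> \<exists>x. c < x \<and> x + Y \<le> Z" and "Y \<le> Z"
  shows "X + Y \<le> Z"
proof (cases "Z = \<infinity>")
  case False
  then have Y: "Y \<noteq> \<infinity>" using \<open>Y \<le> Z\<close> by (auto simp: top_unique)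
  have "X \<le> Z - Y"
  proof (rule dense_le)
    fix c assume "c < X"
    then obtain x where x: "c < x" "x + Y \<le> Z" using d by blast
    have "c \<le> x" using x by simp
    also have "x = (x + Y) - Y" using Y by simp
    also have "\<dots> \<le> Z - Y" using x by (intro ennreal_minus_mono) auto
    finally show "c \<le> Z - Y" .
  qed
  then have "X + Y \<le> (Z - Y) + Y" by (rule add_right_mono)
  also have "\<dots> = Z" using \<open>Y \<le> Z\<close> Y by (simp add: diff_add_cancel_ennreal)
  finally show ?thesis .
qed simp

text \<open>The average of two measurable sets need not be measurable, so \<open>C\<close> is any
  measurable set that contains it. After the cuts, \<open>a\<close> is the greatest point of the
  first set and \<open>b\<close> the least point of the second. The halves
  \<open>(A + b) / 2\<close> and \<open>(a + B) / 2\<close> (\<open>?P\<close> and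
  \<open>?Q\<close>) then lie in \<open>C\<close> on different sides of \<open>(a + b) / 2\<close>,
  so their measures add up.\<close>

lemma brunn_minkowski_real:
  fixes A B C :: "real set"
  assumes [measurable]: "A \<in> sets borel" "B \<in> sets borel" "C \<in> sets borel"
    and ne: "A \<noteq> {}" "B \<noteq> {}"
    and sub: "\<And>x y. x \<in> A \<Longrightarrow> y \<in> B \<Longrightarrow> (x + y) / 2 \<in> C"
  shows "emeasure lborel A + emeasure lborel B \<le> 2 * emeasure lborel C"
proof -
  have key: "emeasure lborel (A \<inter> {..a}) + emeasure lborel (B \<inter> {b..}) \<le> 2 * emeasure lborel C"
    if ab: "a \<in> A" "b \<in> B" for a b
  proof -
    let ?P = "{z. 2 * z - b \<in> A \<inter> {..a}}" and ?Q = "{z. 2 * z - a \<in> B \<inter> {b..}}"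
    have *: "?P \<subseteq> C" "?Q \<subseteq> C"
      using sub[OF _ ab(2)] sub[OF ab(1)] by force+
    have P: "?P \<in> sets borel" by measurable
    have Q: "?Q \<in> sets borel" by measurable
    have i: "?P \<inter> ?Q \<subseteq> {(a + b) / 2}" by auto
    have "emeasure lborel (A \<inter> {..a}) + emeasure lborel (B \<inter> {b..}) =
        2 * (emeasure lborel ?P + emeasure lborel ?Q)"
      by (subst emeasure_lborel_halve[of "A \<inter> {..a}" b], simp,
          subst emeasure_lborel_halve[of "B \<inter> {b..}" a], simp) (simp add: distrib_left)
    also have "emeasure lborel ?Q = emeasure lborel (?Q - {(a + b) / 2})"
      using Q by (subst emeasure_Diff_null_set) auto
    also have "emeasure lborel ?P + emeasure lborel (?Q - {(a + b) / 2}) =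
        emeasure lborel (?P \<union> (?Q - {(a + b) / 2}))"
      using P Q i by (intro plus_emeasure) auto
    also have "\<dots> \<le> emeasure lborel C"
      using * by (intro emeasure_mono) auto
    finally show ?thesis by (simp add: mult_left_mono)
  qed
  have key2: "emeasure lborel A + emeasure lborel (B \<inter> {b..}) \<le> 2 * emeasure lborel C" if b: "b \<in> B" for b
  proof (rule ennreal_add_le_dense)
    fix c assume c: "c < emeasure lborel A"
    obtain a where "a \<in> A" "c < emeasure lborel (A \<inter> {..a})"
      by (rule emeasure_cut_above[OF assms(1) ne(1) c])
    then show "\<exists>x. c < x \<and> x + emeasure lborel (B \<inter> {b..}) \<le> 2 * emeasure lborel C"
      using key[OF _ b] by blast
  next
    obtain a where "a \<in> A" using ne by blast
    show "emeasure lborel (B \<inter> {b..}) \<le> 2 * emeasure lborel C"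
      by (rule order.trans[OF _ key[OF \<open>a \<in> A\<close> b]]) simp
  qed
  have "emeasure lborel B + emeasure lborel A \<le> 2 * emeasure lborel C"
  proof (rule ennreal_add_le_dense)
    fix c assume c: "c < emeasure lborel B"
    obtain b where "b \<in> B" "c < emeasure lborel (B \<inter> {b..})"
      by (rule emeasure_cut_below[OF assms(2) ne(2) c])
    then show "\<exists>x. c < x \<and> x + emeasure lborel A \<le> 2 * emeasure lborel C"
      using key2 by (auto simp: add.commute)
  next
    obtain b where "b \<in> B" using ne by blast
    show "emeasure lborel A \<le> 2 * emeasure lborel C"
      by (rule order.trans[OF _ key2[OF \<open>b \<in> B\<close>]]) simp
  qed
  then show ?thesis by (simp add: add.commute)
qed

text \<open>Only levels in (0, 1) are kept: functions bounded by 1 have no others, and truncating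
  the larger side \<open>m\<close> of the inequality to come only strengthens that
  inequality.\<close>

lemma nn_integral_layer_cake_unit:
  assumes [measurable]: "f \<in> borel_measurable lborel"
  shows "(\<integral>\<^sup>+x. min (f x) 1 \<partial>lborel) =
    (\<integral>\<^sup>+l. indicator {0<..<1} l * emeasure lborel {x::real. ennreal l < f x} \<partial>lborel)"
proof -
  have pw: "min v 1 = (\<integral>\<^sup>+l. indicator {0<..<1} l * indicator {l. ennreal l < v} (l::real) \<partial>lborel)" for v
  proof -
    have "(\<integral>\<^sup>+l. indicator {0<..<1} l * indicator {l. ennreal l < v} (l::real) \<partial>lborel) =
        (\<integral>\<^sup>+l. indicator {0<..<enn2real (min v 1)} l \<partial>lborel)"
    proof (intro nn_integral_cong)
      fix l :: real
      show "indicator {0<..<1} l * indicator {l. ennreal l < v} l = (indicator {0<..<enn2real (min v 1)} l :: ennreal)"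
      proof (cases v rule: ennreal_cases)
        case (real r)
        then show ?thesis
          by (auto simp: indicator_def min_def ennreal_less_iff ennreal_le_1)
      next
        case top
        then have "min v 1 = 1" by (simp add: min_def not_le)
        then show ?thesis using top by (auto simp: indicator_def)
      qed
    qed
    also have "\<dots> = ennreal (enn2real (min v 1))" by simp
    also have "\<dots> = min v 1"
      by (rule ennreal_enn2real, rule le_less_trans[of _ 1]) auto
    finally show ?thesis by simp
  qed
  have "(\<integral>\<^sup>+x. min (f x) 1 \<partial>lborel) =
      (\<integral>\<^sup>+x. (\<integral>\<^sup>+l. indicator {0<..<1} l * indicator {l. ennreal l < f x} (l::real) \<partial>lborel) \<partial>lborel)"
    by (simp add: pw)
  also have "\<dots> = (\<integral>\<^sup>+l. (\<integral>\<^sup>+x. indicator {0<..<1} l * indicator {l. ennreal l < f x} (l::real) \<partial>lborel) \<partial>lborel)"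
    by (rule lborel_pair.Fubini') measurable
  also have "\<dots> = (\<integral>\<^sup>+l. indicator {0<..<1} l * emeasure lborel {x::real. ennreal l < f x} \<partial>lborel)"
  proof (intro nn_integral_cong)
    fix l :: real
    have "(\<integral>\<^sup>+x. indicator {0<..<1} l * indicator {l. ennreal l < f x} (l::real) \<partial>lborel) =
      indicator {0<..<1} l * (\<integral>\<^sup>+x. indicator {x. ennreal l < f x} x \<partial>lborel)"
      by (subst nn_integral_cmult[symmetric]) (auto simp: indicator_def intro!: nn_integral_cong)
    also have "(\<integral>\<^sup>+x. indicator {x. ennreal l < f x} x \<partial>lborel) = emeasure lborel {x. ennreal l < f x}"
      by (intro nn_integral_indicator) measurable
    finally show "(\<integral>\<^sup>+x. indicator {0<..<1} l * indicator {l. ennreal l < f x} (l::real) \<partial>lborel) =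
      indicator {0<..<1} l * emeasure lborel {x. ennreal l < f x}" .
  qed
  finally show ?thesis .
qed

text \<open>When both suprema are 1, every superlevel set at a level below 1 is nonempty, so
  Brunn--Minkowski applies level by level. With different suprema there would be levels at which one
  of the two sets is empty.\<close>

lemma prekopa_leindler_real_normalized:
  fixes f g m :: "real \<Rightarrow> ennreal"
  assumes [measurable]: "f \<in> borel_measurable lborel" "g \<in> borel_measurable lborel" "m \<in> borel_measurable lborel"
    and le1: "\<And>x. f x \<le> 1" "\<And>x. g x \<le> 1"
    and sup: "\<And>l. l < 1 \<Longrightarrow> \<exists>x. l < f x" "\<And>l. l < 1 \<Longrightarrow> \<exists>x. l < g x"
    and mid: "\<And>x y. f x * g y \<le> (m ((x + y) / 2))\<^sup>2"
  shows "(\<integral>\<^sup>+x. f x \<partial>lborel) + (\<integral>\<^sup>+x. g x \<partial>lborel) \<le> 2 * (\<integral>\<^sup>+x. m x \<partial>lborel)"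
proof -
  let ?I = "\<lambda>f l. indicator {0<..<1} l * emeasure lborel {x::real. ennreal l < f x}"
  have eqs: "(\<integral>\<^sup>+x. f x \<partial>lborel) = (\<integral>\<^sup>+l. ?I f l \<partial>lborel)" "(\<integral>\<^sup>+x. g x \<partial>lborel) = (\<integral>\<^sup>+l. ?I g l \<partial>lborel)"
    using le1 by (auto simp: nn_integral_layer_cake_unit[symmetric] min_absorb1)
  have "(\<integral>\<^sup>+x. f x \<partial>lborel) + (\<integral>\<^sup>+x. g x \<partial>lborel) = (\<integral>\<^sup>+l. ?I f l + ?I g l \<partial>lborel)"
    unfolding eqs by (intro nn_integral_add[symmetric]) measurable
  also have "\<dots> \<le> (\<integral>\<^sup>+l. 2 * ?I m l \<partial>lborel)"
  proof (intro nn_integral_mono)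
    fix l :: real
    show "?I f l + ?I g l \<le> 2 * ?I m l"
    proof (cases "0 < l \<and> l < 1")
      case True
      have "emeasure lborel {x. ennreal l < f x} + emeasure lborel {x. ennreal l < g x}
          \<le> 2 * emeasure lborel {x. ennreal l < m x}"
      proof (rule brunn_minkowski_real)
        show "{x. ennreal l < f x} \<noteq> {}" "{x. ennreal l < g x} \<noteq> {}"
          using sup[of "ennreal l"] True by (auto simp: ennreal_less_one_iff)
        fix x y assume xy: "x \<in> {x. ennreal l < f x}" "y \<in> {x. ennreal l < g x}"
        have "ennreal l * ennreal l < f x * g y"
        proof (rule le_less_trans)
          show "ennreal l * ennreal l \<le> ennreal l * g y"
            using xy by (intro mult_left_mono) auto
          show "ennreal l * g y < f x * g y"
          proof (rule ennreal_mult_strict_right_mono)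
            show "0 < g y" by (rule le_less_trans[of _ "ennreal l"]) (use xy in auto)
            show "g y < \<top>" by (rule le_less_trans[OF le1(2)]) simp
          qed (use xy in simp)
        qed
        also have "\<dots> \<le> (m ((x + y) / 2))\<^sup>2" by (rule mid)
        finally have "(ennreal l)\<^sup>2 < (m ((x + y) / 2))\<^sup>2" by (simp add: power2_eq_square)
        then show "(x + y) / 2 \<in> {x. ennreal l < m x}"
          using power_mono[of "m ((x + y) / 2)" "ennreal l" 2] by (force simp: not_less[symmetric])
      qed measurable
      then show ?thesis using True by simp
    qed simp
  qed
  also have "\<dots> = 2 * (\<integral>\<^sup>+x. min (m x) 1 \<partial>lborel)"
    by (subst nn_integral_layer_cake_unit) (simp_all add: nn_integral_cmult)
  also have "\<dots> \<le> 2 * (\<integral>\<^sup>+x. m x \<partial>lborel)"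
    by (intro mult_left_mono nn_integral_mono) auto
  finally show ?thesis .
qed


lemma prekopa_leindler_real_bounded:
  fixes f g m :: "real \<Rightarrow> ennreal"
  assumes [measurable]: "f \<in> borel_measurable lborel" "g \<in> borel_measurable lborel" "m \<in> borel_measurable lborel"
    and bdd: "(SUP x. f x) < \<infinity>" "(SUP x. g x) < \<infinity>"
    and mid: "\<And>x y. f x * g y \<le> (m ((x + y) / 2))\<^sup>2"
  shows "(\<integral>\<^sup>+x. f x \<partial>lborel) * (\<integral>\<^sup>+x. g x \<partial>lborel) \<le> (\<integral>\<^sup>+x. m x \<partial>lborel)\<^sup>2"
proof (cases "(SUP x. f x) = 0 \<or> (SUP x. g x) = 0")
  case True
  then have "(\<forall>x. f x = 0) \<or> (\<forall>x. g x = 0)"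
    by (metis SUP_upper UNIV_I le_zero_eq)
  then show ?thesis by auto
next
  case False
  define a where "a = enn2real (SUP x. f x)"
  define b where "b = enn2real (SUP x. g x)"
  have a: "(SUP x. f x) = ennreal a" and b: "(SUP x. g x) = ennreal b"
    using bdd by (simp_all add: a_def b_def)
  have ab: "a > 0" "b > 0"
    using False a b by (metis ennreal_eq_0_iff not_le)+
  define F where "F = (\<lambda>x. ennreal (1 / a) * f x)"
  define G where "G = (\<lambda>x. ennreal (1 / b) * g x)"
  \<comment> \<open>Dividing \<open>m\<close> by the geometric mean of \<open>a\<close> and
    \<open>b\<close> preserves the midpoint hypothesis for \<open>F\<close> and
    \<open>G\<close>.\<close>
  define M where "M = (\<lambda>x. ennreal (1 / sqrt (a * b)) * m x)"
  have [measurable]: "F \<in> borel_measurable lborel" "G \<in> borel_measurable lborel" "M \<in> borel_measurable lborel"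
    unfolding F_def G_def M_def by measurable
  have SF: "(SUP x. F x) = 1" "(SUP x. G x) = 1"
    using ab unfolding F_def G_def SUP_mult_left_ennreal[symmetric] a b
    by (simp_all add: ennreal_mult''[symmetric])
  have "(\<integral>\<^sup>+x. F x \<partial>lborel) + (\<integral>\<^sup>+x. G x \<partial>lborel) \<le> 2 * (\<integral>\<^sup>+x. M x \<partial>lborel)"
  proof (rule prekopa_leindler_real_normalized)
    show "F x \<le> 1" "G x \<le> 1" for x using SF by (metis SUP_upper UNIV_I)+
    show "\<exists>x. l < F x" if "l < 1" for l
      using that unfolding SF(1)[symmetric] less_SUP_iff by blast
    show "\<exists>x. l < G x" if "l < 1" for l
      using that unfolding SF(2)[symmetric] less_SUP_iff by blast
    fix x y
    have "F x * G y = ennreal (1 / a) * ennreal (1 / b) * (f x * g y)"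
      by (simp add: F_def G_def mult_ac)
    also have "\<dots> \<le> ennreal (1 / a) * ennreal (1 / b) * (m ((x + y) / 2))\<^sup>2"
      by (intro mult_left_mono mid) simp
    also have "ennreal (1 / a) * ennreal (1 / b) = (ennreal (1 / sqrt (a * b)))\<^sup>2"
      using ab by (simp add: ennreal_mult''[symmetric] ennreal_power power_divide)
    finally show "F x * G y \<le> (M ((x + y) / 2))\<^sup>2"
      by (simp add: M_def power_mult_distrib)
  qed auto
  \<comment> \<open>The arithmetic-geometric mean inequality turns the sum of the normalised lemma
    into a product; the factors \<open>a\<close> and \<open>b\<close> cancel afterwards.\<close>
  moreover have "4 * (X * Y) \<le> (X + Y)\<^sup>2" for X Y :: ennreal
  proof (cases X; cases Y)
    fix r q assume *: "X = ennreal r" "0 \<le> r" "Y = ennreal q" "0 \<le> q"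
    have "4 * (r * q) \<le> (r + q)\<^sup>2" using zero_le_power2[of "r - q"] by (simp add: power2_eq_square algebra_simps)
    then show ?thesis using *
      by (simp add: ennreal_mult''[symmetric] ennreal_plus[symmetric] ennreal_power ennreal_numeral[symmetric] del: ennreal_plus ennreal_numeral)
  qed (auto simp: power2_eq_square ennreal_mult_eq_top_iff)
  ultimately have "4 * ((\<integral>\<^sup>+x. F x \<partial>lborel) * (\<integral>\<^sup>+x. G x \<partial>lborel)) \<le> (2 * (\<integral>\<^sup>+x. M x \<partial>lborel))\<^sup>2"
    by (meson order.trans power_mono zero_le)
  then have "(\<integral>\<^sup>+x. F x \<partial>lborel) * (\<integral>\<^sup>+x. G x \<partial>lborel) \<le> (\<integral>\<^sup>+x. M x \<partial>lborel)\<^sup>2"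
    by (simp add: power_mult_distrib ennreal_mult_le_mult_iff)
  then have "ennreal (a * b) * ((\<integral>\<^sup>+x. F x \<partial>lborel) * (\<integral>\<^sup>+x. G x \<partial>lborel)) \<le> ennreal (a * b) * (\<integral>\<^sup>+x. M x \<partial>lborel)\<^sup>2"
    by (rule mult_left_mono) simp
  moreover have "ennreal (a * b) * ((\<integral>\<^sup>+x. F x \<partial>lborel) * (\<integral>\<^sup>+x. G x \<partial>lborel)) =
      (ennreal a * ennreal (1 / a)) * (ennreal b * ennreal (1 / b)) * ((\<integral>\<^sup>+x. f x \<partial>lborel) * (\<integral>\<^sup>+x. g x \<partial>lborel))"
    using ab unfolding F_def G_def by (subst (1 2) nn_integral_cmult) (simp_all add: ennreal_mult mult_ac)
  moreover have "ennreal (a * b) * (\<integral>\<^sup>+x. M x \<partial>lborel)\<^sup>2 =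
      (ennreal (a * b) * (ennreal (1 / sqrt (a * b)))\<^sup>2) * (\<integral>\<^sup>+x. m x \<partial>lborel)\<^sup>2"
    unfolding M_def by (subst nn_integral_cmult) (simp_all add: power_mult_distrib mult_ac)
  moreover have "ennreal a * ennreal (1 / a) = 1" "ennreal b * ennreal (1 / b) = 1"
    "ennreal (a * b) * (ennreal (1 / sqrt (a * b)))\<^sup>2 = 1"
    using ab by (simp_all add: ennreal_mult''[symmetric] ennreal_power power_divide)
  ultimately show ?thesis by simp
qed

lemma nn_integral_SUP_truncate:
  assumes [measurable]: "f \<in> borel_measurable M"
  shows "(SUP n::nat. \<integral>\<^sup>+x. min (f x) (of_nat n) \<partial>M) = (\<integral>\<^sup>+x. f x \<partial>M)"
proof -
  have sup: "(SUP n::nat. min v (of_nat n)) = v" for v :: ennreal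
  proof (rule antisym)
    show "v \<le> (SUP n::nat. min v (of_nat n))"
    proof (rule dense_le)
      fix y assume y: "y < v"
      then have "y < \<top>" by (rule less_le_trans) simp
      then obtain n :: nat where "y \<le> of_nat n"
        using ennreal_Ex_less_of_nat[of y] by (auto intro: less_imp_le)
      then have "y \<le> min v (of_nat n)" using y by simp
      also have "\<dots> \<le> (SUP n::nat. min v (of_nat n))" by (intro SUP_upper) simp
      finally show "y \<le> (SUP n::nat. min v (of_nat n))" .
    qed
  qed (auto intro!: SUP_least)
  have "(\<integral>\<^sup>+x. f x \<partial>M) = (\<integral>\<^sup>+x. (SUP n::nat. min (f x) (of_nat n)) \<partial>M)"
    by (simp add: sup)
  also have "\<dots> = (SUP n::nat. \<integral>\<^sup>+x. min (f x) (of_nat n) \<partial>M)"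
    by (intro nn_integral_monotone_convergence_SUP)
      (auto simp: incseq_def le_fun_def intro: min.coboundedI2 of_nat_mono)
  finally show ?thesis by simp
qed

lemma prekopa_leindler_real:
  fixes f g m :: "real \<Rightarrow> ennreal"
  assumes [measurable]: "f \<in> borel_measurable lborel" "g \<in> borel_measurable lborel" "m \<in> borel_measurable lborel"
    and mid: "\<And>x y. f x * g y \<le> (m ((x + y) / 2))\<^sup>2"
  shows "(\<integral>\<^sup>+x. f x \<partial>lborel) * (\<integral>\<^sup>+x. g x \<partial>lborel) \<le> (\<integral>\<^sup>+x. m x \<partial>lborel)\<^sup>2"
proof -
  have "(\<integral>\<^sup>+x. min (f x) (of_nat n) \<partial>lborel) * (\<integral>\<^sup>+x. min (g x) (of_nat k) \<partial>lborel) \<le> (\<integral>\<^sup>+x. m x \<partial>lborel)\<^sup>2"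
    for n k :: nat
  proof (rule prekopa_leindler_real_bounded)
    have "(SUP x. min (h x) (of_nat n)) < \<infinity>" for h :: "real \<Rightarrow> ennreal" and n :: nat
      by (rule le_less_trans[of _ "of_nat n"]) (auto intro!: SUP_least simp: ennreal_of_nat_eq_real_of_nat)
    then show "(SUP x. min (f x) (of_nat n)) < \<infinity>" "(SUP x. min (g x) (of_nat k)) < \<infinity>" by blast+
    show "min (f x) (of_nat n) * min (g y) (of_nat k) \<le> (m ((x + y) / 2))\<^sup>2" for x y
      by (rule order.trans[OF mult_mono mid]) auto
  qed auto
  then have "(SUP n::nat. SUP k::nat. (\<integral>\<^sup>+x. min (f x) (of_nat n) \<partial>lborel) * (\<integral>\<^sup>+x. min (g x) (of_nat k) \<partial>lborel)) \<le> (\<integral>\<^sup>+x. m x \<partial>lborel)\<^sup>2"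
    by (intro SUP_least)
  then show ?thesis
    by (simp add: SUP_mult_left_ennreal[symmetric] SUP_mult_right_ennreal[symmetric] nn_integral_SUP_truncate)
qed

text \<open>Tensorisation: the induction hypothesis, applied to the sections at \<open>a\<close>,
  \<open>b\<close> and \<open>(a + b) / 2\<close> in coordinate \<open>k\<close>, is exactly the
  pointwise hypothesis of the one-dimensional inequality for the marginals in that
  coordinate.\<close>

lemma prekopa_leindler_PiM:
  fixes f g m :: "('i \<Rightarrow> real) \<Rightarrow> ennreal"
  assumes "finite I"
    and "f \<in> borel_measurable (PiM I (\<lambda>_. lborel))" "g \<in> borel_measurable (PiM I (\<lambda>_. lborel))"
      "m \<in> borel_measurable (PiM I (\<lambda>_. lborel))"
    and "\<And>x y. x \<in> PiE I (\<lambda>_. UNIV) \<Longrightarrow> y \<in> PiE I (\<lambda>_. UNIV) \<Longrightarrow>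
      f x * g y \<le> (m (\<lambda>i\<in>I. (x i + y i) / 2))\<^sup>2"
  shows "(\<integral>\<^sup>+x. f x \<partial>PiM I (\<lambda>_. lborel)) * (\<integral>\<^sup>+x. g x \<partial>PiM I (\<lambda>_. lborel))
    \<le> (\<integral>\<^sup>+x. m x \<partial>PiM I (\<lambda>_. lborel))\<^sup>2"
  using assms
proof (induction I arbitrary: f g m rule: finite_induct)
  case empty
  interpret product_sigma_finite "\<lambda>_. lborel" by standard
  have "f (\<lambda>_. undefined) * g (\<lambda>_. undefined) \<le> (m (\<lambda>_. undefined))\<^sup>2"
    using empty.prems(4)[of "\<lambda>_. undefined" "\<lambda>_. undefined"] by (simp add: restrict_def)
  then show ?case by (simp add: nn_integral_empty)
next
  case (insert k I)
  interpret product_sigma_finite "\<lambda>_. lborel" by standard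
  note [measurable] = insert.prems(1-3)
  have upd: "(\<lambda>i\<in>I. (x i + y i) / 2)(k := (a + b) / 2) = (\<lambda>i\<in>insert k I. ((x(k := a)) i + (y(k := b)) i) / 2)"
    for x y :: "'i \<Rightarrow> real" and a b
    using insert.hyps(2) by (auto simp: restrict_def fun_eq_iff)
  interpret I: sigma_finite_measure "PiM I (\<lambda>_. lborel :: real measure)" by (rule sigma_finite[OF insert.hyps(1)])
  have sec: "(\<lambda>x. h (x(k := a))) \<in> borel_measurable (PiM I (\<lambda>_. lborel))"
    if [measurable]: "h \<in> borel_measurable (PiM (insert k I) (\<lambda>_. lborel))" for h :: "('i \<Rightarrow> real) \<Rightarrow> ennreal" and a
    by measurable
  have marg: "(\<lambda>a. \<integral>\<^sup>+x. h (x(k := a)) \<partial>PiM I (\<lambda>_. lborel)) \<in> borel_measurable lborel"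
    if [measurable]: "h \<in> borel_measurable (PiM (insert k I) (\<lambda>_. lborel))" for h :: "('i \<Rightarrow> real) \<Rightarrow> ennreal"
    by measurable
  show ?case
    unfolding product_nn_integral_insert_rev[OF insert.hyps insert.prems(1)]
      product_nn_integral_insert_rev[OF insert.hyps insert.prems(2)]
      product_nn_integral_insert_rev[OF insert.hyps insert.prems(3)]
  proof (rule prekopa_leindler_real)
    fix a b
    show "(\<integral>\<^sup>+x. f (x(k := a)) \<partial>PiM I (\<lambda>_. lborel)) * (\<integral>\<^sup>+x. g (x(k := b)) \<partial>PiM I (\<lambda>_. lborel))
      \<le> (\<integral>\<^sup>+x. m (x(k := (a + b) / 2)) \<partial>PiM I (\<lambda>_. lborel))\<^sup>2"
    proof (rule insert.IH)
      fix x y :: "'i \<Rightarrow> real" assume xy: "x \<in> PiE I (\<lambda>_. UNIV)" "y \<in> PiE I (\<lambda>_. UNIV)"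
      have "x(k := a) \<in> PiE (insert k I) (\<lambda>_. UNIV)" "y(k := b) \<in> PiE (insert k I) (\<lambda>_. UNIV)"
        using xy by (auto simp: PiE_def extensional_def)
      from insert.prems(4)[OF this]
      show "f (x(k := a)) * g (y(k := b)) \<le> (m ((\<lambda>i\<in>I. (x i + y i) / 2)(k := (a + b) / 2)))\<^sup>2"
        unfolding upd .
    qed (intro sec insert.prems)+
  qed (intro marg insert.prems)+
qed

subsection \<open>Lebesgue measure and convex sets\<close>

text \<open>Serves the dilations in \<open>convex_AE_interior\<close> and the substitution that
  turns the Gaussian noise into the transition kernel. As all coordinates are scaled by the same
  \<open>c\<close>, iterating the one-dimensional rule suffices.\<close>

lemma nn_integral_PiM_affine:
  fixes f :: "('i \<Rightarrow> real) \<Rightarrow> ennreal" and a :: "'i \<Rightarrow> real"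
  assumes "finite I" "c \<noteq> 0" "f \<in> borel_measurable (PiM I (\<lambda>_. lborel))"
  shows "(\<integral>\<^sup>+x. f x \<partial>PiM I (\<lambda>_. lborel)) =
    ennreal (\<bar>c\<bar> ^ card I) * (\<integral>\<^sup>+x. f (\<lambda>i\<in>I. a i + c * x i) \<partial>PiM I (\<lambda>_. lborel))"
  using assms
proof (induction I arbitrary: f rule: finite_induct)
  case empty
  interpret product_sigma_finite "\<lambda>_. lborel" by standard
  show ?case by (simp add: PiM_empty nn_integral_count_space_finite restrict_def)
next
  case (insert k I)
  interpret product_sigma_finite "\<lambda>_. lborel" by standard
  note [measurable] = insert.prems(2)
  interpret I: sigma_finite_measure "PiM I (\<lambda>_. lborel :: real measure)" by (rule sigma_finite[OF insert.hyps(1)])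
  let ?L = "PiM I (\<lambda>_. lborel) :: ('i \<Rightarrow> real) measure"
  have upd: "(\<lambda>i\<in>I. a i + c * x i)(k := a k + c * y) = (\<lambda>i\<in>insert k I. a i + c * (x(k := y)) i)"
    for x :: "'i \<Rightarrow> real" and y
    using insert.hyps(2) by (auto simp: restrict_def fun_eq_iff)
  have [measurable]: "(\<lambda>x. \<lambda>i\<in>J. a i + c * x i) \<in> PiM J (\<lambda>_. lborel) \<rightarrow>\<^sub>M PiM J (\<lambda>_. lborel)" for J :: "'i set"
    by measurable
  have "(\<integral>\<^sup>+x. f x \<partial>PiM (insert k I) (\<lambda>_. lborel)) = (\<integral>\<^sup>+y. (\<integral>\<^sup>+x. f (x(k := y)) \<partial>?L) \<partial>lborel)"
    by (rule product_nn_integral_insert_rev[OF insert.hyps insert.prems(2)])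
  also have "\<dots> = (\<integral>\<^sup>+y. ennreal (\<bar>c\<bar> ^ card I) * (\<integral>\<^sup>+x. f ((\<lambda>i\<in>I. a i + c * x i)(k := y)) \<partial>?L) \<partial>lborel)"
    by (intro nn_integral_cong insert.IH insert.prems) measurable
  also have "\<dots> = ennreal (\<bar>c\<bar> ^ card I) * (\<integral>\<^sup>+y. (\<integral>\<^sup>+x. f ((\<lambda>i\<in>I. a i + c * x i)(k := y)) \<partial>?L) \<partial>lborel)"
    by (rule nn_integral_cmult) measurable
  also have "(\<integral>\<^sup>+y. (\<integral>\<^sup>+x. f ((\<lambda>i\<in>I. a i + c * x i)(k := y)) \<partial>?L) \<partial>lborel) =
      \<bar>c\<bar> * (\<integral>\<^sup>+y. (\<integral>\<^sup>+x. f ((\<lambda>i\<in>I. a i + c * x i)(k := a k + c * y)) \<partial>?L) \<partial>lborel)"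
    using insert.prems by (intro nn_integral_real_affine) measurable
  also have "(\<integral>\<^sup>+y. (\<integral>\<^sup>+x. f ((\<lambda>i\<in>I. a i + c * x i)(k := a k + c * y)) \<partial>?L) \<partial>lborel) =
     (\<integral>\<^sup>+x. f (\<lambda>i\<in>insert k I. a i + c * x i) \<partial>PiM (insert k I) (\<lambda>_. lborel))"
    unfolding upd by (rule product_nn_integral_insert_rev[OF insert.hyps, symmetric]) measurable
  finally have "(\<integral>\<^sup>+x. f x \<partial>PiM (insert k I) (\<lambda>_. lborel)) = ennreal (\<bar>c\<bar> ^ card I) *
    (\<bar>c\<bar> * (\<integral>\<^sup>+x. f (\<lambda>i\<in>insert k I. a i + c * x i) \<partial>PiM (insert k I) (\<lambda>_. lborel)))" .
  moreover have "ennreal (\<bar>c\<bar> ^ card (insert k I)) = ennreal (\<bar>c\<bar> ^ card I) * \<bar>c\<bar>"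
    using insert.hyps by (simp add: ennreal_mult'' mult.commute)
  ultimately show ?case by (simp only: mult.assoc)
qed

section \<open>Convex sets of positive measure\<close>

definition convex_Rd :: "'i set \<Rightarrow> ('i \<Rightarrow> real) set \<Rightarrow> bool" where
  "convex_Rd I D \<longleftrightarrow> (\<forall>x\<in>D. \<forall>y\<in>D. \<forall>r. 0 < r \<and> r < 1 \<longrightarrow> (\<lambda>i\<in>I. (1 - r) * x i + r * y i) \<in> D)"

definition cube :: "'i set \<Rightarrow> ('i \<Rightarrow> real) \<Rightarrow> real \<Rightarrow> ('i \<Rightarrow> real) set" where
  "cube I x e = {y \<in> PiE I (\<lambda>_. UNIV). \<forall>i\<in>I. \<bar>y i - x i\<bar> < e}"

lemma cube_eq_PiE: "cube I x e = PiE I (\<lambda>i. {x i - e<..<x i + e})"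
proof -
  have "\<And>y i. \<bar>y i - x i\<bar> < e \<longleftrightarrow> y i \<in> {x i - e<..<x i + e}" by auto
  then show ?thesis unfolding cube_def by (auto simp: PiE_def Pi_def)
qed

lemma cube_mono: "e \<le> e' \<Longrightarrow> cube I x e \<subseteq> cube I x e'"
  unfolding cube_def by force

text \<open>By Fubini, a single slice cannot carry positive measure, so two parallel slices of
  \<open>D\<close> are not null. By induction each contains a cube of one dimension less, and the
  convex hull of these two contains a full cube around the midpoint of their centres.\<close>

lemma convex_contains_cube:
  fixes D :: "('i \<Rightarrow> real) set"
  assumes "finite I" "D \<in> sets (PiM I (\<lambda>_. lborel))" "convex_Rd I D" "emeasure (PiM I (\<lambda>_. lborel)) D \<noteq> 0"
  shows "\<exists>c\<in>PiE I (\<lambda>_. UNIV). \<exists>e>0. cube I c e \<subseteq> D"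
  using assms
proof (induction I arbitrary: D rule: finite_induct)
  case empty
  have "D \<noteq> {}" using empty.prems by auto
  moreover have "D \<subseteq> space (PiM {} (\<lambda>_. lborel))" using empty.prems(1) by (rule sets.sets_into_space)
  ultimately have "(\<lambda>_. undefined) \<in> D" by (auto simp: space_PiM)
  then show ?case by (auto simp: cube_def intro!: exI[of _ "1::real"])
next
  case (insert k I)
  interpret product_sigma_finite "\<lambda>_. lborel" by standard
  let ?L = "PiM I (\<lambda>_. lborel) :: ('i \<Rightarrow> real) measure"
  note [measurable] = insert.prems(1)
  define S where "S s = {x \<in> space ?L. x(k := s) \<in> D}" for s
  have Sm [measurable]: "S s \<in> sets ?L" for s
    unfolding S_def by measurable
  have ext: "D \<subseteq> PiE (insert k I) (\<lambda>_. UNIV)"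
    using sets.sets_into_space[OF insert.prems(1)] by (simp add: space_PiM)
  have emD: "emeasure (PiM (insert k I) (\<lambda>_. lborel)) D = (\<integral>\<^sup>+s. emeasure ?L (S s) \<partial>lborel)"
  proof -
    have "emeasure (PiM (insert k I) (\<lambda>_. lborel)) D = (\<integral>\<^sup>+x. indicator D x \<partial>PiM (insert k I) (\<lambda>_. lborel))"
      by simp
    also have "\<dots> = (\<integral>\<^sup>+s. (\<integral>\<^sup>+x. indicator D (x(k := s)) \<partial>?L) \<partial>lborel)"
      by (rule product_nn_integral_insert_rev[OF insert.hyps]) measurable
    also have "\<dots> = (\<integral>\<^sup>+s. emeasure ?L (S s) \<partial>lborel)"
    proof (intro nn_integral_cong)
      fix s
      have "(\<integral>\<^sup>+x. indicator D (x(k := s)) \<partial>?L) = (\<integral>\<^sup>+x. indicator (S s) x \<partial>?L)"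
        by (intro nn_integral_cong) (auto simp: S_def indicator_def)
      then show "(\<integral>\<^sup>+x. indicator D (x(k := s)) \<partial>?L) = emeasure ?L (S s)" by simp
    qed
    finally show ?thesis .
  qed
  obtain s1 s2 where s: "s1 < s2" "emeasure ?L (S s1) \<noteq> 0" "emeasure ?L (S s2) \<noteq> 0"
  proof -
    have "\<exists>s1 s2. s1 < s2 \<and> emeasure ?L (S s1) \<noteq> 0 \<and> emeasure ?L (S s2) \<noteq> 0"
    proof (rule ccontr)
      assume no: "\<not> ?thesis"
      have one: "s1 = s2" if "emeasure ?L (S s1) \<noteq> 0" "emeasure ?L (S s2) \<noteq> 0" for s1 s2
        using no that by (cases s1 s2 rule: linorder_cases) blast+
      \<comment> \<open>By \<open>one\<close>, at most one level has a slice of positive measure;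
        \<open>s0\<close> is that level if it exists.\<close>
      define s0 where "s0 = (SOME s. emeasure ?L (S s) \<noteq> 0)"
      have "emeasure ?L (S s) = 0" if "s \<noteq> s0" for s
      proof (rule ccontr)
        assume s: "emeasure ?L (S s) \<noteq> 0"
        then have "emeasure ?L (S s0) \<noteq> 0" unfolding s0_def by (rule someI)
        from one[OF s this] that show False by simp
      qed
      moreover have "AE s in lborel. s \<noteq> s0" by (rule AE_lborel_singleton)
      ultimately have "(\<integral>\<^sup>+s. emeasure ?L (S s) \<partial>lborel) = integral\<^sup>N lborel (\<lambda>_::real. 0)"
        by (intro nn_integral_cong_AE) (auto elim: eventually_mono)
      then show False using emD insert.prems(3) by simp
    qed
    then show ?thesis using that by blast
  qed
  have cvx: "convex_Rd I (S s)" for s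
    unfolding convex_Rd_def
  proof (intro ballI allI impI)
    fix x y and r :: real assume xy: "x \<in> S s" "y \<in> S s" and r: "0 < r \<and> r < 1"
    have "(\<lambda>i\<in>insert k I. (1 - r) * (x(k := s)) i + r * (y(k := s)) i) \<in> D"
      using insert.prems(2) xy r unfolding convex_Rd_def S_def by blast
    moreover have "(\<lambda>i\<in>insert k I. (1 - r) * (x(k := s)) i + r * (y(k := s)) i) = (\<lambda>i\<in>I. (1 - r) * x i + r * y i)(k := s)"
      using insert.hyps(2) by (auto simp: restrict_def fun_eq_iff algebra_simps)
    ultimately show "(\<lambda>i\<in>I. (1 - r) * x i + r * y i) \<in> S s"
      unfolding S_def by (auto simp: space_PiM)
  qed
  obtain c1 e1 where 1: "c1 \<in> PiE I (\<lambda>_. UNIV)" "e1 > 0" "cube I c1 e1 \<subseteq> S s1"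
    using insert.IH[OF Sm cvx s(2)] by blast
  obtain c2 e2 where 2: "c2 \<in> PiE I (\<lambda>_. UNIV)" "e2 > 0" "cube I c2 e2 \<subseteq> S s2"
    using insert.IH[OF Sm cvx s(3)] by blast
  define e0 where "e0 = min e1 e2"
  define B where "B = 1 + (\<Sum>i\<in>I. \<bar>c2 i - c1 i\<bar>)"
  have B: "B > 0" "\<And>i. i \<in> I \<Longrightarrow> \<bar>c2 i - c1 i\<bar> \<le> B"
  proof -
    show "B > 0" unfolding B_def by (simp add: add_pos_nonneg sum_nonneg)
    show "\<bar>c2 i - c1 i\<bar> \<le> B" if "i \<in> I" for i
      using member_le_sum[of i I "\<lambda>i. \<bar>c2 i - c1 i\<bar>"] that insert.hyps(1) unfolding B_def by simp
  qed
  have e0: "e0 > 0" using 1 2 by (simp add: e0_def)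
  \<comment> \<open>The first term bounds the offset from the midpoint of the two centres, the
    second keeps \<open>r\<close> strictly between 0 and 1, and the third makes the drift
    \<open>\<bar>r - 1 / 2\<bar> * B\<close> along the line of centres at most
    \<open>e0 / 2\<close>.\<close>
  define e where "e = min (e0 / 2) (min ((s2 - s1) / 2) (e0 * (s2 - s1) / (2 * B)))"
  have e: "e > 0" using e0 s B by (simp add: e_def)
  define c where "c = (\<lambda>i\<in>I. (c1 i + c2 i) / 2)(k := (s1 + s2) / 2)"
  have "cube (insert k I) c e \<subseteq> D"
  proof
    fix x assume x: "x \<in> cube (insert k I) c e"
    define r where "r = (x k - s1) / (s2 - s1)"
    have xk: "\<bar>x k - (s1 + s2) / 2\<bar> < e" using x by (auto simp: cube_def c_def)
    have r01: "0 < r" "r < 1"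
      using xk s(1) unfolding e_def r_def by (auto simp: field_simps abs_less_iff)
    have rh: "\<bar>r - 1 / 2\<bar> * B \<le> e0 / 2"
    proof -
      have "r - 1 / 2 = (x k - (s1 + s2) / 2) / (s2 - s1)"
        using s(1) by (simp add: r_def field_simps)
      then have "\<bar>r - 1 / 2\<bar> = \<bar>x k - (s1 + s2) / 2\<bar> / (s2 - s1)" using s(1) by simp
      also have "\<dots> \<le> (e0 * (s2 - s1) / (2 * B)) / (s2 - s1)"
        using xk s(1) unfolding e_def by (intro divide_right_mono) auto
      also have "\<dots> = e0 / (2 * B)" using s(1) by simp
      finally show ?thesis using B(1) by (simp add: field_simps)
    qed
    \<comment> \<open>The same displacement \<open>w\<close> is used in both slices:
      \<open>x\<close> lies on the segment from \<open>c1 + w\<close> at level \<open>s1\<close> to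
      \<open>c2 + w\<close> at level \<open>s2\<close>.\<close>
    define w where "w i = x i - ((1 - r) * c1 i + r * c2 i)" for i
    have w: "\<bar>w i\<bar> < e0" if i: "i \<in> I" for i
    proof -
      have ik: "i \<noteq> k" using i insert.hyps(2) by auto
      have xi: "\<bar>x i - (c1 i + c2 i) / 2\<bar> < e" using x i ik by (auto simp: cube_def c_def)
      have "w i = (x i - (c1 i + c2 i) / 2) - (r - 1 / 2) * (c2 i - c1 i)"
        by (simp add: w_def field_simps)
      then have "\<bar>w i\<bar> \<le> \<bar>x i - (c1 i + c2 i) / 2\<bar> + \<bar>r - 1 / 2\<bar> * \<bar>c2 i - c1 i\<bar>"
        using abs_triangle_ineq4[of "x i - (c1 i + c2 i) / 2" "(r - 1 / 2) * (c2 i - c1 i)"] by (simp add: abs_mult)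
      also have "\<bar>r - 1 / 2\<bar> * \<bar>c2 i - c1 i\<bar> \<le> \<bar>r - 1 / 2\<bar> * B"
        using B(2)[OF i] by (intro mult_left_mono) auto
      also have "\<dots> \<le> e0 / 2" by (rule rh)
      finally show ?thesis using xi unfolding e_def by linarith
    qed
    have m1: "(\<lambda>i\<in>I. c1 i + w i) \<in> S s1" and m2: "(\<lambda>i\<in>I. c2 i + w i) \<in> S s2"
      using 1(3) 2(3) w by (force simp: cube_def e0_def)+
    have "(\<lambda>i\<in>insert k I. (1 - r) * ((\<lambda>i\<in>I. c1 i + w i)(k := s1)) i + r * ((\<lambda>i\<in>I. c2 i + w i)(k := s2)) i) \<in> D"
      using insert.prems(2) m1 m2 r01 unfolding convex_Rd_def S_def by blast
    also have "(\<lambda>i\<in>insert k I. (1 - r) * ((\<lambda>i\<in>I. c1 i + w i)(k := s1)) i + r * ((\<lambda>i\<in>I. c2 i + w i)(k := s2)) i) = x"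
    proof
      fix i
      have "(1 - r) * s1 + r * s2 = x k"
      proof -
        have "(1 - r) * s1 + r * s2 = s1 + r * (s2 - s1)" by (simp add: algebra_simps)
        then show ?thesis using s(1) by (simp add: r_def)
      qed
      moreover have "i \<in> I \<Longrightarrow> (1 - r) * (c1 i + w i) + r * (c2 i + w i) = x i"
        by (simp add: w_def algebra_simps)
      moreover have "i \<notin> insert k I \<Longrightarrow> x i = undefined"
        using x by (auto simp: cube_def PiE_def extensional_def)
      ultimately show "(\<lambda>i\<in>insert k I. (1 - r) * ((\<lambda>i\<in>I. c1 i + w i)(k := s1)) i + r * ((\<lambda>i\<in>I. c2 i + w i)(k := s2)) i) i = x i"
        using insert.hyps(2) by auto
    qed
    finally show "x \<in> D" .
  qed
  moreover have "c \<in> PiE (insert k I) (\<lambda>_. UNIV)"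
    by (auto simp: c_def PiE_def extensional_def)
  ultimately show ?case using e by blast
qed

section \<open>Topology and open sets of \<open>Rd d\<close>\<close>

lemma upd_in_Rd: "x \<in> Rd d \<Longrightarrow> i < d \<Longrightarrow> x(i := r) \<in> Rd d"
  by (auto simp: Rd_def PiE_def extensional_def)

lemma restrict_in_Rd: "(\<lambda>i\<in>{..<d}. f i) \<in> Rd d"
  by (simp add: Rd_def)

lemma lincomb_in_Rd: "lincomb d r x s y \<in> Rd d"
  by (simp add: lincomb_def restrict_in_Rd)

lemma Rd_eqI: "x \<in> Rd d \<Longrightarrow> y \<in> Rd d \<Longrightarrow> (\<And>i. i < d \<Longrightarrow> x i = y i) \<Longrightarrow> x = y"
  unfolding Rd_def by (rule PiE_ext) auto

lemma cube_Rd: "cube {..<d} x e = {y \<in> Rd d. \<forall>i<d. \<bar>y i - x i\<bar> < e}"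
  by (auto simp: cube_def Rd_def)

lemma openin_cube: "openin (Rd_top d) (cube {..<d} x e)"
  unfolding cube_eq_PiE Rd_top_def by (subst openin_PiE) auto

lemma openin_Rd_top:
  "openin (Rd_top d) U \<longleftrightarrow> U \<subseteq> Rd d \<and> (\<forall>x\<in>U. \<exists>e>0. cube {..<d} x e \<subseteq> U)"
proof (intro iffI conjI ballI)
  assume U: "openin (Rd_top d) U"
  show "U \<subseteq> Rd d" using openin_subset[OF U] by (simp add: topspace_Rd_top)
  fix x assume x: "x \<in> U"
  have "\<exists>V. finite {i \<in> {..<d}. V i \<noteq> topspace euclideanreal} \<and> (\<forall>i\<in>{..<d}. openin euclideanreal (V i)) \<and>
      x \<in> PiE {..<d} V \<and> PiE {..<d} V \<subseteq> U"
    using U x unfolding Rd_top_def openin_product_topology_alt by blast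
  then obtain V where V: "\<And>i. i < d \<Longrightarrow> open (V i)" "x \<in> PiE {..<d} V" "PiE {..<d} V \<subseteq> U"
    by auto
  have "\<exists>e>0. \<forall>y. \<bar>y - x i\<bar> < e \<longrightarrow> y \<in> V i" if "i < d" for i
    using V(1)[OF that] V(2) that unfolding open_dist dist_real_def by (auto simp: PiE_iff)
  then obtain e where e: "\<And>i. i < d \<Longrightarrow> e i > 0" "\<And>i y. i < d \<Longrightarrow> \<bar>y - x i\<bar> < e i \<Longrightarrow> y \<in> V i"
    by metis
  \<comment> \<open>The entry 1 keeps the minimum meaningful when \<open>d = 0\<close>.\<close>
  let ?e = "Min (insert 1 (e ` {..<d}))"
  have "?e > 0" using e(1) by (subst Min_gr_iff) auto
  moreover have le: "?e \<le> e i" if "i < d" for i using that by (intro Min_le) auto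
  have "cube {..<d} x ?e \<subseteq> PiE {..<d} V"
  proof
    fix y assume y: "y \<in> cube {..<d} x ?e"
    have "y i \<in> V i" if "i < d" for i
      using y e(2)[OF that, of "y i"] le[OF that] that unfolding cube_def by force
    then show "y \<in> PiE {..<d} V" using y by (auto simp: cube_def PiE_iff)
  qed
  ultimately show "\<exists>e>0. cube {..<d} x e \<subseteq> U" using V(3) by (meson order.trans)
next
  assume U: "U \<subseteq> Rd d \<and> (\<forall>x\<in>U. \<exists>e>0. cube {..<d} x e \<subseteq> U)"
  show "openin (Rd_top d) U"
  proof (subst openin_subopen, intro ballI)
    fix x assume x: "x \<in> U"
    then obtain e where "e > 0" "cube {..<d} x e \<subseteq> U" using U by blast
    moreover have "x \<in> cube {..<d} x e" using x U \<open>e > 0\<close> by (auto simp: cube_Rd)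
    ultimately show "\<exists>T. openin (Rd_top d) T \<and> x \<in> T \<and> T \<subseteq> U" using openin_cube by blast
  qed
qed

lemma interior_of_Rd_top:
  "x \<in> Rd_top d interior_of D \<longleftrightarrow> x \<in> Rd d \<and> (\<exists>e>0. cube {..<d} x e \<subseteq> D)"
proof
  assume "x \<in> Rd_top d interior_of D"
  then obtain T where "openin (Rd_top d) T" "x \<in> T" "T \<subseteq> D" unfolding interior_of_def by auto
  then show "x \<in> Rd d \<and> (\<exists>e>0. cube {..<d} x e \<subseteq> D)"
    unfolding openin_Rd_top by blast
next
  assume "x \<in> Rd d \<and> (\<exists>e>0. cube {..<d} x e \<subseteq> D)"
  then obtain e where "x \<in> Rd d" "e > 0" "cube {..<d} x e \<subseteq> D" by blast
  moreover from this have "x \<in> cube {..<d} x e" by (auto simp: cube_Rd)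
  ultimately show "x \<in> Rd_top d interior_of D"
    unfolding interior_of_def using openin_cube by blast
qed

lemma cube_measurable [measurable]: "cube {..<d} x e \<in> sets (lebesgue_Rd d)"
  unfolding cube_eq_PiE lebesgue_Rd_def by (intro sets_PiM_I_finite) auto

text \<open>An open set is the union of the cubes inside it with rational centres and radii
  \<open>1 / Suc n\<close>. There are countably many of them, and each is a product of intervals,
  hence in the product sigma-algebra.\<close>

lemma openin_Rd_top_measurable:
  assumes "openin (Rd_top d) U"
  shows "U \<in> sets (lebesgue_Rd d)"
proof -
  let ?Q = "PiE {..<d} (\<lambda>_. \<rat>) :: point set"
  let ?F = "{(q, n). q \<in> ?Q \<and> cube {..<d} q (1 / Suc n) \<subseteq> U} :: (point \<times> nat) set"
  have "countable ?Q" by (intro countable_PiE countable_rat) auto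
  then have cF: "countable ?F"
    by (rule countable_subset[rotated, OF countable_SIGMA[of _ "\<lambda>_. UNIV"]]) auto
  have "U = (\<Union>(q, n)\<in>?F. cube {..<d} q (1 / Suc n))"
  proof (intro equalityI subsetI)
    fix x assume x: "x \<in> U"
    then have xR: "x \<in> Rd d" using assms unfolding openin_Rd_top by blast
    obtain e where e: "e > 0" "cube {..<d} x e \<subseteq> U" using assms x unfolding openin_Rd_top by blast
    obtain n where n: "1 / Suc n < e / 2"
      using reals_Archimedean[of "e / 2"] e by (auto simp: inverse_eq_divide)
    have "\<exists>q\<in>\<rat>. \<bar>q - x i\<bar> < 1 / Suc n" for i
    proof -
      obtain q where "q \<in> \<rat>" "x i < q" "q < x i + 1 / Suc n"
        using Rats_dense_in_real[of "x i" "x i + 1 / Suc n"] by auto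
      then show ?thesis by (intro bexI[of _ q]) auto
    qed
    then obtain q where q: "\<And>i. q i \<in> \<rat>" "\<And>i. \<bar>q i - x i\<bar> < 1 / Suc n" by metis
    let ?q = "\<lambda>i\<in>{..<d}. q i"
    have "cube {..<d} ?q (1 / Suc n) \<subseteq> cube {..<d} x e"
    proof
      fix y assume y: "y \<in> cube {..<d} ?q (1 / Suc n)"
      have "\<bar>y i - x i\<bar> < e" if "i < d" for i
      proof -
        have "\<bar>y i - q i\<bar> < 1 / Suc n" using y that by (auto simp: cube_Rd)
        with q(2)[of i] n show ?thesis by linarith
      qed
      then show "y \<in> cube {..<d} x e" using y by (auto simp: cube_Rd)
    qed
    moreover have "x \<in> cube {..<d} ?q (1 / Suc n)"
      using q(2) xR by (auto simp: cube_Rd abs_minus_commute)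
    moreover have "?q \<in> ?Q" using q by auto
    ultimately show "x \<in> (\<Union>(q, n)\<in>?F. cube {..<d} q (1 / Suc n))" using e by blast
  qed auto
  also have "\<dots> \<in> sets (lebesgue_Rd d)"
    using cF by (intro sets.countable_UN') auto
  finally show ?thesis .
qed

lemma openin_Rd_top_emeasure_pos:
  assumes U: "openin (Rd_top d) U" and "U \<noteq> {}"
  shows "emeasure (lebesgue_Rd d) U > 0"
proof -
  interpret product_sigma_finite "\<lambda>_. lborel" by standard
  obtain x e where x: "x \<in> U" "e > 0" "cube {..<d} x e \<subseteq> U"
    using assms unfolding openin_Rd_top by blast
  have "emeasure (lebesgue_Rd d) (cube {..<d} x e) = (\<Prod>i<d. ennreal (2 * e))"
    unfolding cube_eq_PiE lebesgue_Rd_def using x by (subst emeasure_PiM) auto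
  also have "\<dots> > 0" using x by (simp add: ennreal_power)
  finally show ?thesis
    using emeasure_mono[OF x(3) openin_Rd_top_measurable[OF U]] by order
qed

text \<open>The homothety with centre \<open>x\<close> and ratio \<open>1 - r\<close> maps a cube
  around \<open>x0\<close> onto a cube around the given point, and convexity keeps the image in
  \<open>D\<close>. The case \<open>r = 0\<close> is apart because \<open>convex_Rd\<close> speaks
  of \<open>0 < r < 1\<close> only.\<close>

lemma interior_of_segment:
  assumes D: "convex_Rd {..<d} D" and x0: "x0 \<in> Rd_top d interior_of D"
    and x: "x \<in> D" "x \<in> Rd d" and r: "0 \<le> r" "r < 1"
  shows "lincomb d (1 - r) x0 r x \<in> Rd_top d interior_of D"
proof (cases "r = 0")
  case True
  have "lincomb d 1 x0 0 x = x0"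
    using x0 by (intro Rd_eqI[OF lincomb_in_Rd]) (auto simp: interior_of_Rd_top lincomb_def)
  then show ?thesis using x0 True by simp
next
  case False
  obtain e where e: "e > 0" "cube {..<d} x0 e \<subseteq> D" using x0 unfolding interior_of_Rd_top by blast
  have "cube {..<d} (lincomb d (1 - r) x0 r x) ((1 - r) * e) \<subseteq> D"
  proof
    fix y assume y: "y \<in> cube {..<d} (lincomb d (1 - r) x0 r x) ((1 - r) * e)"
    let ?z = "\<lambda>i\<in>{..<d}. (y i - r * x i) / (1 - r)"
    have "?z \<in> cube {..<d} x0 e"
      unfolding cube_Rd
    proof (intro CollectI conjI allI impI restrict_in_Rd)
      fix i assume i: "i < d"
      then have "\<bar>y i - ((1 - r) * x0 i + r * x i)\<bar> < (1 - r) * e"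
        using y by (auto simp: cube_Rd lincomb_def)
      moreover have "y i - ((1 - r) * x0 i + r * x i) = (1 - r) * (?z i - x0 i)"
        using i r by (simp add: field_simps)
      ultimately show "\<bar>?z i - x0 i\<bar> < e" using r by (simp add: abs_mult)
    qed
    then have "?z \<in> D" using e by blast
    then have "(\<lambda>i\<in>{..<d}. (1 - r) * ?z i + r * x i) \<in> D"
      using D x(1) r False unfolding convex_Rd_def by auto
    also have "(\<lambda>i\<in>{..<d}. (1 - r) * ?z i + r * x i) = y"
      using r y by (intro Rd_eqI[OF restrict_in_Rd]) (auto simp: cube_Rd)
    finally show "y \<in> D" .
  qed
  then show ?thesis using e r unfolding interior_of_Rd_top
    by (intro conjI lincomb_in_Rd exI[of _ "(1 - r) * e"]) auto
qed

text \<open>A ray from an interior point meets \<open>D - interior D\<close> at most once; average over the dilations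
  with factor \<open>r \<in> (1, 2)\<close>.\<close>

lemma convex_AE_interior:
  assumes D [measurable]: "D \<in> sets (lebesgue_Rd d)" and cvx: "convex_Rd {..<d} D"
  shows "AE x in lebesgue_Rd d. x \<in> D \<longrightarrow> x \<in> Rd_top d interior_of D"
proof (cases "emeasure (lebesgue_Rd d) D = 0")
  case True
  then show ?thesis using AE_not_in[of D "lebesgue_Rd d"] D by (auto simp: null_sets_def elim: eventually_mono)
next
  case False
  obtain x0 where x0: "x0 \<in> Rd_top d interior_of D"
    using convex_contains_cube[of "{..<d}" D] D cvx False unfolding lebesgue_Rd_def
    by (auto simp: interior_of_Rd_top Rd_def)
  have DR: "D \<subseteq> Rd d" using sets.sets_into_space[OF D] by (simp add: space_lebesgue_Rd)
  define F where "F = D - Rd_top d interior_of D"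
  have F [measurable]: "F \<in> sets (lebesgue_Rd d)"
    unfolding F_def by (intro sets.Diff D openin_Rd_top_measurable openin_interior_of)
  let ?l = "\<lambda>r x. lincomb d (1 - r) x0 r x"
  have [measurable]: "(\<lambda>(r, x). ?l r x) \<in> lborel \<Otimes>\<^sub>M lebesgue_Rd d \<rightarrow>\<^sub>M lebesgue_Rd d"
    unfolding lincomb_def lebesgue_Rd_def by measurable
  interpret product_sigma_finite "\<lambda>_. lborel" by standard
  interpret R: sigma_finite_measure "lebesgue_Rd d"
    unfolding lebesgue_Rd_def by (rule sigma_finite) simp
  interpret P: pair_sigma_finite lborel "lebesgue_Rd d" by standard
  have one: "r1 = r2" if "?l r1 x \<in> F" "?l r2 x \<in> F" "0 < r1" "r1 \<le> r2" for r1 r2 x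
  proof (rule ccontr)
    assume "r1 \<noteq> r2"
    have "?l (r1 / r2) (?l r2 x) \<in> Rd_top d interior_of D"
      using that \<open>r1 \<noteq> r2\<close> DR by (intro interior_of_segment[OF cvx x0]) (auto simp: F_def)
    moreover have "?l (r1 / r2) (?l r2 x) = ?l r1 x"
      using that by (intro Rd_eqI[OF lincomb_in_Rd lincomb_in_Rd]) (auto simp: lincomb_def field_simps)
    ultimately show False using that by (auto simp: F_def)
  qed
  have line: "(\<integral>\<^sup>+r. indicator {1<..<2} r * indicator F (?l r x) \<partial>lborel) = 0" for x
  proof -
    define r0 where "r0 = (SOME r. 0 < r \<and> ?l r x \<in> F)"
    have "r = r0" if "0 < r" "?l r x \<in> F" for r
    proof -
      have "0 < r0 \<and> ?l r0 x \<in> F" using that unfolding r0_def by (metis (mono_tags, lifting) someI_ex)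
      then show ?thesis using one[of r x r0] one[of r0 x r] that by linarith
    qed
    then have "indicator {1<..<2} r * indicator F (?l r x) = (0::ennreal)" if "r \<noteq> r0" for r
      using that by (auto simp: indicator_def)
    then have "(\<integral>\<^sup>+r. indicator {1<..<2} r * indicator F (?l r x) \<partial>lborel) = integral\<^sup>N lborel (\<lambda>_::real. 0)"
      using AE_lborel_singleton[of r0] by (intro nn_integral_cong_AE) (auto elim: eventually_mono)
    then show ?thesis by simp
  qed
  have scale: "emeasure (lebesgue_Rd d) F \<le> ennreal (2 ^ d) * (\<integral>\<^sup>+x. indicator F (?l r x) \<partial>lebesgue_Rd d)"
    if r: "1 < r" "r < 2" for r
  proof -
    have "emeasure (lebesgue_Rd d) F = (\<integral>\<^sup>+x. indicator F x \<partial>lebesgue_Rd d)" by simp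
    also have "\<dots> = ennreal (\<bar>r\<bar> ^ card {..<d}) * (\<integral>\<^sup>+x. indicator F (?l r x) \<partial>lebesgue_Rd d)"
      using r F unfolding lebesgue_Rd_def lincomb_def by (intro nn_integral_PiM_affine) auto
    also have "\<dots> \<le> ennreal (2 ^ d) * (\<integral>\<^sup>+x. indicator F (?l r x) \<partial>lebesgue_Rd d)"
      using r by (intro mult_right_mono ennreal_leI) (auto intro: power_mono)
    finally show ?thesis .
  qed
  \<comment> \<open>The interval (1, 2) has length one, so averaging over \<open>r\<close>
    reproduces the measure of \<open>F\<close>. After Fubini the inner integrals run along rays from
    \<open>x0\<close> and vanish by \<open>line\<close>.\<close>
  have "emeasure (lebesgue_Rd d) F = (\<integral>\<^sup>+r. indicator {1<..<2::real} r * emeasure (lebesgue_Rd d) F \<partial>lborel)"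
    by (subst nn_integral_multc) auto
  also have "\<dots> \<le> (\<integral>\<^sup>+r. ennreal (2 ^ d) * (\<integral>\<^sup>+x. indicator {1<..<2} r * indicator F (?l r x) \<partial>lebesgue_Rd d) \<partial>lborel)"
    using scale by (intro nn_integral_mono) (auto simp: indicator_def)
  also have "\<dots> = ennreal (2 ^ d) * (\<integral>\<^sup>+r. (\<integral>\<^sup>+x. indicator {1<..<2} r * indicator F (?l r x) \<partial>lebesgue_Rd d) \<partial>lborel)"
    by (rule nn_integral_cmult) measurable
  also have "(\<integral>\<^sup>+r. (\<integral>\<^sup>+x. indicator {1<..<2} r * indicator F (?l r x) \<partial>lebesgue_Rd d) \<partial>lborel) =
      (\<integral>\<^sup>+x. (\<integral>\<^sup>+r. indicator {1<..<2} r * indicator F (?l r x) \<partial>lborel) \<partial>lebesgue_Rd d)"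
    by (rule P.Fubini'[symmetric]) measurable
  finally have "emeasure (lebesgue_Rd d) F = 0" by (simp add: line)
  then have "F \<in> null_sets (lebesgue_Rd d)" by (simp add: null_sets_def)
  then show ?thesis by (rule AE_not_in[THEN eventually_mono]) (auto simp: F_def)
qed

subsection \<open>Second differences along lines\<close>

text \<open>\<open>Ck_on\<close> provides partial derivatives only. Their continuity yields
  derivatives along arbitrary lines: the coordinates are moved one at a time, and on each such step
  the partial derivative stays within \<epsilon> of its value at \<open>x\<close>.\<close>

lemma has_real_derivative_line_at_0:
  assumes S: "openin (Rd_top d) S" and x: "x \<in> S"
    and diff: "\<And>i y. i < d \<Longrightarrow> y \<in> S \<Longrightarrow> (\<lambda>r. f (y(i := r))) differentiable at (y i)"
    and cont: "\<And>i. i < d \<Longrightarrow> continuous_map (subtopology (Rd_top d) S) euclideanreal (partial i f)"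
  shows "((\<lambda>r. f (\<lambda>i\<in>{..<d}. x i + r * w i)) has_real_derivative (\<Sum>i<d. w i * partial i f x)) (at 0)"
proof -
  define W where "W = 1 + (\<Sum>i<d. \<bar>w i\<bar>)"
  have W: "W > 0" unfolding W_def by (simp add: add_pos_nonneg sum_nonneg)
  have wW: "\<bar>w i\<bar> \<le> W" if "i < d" for i
    using member_le_sum[of i "{..<d}" "\<lambda>i. \<bar>w i\<bar>"] that unfolding W_def by simp
  have xR: "x \<in> Rd d" using S x unfolding openin_Rd_top by blast
  have x0: "(\<lambda>i\<in>{..<d}. x i + 0 * w i) = x"
    using xR by (intro Rd_eqI[OF restrict_in_Rd]) auto
  have near: "\<exists>e>0. \<forall>y\<in>cube {..<d} x e. y \<in> S \<and> \<bar>partial i f y - partial i f x\<bar> < \<epsilon>" if "i < d" "\<epsilon> > 0" for i \<epsilon>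
  proof -
    have "openin (subtopology (Rd_top d) S) {y \<in> topspace (subtopology (Rd_top d) S). partial i f y \<in> ball (partial i f x) \<epsilon>}"
      using cont[OF that(1)] unfolding continuous_map_def by (metis open_ball open_openin)
    then have "openin (Rd_top d) {y \<in> topspace (subtopology (Rd_top d) S). partial i f y \<in> ball (partial i f x) \<epsilon>}"
      by (rule openin_trans_full[OF _ S])
    moreover have "x \<in> {y \<in> topspace (subtopology (Rd_top d) S). partial i f y \<in> ball (partial i f x) \<epsilon>}"
      using x xR that by (auto simp: topspace_Rd_top)
    ultimately obtain e where "e > 0" "cube {..<d} x e \<subseteq> {y \<in> topspace (subtopology (Rd_top d) S). partial i f y \<in> ball (partial i f x) \<epsilon>}"
      unfolding openin_Rd_top by blast
    then show ?thesis
      by (intro exI[of _ e]) (auto simp: dist_real_def abs_minus_commute)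
  qed
  have est: "\<exists>\<delta>>0. \<forall>h. \<bar>h\<bar> < \<delta> \<longrightarrow>
     \<bar>f (\<lambda>i\<in>{..<d}. x i + h * w i) - f x - h * (\<Sum>i<d. w i * partial i f x)\<bar> \<le> \<epsilon> * W * \<bar>h\<bar>" if \<epsilon>: "\<epsilon> > 0" for \<epsilon>
  proof -
    obtain e where e: "\<And>i. i < d \<Longrightarrow> e i > 0"
      "\<And>i y. i < d \<Longrightarrow> y \<in> cube {..<d} x (e i) \<Longrightarrow> y \<in> S \<and> \<bar>partial i f y - partial i f x\<bar> < \<epsilon>"
      using near[OF _ \<epsilon>] by metis
    define \<eta> where "\<eta> = Min (insert 1 (e ` {..<d}))"
    have \<eta>: "\<eta> > 0" unfolding \<eta>_def using e(1) by (subst Min_gr_iff) auto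
    have \<eta>e: "\<eta> \<le> e i" if "i < d" for i unfolding \<eta>_def using that by (intro Min_le) auto
    have e': "y \<in> S" "\<bar>partial i f y - partial i f x\<bar> < \<epsilon>" if "i < d" "y \<in> cube {..<d} x \<eta>" for i y
      using e(2)[OF that(1)] cube_mono[OF \<eta>e[OF that(1)]] that(2) by blast+
    have "\<bar>f (\<lambda>i\<in>{..<d}. x i + h * w i) - f x - h * (\<Sum>i<d. w i * partial i f x)\<bar> \<le> \<epsilon> * W * \<bar>h\<bar>"
      if h: "\<bar>h\<bar> < \<eta> / W" for h
    proof -
      have hw: "\<bar>h * w i\<bar> < \<eta>" if "i < d" for i
      proof -
        have "\<bar>h * w i\<bar> \<le> \<bar>h\<bar> * W" using wW[OF that] by (simp add: abs_mult mult_left_mono)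
        also have "\<dots> < \<eta>" using h W by (simp add: field_simps)
        finally show ?thesis .
      qed
      \<comment> \<open>In \<open>z k\<close> the first \<open>k\<close> coordinates have been
        moved. Neighbours differ in coordinate \<open>k\<close> only, and their differences
        telescope.\<close>
      define z where "z k = (\<lambda>i\<in>{..<d}. if i < k then x i + h * w i else x i)" for k
      have step: "\<bar>f (z (Suc k)) - f (z k) - h * (w k * partial k f x)\<bar> \<le> \<epsilon> * (\<bar>h\<bar> * \<bar>w k\<bar>)" if k: "k < d" for k
      proof -
        let ?c = "partial k f x"
        let ?T = "{x k - \<bar>h * w k\<bar> .. x k + \<bar>h * w k\<bar>}"
        have inc: "(z k)(k := r) \<in> cube {..<d} x \<eta>" if "r \<in> ?T" for r
          unfolding cube_Rd
        proof (intro CollectI conjI allI impI)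
          show "(z k)(k := r) \<in> Rd d" using k by (intro upd_in_Rd) (simp_all add: z_def restrict_in_Rd)
          fix i assume i: "i < d"
          show "\<bar>((z k)(k := r)) i - x i\<bar> < \<eta>"
            using that hw[OF i] \<eta> hw[OF k] i by (auto simp: z_def)
        qed
        have der: "((\<lambda>r. f ((z k)(k := r)) - ?c * r) has_field_derivative (partial k f ((z k)(k := r)) - ?c)) (at r within ?T)"
          if r: "r \<in> ?T" for r
        proof -
          let ?y = "(z k)(k := r)"
          have "(\<lambda>s. f (?y(k := s))) differentiable at (?y k)"
            using diff[OF k] e'(1)[OF k inc[OF r]] by blast
          then have "((\<lambda>s. f (?y(k := s))) has_real_derivative partial k f ?y) (at r)"
            unfolding partial_def by (simp add: DERIV_deriv_iff_real_differentiable)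
          then have "((\<lambda>s. f ((z k)(k := s))) has_real_derivative partial k f ?y) (at r within ?T)"
            by (auto intro: has_field_derivative_at_within)
          then show ?thesis by (auto intro!: derivative_eq_intros)
        qed
        have "norm ((f ((z k)(k := x k + h * w k)) - ?c * (x k + h * w k)) - (f ((z k)(k := x k)) - ?c * x k))
            \<le> \<epsilon> * norm ((x k + h * w k) - x k)"
          using e'(2)[OF k inc]
          by (intro field_differentiable_bound[where S = ?T, OF _ der]) (auto intro: less_imp_le)
        moreover have "(z k)(k := x k + h * w k) = z (Suc k)" "(z k)(k := x k) = z k"
          using k by (auto simp: z_def fun_eq_iff restrict_def)
        ultimately show ?thesis by (simp add: algebra_simps abs_mult)
      qed
      have z0: "z 0 = x" using xR by (intro Rd_eqI) (auto simp: z_def restrict_in_Rd)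
      have zd: "z d = (\<lambda>i\<in>{..<d}. x i + h * w i)" by (auto simp: z_def)
      have "f (z d) - f (z 0) - h * (\<Sum>i<d. w i * partial i f x) =
          (\<Sum>k<d. f (z (Suc k)) - f (z k) - h * (w k * partial k f x))"
        unfolding sum_subtractf[of "\<lambda>k. f (z (Suc k)) - f (z k)"] sum_lessThan_telescope[of "\<lambda>k. f (z k)"]
        by (simp add: sum_distrib_left)
      also have "\<bar>\<dots>\<bar> \<le> (\<Sum>k<d. \<epsilon> * (\<bar>h\<bar> * \<bar>w k\<bar>))"
        by (rule order.trans[OF sum_abs]) (intro sum_mono step, simp)
      also have "\<dots> = \<epsilon> * \<bar>h\<bar> * (\<Sum>k<d. \<bar>w k\<bar>)" by (simp add: sum_distrib_left mult.assoc)
      also have "\<dots> \<le> \<epsilon> * \<bar>h\<bar> * W" using \<epsilon> by (intro mult_left_mono) (auto simp: W_def)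
      finally show ?thesis unfolding z0 zd by (simp add: mult_ac)
    qed
    then show ?thesis using \<eta> W by (intro exI[of _ "\<eta> / W"]) auto
  qed
  show ?thesis
    unfolding DERIV_def
  proof (rule LIM_I)
    fix \<epsilon>' :: real assume \<epsilon>': "0 < \<epsilon>'"
    obtain \<delta> where \<delta>: "\<delta> > 0" "\<And>h. \<bar>h\<bar> < \<delta> \<Longrightarrow>
      \<bar>f (\<lambda>i\<in>{..<d}. x i + h * w i) - f x - h * (\<Sum>i<d. w i * partial i f x)\<bar> \<le> (\<epsilon>' / (2 * W)) * W * \<bar>h\<bar>"
      using est[of "\<epsilon>' / (2 * W)"] W \<epsilon>' by auto
    have "norm ((f (\<lambda>i\<in>{..<d}. x i + (0 + h) * w i) - f (\<lambda>i\<in>{..<d}. x i + 0 * w i)) / h - (\<Sum>i<d. w i * partial i f x)) < \<epsilon>'"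
      if h: "h \<noteq> 0 \<and> norm (h - 0) < \<delta>" for h
    proof -
      have "(f (\<lambda>i\<in>{..<d}. x i + h * w i) - f x) / h - (\<Sum>i<d. w i * partial i f x) =
        (f (\<lambda>i\<in>{..<d}. x i + h * w i) - f x - h * (\<Sum>i<d. w i * partial i f x)) / h"
        using h by (simp add: field_simps)
      also have "\<bar>\<dots>\<bar> \<le> \<epsilon>' / 2"
        using \<delta>(2)[of h] h W by (simp add: abs_divide field_simps)
      also have "\<dots> < \<epsilon>'" using \<epsilon>' by simp
      finally show ?thesis unfolding x0 by simp
    qed
    then show "\<exists>s>0. \<forall>h. h \<noteq> 0 \<and> norm (h - 0) < s \<longrightarrow>
      norm ((f (\<lambda>i\<in>{..<d}. x i + (0 + h) * w i) - f (\<lambda>i\<in>{..<d}. x i + 0 * w i)) / h - (\<Sum>i<d. w i * partial i f x)) < \<epsilon>'"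
      using \<delta>(1) by blast
  qed
qed

lemma has_real_derivative_line:
  assumes S: "openin (Rd_top d) S" and x: "(\<lambda>i\<in>{..<d}. x i + r * w i) \<in> S"
    and diff: "\<And>i y. i < d \<Longrightarrow> y \<in> S \<Longrightarrow> (\<lambda>r. f (y(i := r))) differentiable at (y i)"
    and cont: "\<And>i. i < d \<Longrightarrow> continuous_map (subtopology (Rd_top d) S) euclideanreal (partial i f)"
  shows "((\<lambda>r. f (\<lambda>i\<in>{..<d}. x i + r * w i)) has_real_derivative
    (\<Sum>i<d. w i * partial i f (\<lambda>i\<in>{..<d}. x i + r * w i))) (at r)"
proof -
  have eq: "(\<lambda>i\<in>{..<d}. (\<lambda>i\<in>{..<d}. x i + r * w i) i + s * w i) = (\<lambda>i\<in>{..<d}. x i + (s + r) * w i)" for s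
    by (auto simp: fun_eq_iff restrict_def algebra_simps)
  from has_real_derivative_line_at_0[OF S x diff cont, of w]
  have "((\<lambda>s. f (\<lambda>i\<in>{..<d}. x i + (s + r) * w i)) has_real_derivative
    (\<Sum>i<d. w i * partial i f (\<lambda>i\<in>{..<d}. x i + r * w i))) (at 0)"
    unfolding eq by blast
  then show ?thesis
    using DERIV_shift[of "\<lambda>r. f (\<lambda>i\<in>{..<d}. x i + r * w i)" _ 0 r] by simp
qed

text \<open>Subtracting \<open>m * r\<^sup>2 / 2\<close> leaves a convex function, for which the
  claim is midpoint convexity between -1 and 1.\<close>

lemma second_difference_ge:
  fixes \<phi> :: "real \<Rightarrow> real"
  assumes d1: "\<And>r. -1 \<le> r \<Longrightarrow> r \<le> 1 \<Longrightarrow> (\<phi> has_real_derivative \<phi>' r) (at r)"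
    and d2: "\<And>r. -1 \<le> r \<Longrightarrow> r \<le> 1 \<Longrightarrow> (\<phi>' has_real_derivative \<phi>'' r) (at r)"
    and ge: "\<And>r. -1 \<le> r \<Longrightarrow> r \<le> 1 \<Longrightarrow> m \<le> \<phi>'' r"
  shows "m \<le> \<phi> 1 + \<phi> (-1) - 2 * \<phi> 0"
proof -
  have "convex_on {-1..1} (\<lambda>r. \<phi> r - m * r\<^sup>2 / 2)"
  proof (rule f''_ge0_imp_convex)
    fix r :: real assume r: "r \<in> {-1..1}"
    show "((\<lambda>r. \<phi> r - m * r\<^sup>2 / 2) has_real_derivative \<phi>' r - m * r) (at r)"
      using d1[of r] r by (auto intro!: derivative_eq_intros)
    show "((\<lambda>r. \<phi>' r - m * r) has_real_derivative \<phi>'' r - m) (at r)"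
      using d2[of r] r by (auto intro!: derivative_eq_intros)
    show "0 \<le> \<phi>'' r - m" using ge[of r] r by simp
  qed simp
  from convex_onD[OF this, of "1/2" "-1" 1]
  show ?thesis by (simp add: field_simps)
qed

lemma scalar_prod_mat_quadratic:
  fixes A :: "nat \<times> nat \<Rightarrow> real"
  shows
  "scalar_prod (vec d w) (mat d d A *\<^sub>v vec d w) = (\<Sum>i<d. \<Sum>j<d. w i * w j * A (i, j))"
  by (auto simp: scalar_prod_def lessThan_atLeast0[symmetric] sum_distrib_left mult_ac intro!: sum.cong)

text \<open>The Hessian bound in integrated form. Only this midpoint version of strong convexity is
  fed into Prekopa--Leindler, with \<open>x\<close> the midpoint and \<open>w\<close> half the
  difference of two points.\<close>

lemma Ck_on_2_second_difference_ge:
  assumes S: "openin (Rd_top d) S" and f: "Ck_on 2 d S f"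
    and H: "\<And>x. x \<in> S \<Longrightarrow> loewner_le (\<alpha> \<cdot>\<^sub>m 1\<^sub>m d) (hessian d f x)"
    and seg: "\<And>r. -1 \<le> r \<Longrightarrow> r \<le> 1 \<Longrightarrow> (\<lambda>i\<in>{..<d}. x i + r * w i) \<in> S"
  shows "\<alpha> * (\<Sum>i<d. (w i)\<^sup>2) \<le>
    f (\<lambda>i\<in>{..<d}. x i + 1 * w i) + f (\<lambda>i\<in>{..<d}. x i + (-1) * w i) - 2 * f (\<lambda>i\<in>{..<d}. x i + 0 * w i)"
proof -
  have f1: "\<And>i y. i < d \<Longrightarrow> y \<in> S \<Longrightarrow> (\<lambda>r. f (y(i := r))) differentiable at (y i)"
    and f2: "\<And>i. i < d \<Longrightarrow> continuous_map (subtopology (Rd_top d) S) euclideanreal (partial i f)"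
    and f3: "\<And>i j y. i < d \<Longrightarrow> j < d \<Longrightarrow> y \<in> S \<Longrightarrow> (\<lambda>r. partial i f (y(j := r))) differentiable at (y j)"
    and f4: "\<And>i j. i < d \<Longrightarrow> j < d \<Longrightarrow> continuous_map (subtopology (Rd_top d) S) euclideanreal (partial j (partial i f))"
    using f by (auto simp: numeral_2_eq_2)
  let ?y = "\<lambda>r. \<lambda>i\<in>{..<d}. x i + r * w i"
  show ?thesis
  proof (rule second_difference_ge)
    fix r :: real assume r: "-1 \<le> r" "r \<le> 1"
    show "((\<lambda>r. f (?y r)) has_real_derivative (\<Sum>i<d. w i * partial i f (?y r))) (at r)"
      by (rule has_real_derivative_line[OF S seg[OF r] f1 f2])
    show "((\<lambda>r. \<Sum>i<d. w i * partial i f (?y r)) has_real_derivative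
        (\<Sum>i<d. w i * (\<Sum>j<d. w j * partial j (partial i f) (?y r)))) (at r)"
      by (intro DERIV_sum DERIV_cmult has_real_derivative_line[OF S seg[OF r]] f3 f4) auto
    have "\<alpha> * (\<Sum>i<d. (w i)\<^sup>2) = scalar_prod (vec d w) ((\<alpha> \<cdot>\<^sub>m 1\<^sub>m d) *\<^sub>v vec d w)"
    proof -
      have "\<alpha> \<cdot>\<^sub>m 1\<^sub>m d = mat d d (\<lambda>(i, j). if i = j then \<alpha> else 0)" by (rule eq_matI) auto
      then show ?thesis
        by (simp add: scalar_prod_mat_quadratic if_distrib[of "\<lambda>x. _ * x"] sum_distrib_left power2_eq_square
            mult_ac cong: if_cong)
    qed
    also have "\<dots> \<le> scalar_prod (vec d w) (hessian d f (?y r) *\<^sub>v vec d w)"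
      using H[OF seg[OF r]] unfolding loewner_le_def by simp
    also have "\<dots> = (\<Sum>i<d. \<Sum>j<d. w i * w j * partial j (\<lambda>y. grad d f y i) (?y r))"
      unfolding hessian_def jacobian_mat_def scalar_prod_mat_quadratic by simp
    also have "\<dots> = (\<Sum>i<d. w i * (\<Sum>j<d. w j * partial j (partial i f) (?y r)))"
      by (simp add: grad_def sum_distrib_left mult.assoc)
    finally show "\<alpha> * (\<Sum>i<d. (w i)\<^sup>2) \<le> (\<Sum>i<d. w i * (\<Sum>j<d. w j * partial j (partial i f) (?y r)))" .
  qed
qed

subsection \<open>The largest eigenvalue\<close>

text \<open>The first-order condition at a minimum, used below for the maximiser of the Rayleigh
  quotient.\<close>

lemma linear_coeff_zero:
  fixes a b :: real
  assumes "\<And>r. 0 \<le> r * a + r\<^sup>2 * b"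
  shows "a = 0"
proof (rule ccontr)
  assume a: "a \<noteq> 0"
  define c where "c = \<bar>b\<bar> + 1"
  have c: "c > 0" "b < c" by (auto simp: c_def)
  \<comment> \<open>With \<open>c > b\<close> in the place of \<open>b\<close>, the value at
    \<open>r = - a / c\<close> is exactly 0; so with \<open>b\<close> it is negative.\<close>
  have "0 \<le> (- a / c) * a + (- a / c)\<^sup>2 * b" by (rule assms)
  also have "\<dots> < (- a / c) * a + (- a / c)\<^sup>2 * c"
    using a c by (intro add_strict_left_mono mult_strict_left_mono) auto
  also have "\<dots> = 0" using c by (simp add: power2_eq_square field_simps)
  finally show False by simp
qed

text \<open>Vectors are functions on all of \<open>nat\<close> with the product topology. The
  coordinates from \<open>d\<close> on are pinned to 0, which makes the sphere a closed subset of a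
  product of compact sets.\<close>

lemma compact_unit_sphere_fun:
  "compact {v :: nat \<Rightarrow> real. (\<forall>i\<ge>d. v i = 0) \<and> (\<Sum>i<d. (v i)\<^sup>2) = 1}"
proof -
  let ?S = "\<lambda>i. if i < d then {-1..1} else {0::real}"
  have "compactin (product_topology (\<lambda>i::nat. euclideanreal) UNIV) (PiE UNIV ?S)"
    by (subst compactin_PiE) auto
  then have "compact (PiE UNIV ?S)" by (simp add: euclidean_product_topology)
  moreover have "closed {v :: nat \<Rightarrow> real. (\<Sum>i<d. (v i)\<^sup>2) = 1}"
    by (intro closed_Collect_eq continuous_intros continuous_on_product_coordinates)
  ultimately have "compact (PiE UNIV ?S \<inter> {v. (\<Sum>i<d. (v i)\<^sup>2) = 1})" by (rule compact_Int_closed)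
  also have "PiE UNIV ?S \<inter> {v. (\<Sum>i<d. (v i)\<^sup>2) = 1} = {v. (\<forall>i\<ge>d. v i = 0) \<and> (\<Sum>i<d. (v i)\<^sup>2) = 1}"
  proof (intro equalityI subsetI)
    fix v :: "nat \<Rightarrow> real" assume v: "v \<in> {v. (\<forall>i\<ge>d. v i = 0) \<and> (\<Sum>i<d. (v i)\<^sup>2) = 1}"
    have "v i \<in> {-1..1}" if "i < d" for i
    proof -
      have "(v i)\<^sup>2 \<le> (\<Sum>i<d. (v i)\<^sup>2)" using that by (intro member_le_sum) auto
      then have "\<bar>v i\<bar> \<le> 1" using v by (simp add: abs_square_le_1)
      then show ?thesis by auto
    qed
    then show "v \<in> PiE UNIV ?S \<inter> {v. (\<Sum>i<d. (v i)\<^sup>2) = 1}" using v by auto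
  next
    fix v :: "nat \<Rightarrow> real" assume v: "v \<in> PiE UNIV ?S \<inter> {v. (\<Sum>i<d. (v i)\<^sup>2) = 1}"
    have "v i = 0" if "i \<ge> d" for i
    proof -
      have "v i \<in> ?S i" using v by (intro PiE_mem[of v UNIV ?S]) auto
      then show ?thesis using that by simp
    qed
    moreover have "(\<Sum>i<d. (v i)\<^sup>2) = 1" using v by blast
    ultimately show "v \<in> {v. (\<forall>i\<ge>d. v i = 0) \<and> (\<Sum>i<d. (v i)\<^sup>2) = 1}" by blast
  qed
  finally show ?thesis .
qed

text \<open>The maximum \<open>M\<close> of the quadratic form over the sphere is attained by
  compactness; \<open>1 \<le> d\<close> makes the sphere nonempty. Stationarity at the maximiser
  shows that \<open>M\<close> is an eigenvalue, and testing the form on an arbitrary eigenvector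
  shows that no eigenvalue exceeds it.\<close>

lemma lambda_max_variational:
  fixes A :: "nat \<times> nat \<Rightarrow> real"
  assumes d: "1 \<le> d" and sym: "\<And>i j. i < d \<Longrightarrow> j < d \<Longrightarrow> A (i, j) = A (j, i)"
  defines "q \<equiv> \<lambda>v :: nat \<Rightarrow> real. \<Sum>i<d. \<Sum>j<d. v i * v j * A (i, j)"
  shows "q v \<le> lambda_max (mat d d A) * (\<Sum>i<d. (v i)\<^sup>2)" (is ?thesis1)
    and "\<exists>v. (\<Sum>i<d. (v i)\<^sup>2) = 1 \<and> q v = lambda_max (mat d d A)" (is ?thesis2)
proof -
  let ?S = "{v :: nat \<Rightarrow> real. (\<forall>i\<ge>d. v i = 0) \<and> (\<Sum>i<d. (v i)\<^sup>2) = 1}"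
  have "continuous_on ?S q"
    unfolding q_def by (intro continuous_intros continuous_on_subset[OF continuous_on_product_coordinates] subset_UNIV)
  moreover have "(\<Sum>i<d. (if i = 0 then 1 else 0 :: real)\<^sup>2) = 1"
    using d by (simp add: if_distrib[of "\<lambda>x. x\<^sup>2"] cong: if_cong)
  then have "(\<lambda>i. if i = 0 then 1 else 0) \<in> ?S" using d by (intro CollectI conjI allI impI) simp_all
  then have "?S \<noteq> {}" by (rule ex_in_conv[THEN iffD1, OF exI])
  ultimately have "\<exists>v0\<in>?S. \<forall>v\<in>?S. q v \<le> q v0"
    by (intro continuous_attains_sup[OF compact_unit_sphere_fun])
  then obtain v0 where v0: "v0 \<in> ?S" and max0: "\<forall>v\<in>?S. q v \<le> q v0" by (rule bexE)
  have max: "q v \<le> q v0" if "v \<in> ?S" for v using max0 that by (rule bspec)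
  define M where "M = q v0"
  have qscale: "q (\<lambda>i. c * v i) = c\<^sup>2 * q v" for c v
    unfolding q_def by (simp add: sum_distrib_left power2_eq_square mult_ac)
  have ub: "q v \<le> M * (\<Sum>i<d. (v i)\<^sup>2)" for v
  proof (cases "(\<Sum>i<d. (v i)\<^sup>2) = 0")
    case True
    then have "\<And>i. i < d \<Longrightarrow> v i = 0" by (simp add: sum_nonneg_eq_0_iff)
    then show ?thesis using True by (simp add: q_def)
  next
    case False
    let ?n = "\<Sum>i<d. (v i)\<^sup>2"
    have n: "?n > 0" using False by (simp add: sum_nonneg order.not_eq_order_implies_strict)
    let ?u = "\<lambda>i. if i < d then 1 / sqrt ?n * v i else 0"
    have "(\<Sum>i<d. (?u i)\<^sup>2) = (\<Sum>i<d. (1 / ?n) * (v i)\<^sup>2)"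
      using n by (intro sum.cong) (auto simp: power_mult_distrib power_divide)
    also have "\<dots> = 1" using n by (simp add: sum_divide_distrib[symmetric])
    finally have "q ?u \<le> M" unfolding M_def by (intro max) auto
    also have "q ?u = q (\<lambda>i. 1 / sqrt ?n * v i)" unfolding q_def by simp
    also have "\<dots> = q v / ?n" unfolding qscale using n by (simp add: power_divide)
    finally show ?thesis using n by (simp add: field_simps)
  qed
  have eig: "(\<Sum>j<d. A (i, j) * v0 j) = M * v0 i" if i: "i < d" for i
  proof -
    \<comment> \<open>The residual of the eigenvalue equation. Perturbing \<open>v0\<close> in the
      direction \<open>z\<close> itself makes the linear coefficient twice the squared norm of
      \<open>z\<close>.\<close>
    define z where "z i = M * v0 i - (\<Sum>j<d. A (i, j) * v0 j)" for i
    have "2 * (\<Sum>i<d. z i * z i) = 0"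
    proof (rule linear_coeff_zero)
      fix r
      have e1: "q (\<lambda>i. v0 i + r * z i) = q v0 + 2 * r * (\<Sum>i<d. z i * (\<Sum>j<d. A (i, j) * v0 j)) + r\<^sup>2 * q z"
      proof -
        have sw: "(\<Sum>i<d. \<Sum>j<d. v0 i * z j * A (i, j)) = (\<Sum>i<d. \<Sum>j<d. z i * v0 j * A (i, j))"
          by (subst sum.swap) (intro sum.cong refl, simp add: sym)
        have "q (\<lambda>i. v0 i + r * z i) = (\<Sum>i<d. \<Sum>j<d. v0 i * v0 j * A (i, j) + r * (v0 i * z j * A (i, j))
            + r * (z i * v0 j * A (i, j)) + r\<^sup>2 * (z i * z j * A (i, j)))"
          unfolding q_def by (intro sum.cong refl) (simp add: algebra_simps power2_eq_square)
        also have "\<dots> = q v0 + r * (\<Sum>i<d. \<Sum>j<d. v0 i * z j * A (i, j)) + r * (\<Sum>i<d. \<Sum>j<d. z i * v0 j * A (i, j)) + r\<^sup>2 * q z"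
          by (simp only: q_def sum.distrib sum_distrib_left)
        also have "(\<Sum>i<d. \<Sum>j<d. z i * v0 j * A (i, j)) = (\<Sum>i<d. z i * (\<Sum>j<d. A (i, j) * v0 j))"
          by (simp add: sum_distrib_left mult_ac)
        finally show ?thesis unfolding sw by (simp add: sum_distrib_left mult_ac)
      qed
      have e2: "(\<Sum>i<d. (v0 i + r * z i)\<^sup>2) = 1 + 2 * r * (\<Sum>i<d. z i * v0 i) + r\<^sup>2 * (\<Sum>i<d. (z i)\<^sup>2)"
        using v0 by (simp add: power2_sum power_mult_distrib sum.distrib sum_distrib_left mult_ac)
      have zz: "(\<Sum>i<d. z i * z i) = M * (\<Sum>i<d. z i * v0 i) - (\<Sum>i<d. z i * (\<Sum>j<d. A (i, j) * v0 j))"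
        unfolding sum_distrib_left sum_subtractf[symmetric]
        by (intro sum.cong refl) (subst (2) z_def, simp add: algebra_simps sum_distrib_left)
      have "0 \<le> M * (\<Sum>i<d. (v0 i + r * z i)\<^sup>2) - q (\<lambda>i. v0 i + r * z i)" using ub by simp
      also have "\<dots> = r * (2 * (\<Sum>i<d. z i * z i)) + r\<^sup>2 * (M * (\<Sum>i<d. (z i)\<^sup>2) - q z)"
        unfolding e1 e2 zz using M_def by (simp add: algebra_simps)
      finally show "0 \<le> r * (2 * (\<Sum>i<d. z i * z i)) + r\<^sup>2 * (M * (\<Sum>i<d. (z i)\<^sup>2) - q z)" .
    qed
    then have "z i = 0" using i by (simp add: sum_nonneg_eq_0_iff)
    then show ?thesis by (simp add: z_def)
  qed
  have spec: "M \<in> spectrum (mat d d A)"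
  proof -
    have "eigenvector (mat d d A) (vec d v0) M"
      unfolding eigenvector_def
    proof (intro conjI)
      obtain i where i: "i < d" "v0 i \<noteq> 0"
      proof (rule ccontr)
        assume "\<not> thesis"
        then have "\<forall>i<d. v0 i = 0" using that by blast
        then show False using v0 by simp
      qed
      show "vec d v0 \<noteq> 0\<^sub>v (dim_row (mat d d A))"
        using i by (auto simp: vec_eq_iff)
      show "mat d d A *\<^sub>v vec d v0 = M \<cdot>\<^sub>v vec d v0"
        using eig by (intro eq_vecI) (auto simp: scalar_prod_def lessThan_atLeast0[symmetric])
    qed simp
    then show ?thesis by (auto simp: spectrum_def eigenvalue_def)
  qed
  have le: "l \<le> M" if l: "l \<in> spectrum (mat d d A)" for l
  proof -
    obtain u where "eigenvector (mat d d A) u l"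
      using l by (auto simp: spectrum_def eigenvalue_def)
    then have u: "u \<in> carrier_vec d" "u \<noteq> 0\<^sub>v d" "mat d d A *\<^sub>v u = l \<cdot>\<^sub>v u"
      unfolding eigenvector_def by auto
    let ?v = "\<lambda>i. u $ i"
    have row: "(\<Sum>j<d. A (i, j) * ?v j) = l * ?v i" if "i < d" for i
    proof -
      have "(mat d d A *\<^sub>v u) $ i = (\<Sum>j<d. A (i, j) * ?v j)"
        using that u(1) by (auto simp: scalar_prod_def lessThan_atLeast0[symmetric])
      then show ?thesis using u that by simp
    qed
    have "q ?v = (\<Sum>i<d. ?v i * (\<Sum>j<d. A (i, j) * ?v j))"
      unfolding q_def by (simp add: sum_distrib_left mult_ac)
    also have "\<dots> = (\<Sum>i<d. ?v i * (l * ?v i))"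
      by (intro sum.cong) (simp_all add: row)
    also have "\<dots> = l * (\<Sum>i<d. (?v i)\<^sup>2)"
      by (simp add: sum_distrib_left power2_eq_square mult_ac)
    finally have "l * (\<Sum>i<d. (?v i)\<^sup>2) \<le> M * (\<Sum>i<d. (?v i)\<^sup>2)" using ub[of ?v] by simp
    moreover have "(\<Sum>i<d. (?v i)\<^sup>2) > 0"
    proof -
      obtain i where "i < d" "?v i \<noteq> 0" using u(1,2) by (auto simp: vec_eq_iff)
      then show ?thesis by (intro sum_pos2[of _ i]) auto
    qed
    ultimately show ?thesis by simp
  qed
  have "lambda_max (mat d d A) = M"
    unfolding lambda_max_def using spec le
    by (intro Max_eqI) (auto intro!: card_finite_spectrum(1)[of _ d])
  then show ?thesis1 ?thesis2 using ub v0 M_def by auto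
qed

subsection \<open>Moments under Gaussian weights\<close>

lemma abs_exp_diff_le: "\<bar>exp x - exp y\<bar> \<le> \<bar>x - y\<bar> * exp (max x y)" for x y :: real
proof -
  have *: "exp u - exp v \<le> (u - v) * exp u" for u v :: real
  proof -
    have "1 + (v - u) \<le> exp (v - u)" by (rule exp_ge_add_one_self)
    then have "exp u * (1 + (v - u)) \<le> exp u * exp (v - u)" by (intro mult_left_mono) auto
    also have "exp u * exp (v - u) = exp v" by (simp add: exp_add[symmetric])
    finally show ?thesis by (simp add: algebra_simps)
  qed
  show ?thesis using *[of x y] *[of y x] by (auto simp: max_def abs_if algebra_simps)
qed

lemma has_real_derivative_integral_exp:
  fixes w c :: "'a \<Rightarrow> real"
  assumes [measurable]: "w \<in> borel_measurable M" "c \<in> borel_measurable M"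
    and int: "\<And>R. integrable M (\<lambda>y. w y * exp (R * \<bar>c y\<bar>))"
  shows "((\<lambda>r. \<integral>y. w y * exp (r * c y) \<partial>M) has_real_derivative (\<integral>y. w y * c y * exp (r * c y) \<partial>M)) (at r)"
proof -
  have i: "integrable M (\<lambda>y. w y * exp (s * c y))" for s
  proof (rule Bochner_Integration.integrable_bound[OF int[of "\<bar>s\<bar>"]])
    have "s * c y \<le> \<bar>s\<bar> * \<bar>c y\<bar>" for y by (metis abs_ge_self abs_mult)
    then show "AE y in M. norm (w y * exp (s * c y)) \<le> norm (w y * exp (\<bar>s\<bar> * \<bar>c y\<bar>))"
      by (intro AE_I2) (simp add: abs_mult mult_left_mono)
  qed simp
  show ?thesis
    unfolding has_field_derivative_iff tendsto_at_iff_sequentially comp_def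
  proof (intro allI impI)
    fix X :: "nat \<Rightarrow> real" assume X: "\<forall>i. X i \<in> UNIV - {r}" "X \<longlonglongrightarrow> r"
    then obtain N where N: "\<And>n. n \<ge> N \<Longrightarrow> \<bar>X n - r\<bar> < 1"
      using LIMSEQ_D[OF X(2), of 1] by auto
    let ?Y = "\<lambda>n. X (n + N)"
    have Y: "?Y \<longlonglongrightarrow> r" using X(2) by (rule LIMSEQ_ignore_initial_segment)
    have Yr: "?Y n \<noteq> r" for n using X(1) by auto
    have "(\<lambda>n. \<integral>y. w y * ((exp (?Y n * c y) - exp (r * c y)) / (?Y n - r)) \<partial>M)
        \<longlonglongrightarrow> (\<integral>y. w y * (c y * exp (r * c y)) \<partial>M)"
    \<comment> \<open>The parameters \<open>?Y n\<close> are bounded by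
      \<open>\<bar>r\<bar> + 1\<close>. The remaining 1 in \<open>\<bar>r\<bar> + 2\<close> absorbs
      the factor \<open>\<bar>c y\<bar>\<close> from the difference quotient, as it is at most
      \<open>exp \<bar>c y\<bar>\<close>.\<close>
    proof (rule integral_dominated_convergence[where w = "\<lambda>y. \<bar>w y * exp ((\<bar>r\<bar> + 2) * \<bar>c y\<bar>)\<bar>"])
      show "AE y in M. (\<lambda>n. w y * ((exp (?Y n * c y) - exp (r * c y)) / (?Y n - r))) \<longlonglongrightarrow> w y * (c y * exp (r * c y))"
      proof (intro AE_I2 tendsto_mult tendsto_const)
        fix y
        have "((\<lambda>r. exp (r * c y)) has_real_derivative c y * exp (r * c y)) (at r)"
          by (auto intro!: derivative_eq_intros)
        then have "((\<lambda>s. (exp (s * c y) - exp (r * c y)) / (s - r)) \<longlongrightarrow> c y * exp (r * c y)) (at r)"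
          by (simp add: has_field_derivative_iff)
        then show "(\<lambda>n. (exp (?Y n * c y) - exp (r * c y)) / (?Y n - r)) \<longlonglongrightarrow> c y * exp (r * c y)"
          using Y Yr unfolding tendsto_at_iff_sequentially comp_def by auto
      qed
      fix n
      show "AE y in M. norm (w y * ((exp (?Y n * c y) - exp (r * c y)) / (?Y n - r))) \<le> \<bar>w y * exp ((\<bar>r\<bar> + 2) * \<bar>c y\<bar>)\<bar>"
      proof (intro AE_I2)
        fix y
        have Yn: "\<bar>?Y n\<bar> \<le> \<bar>r\<bar> + 1" using N[of "n + N"] by simp
        have "?Y n * c y \<le> \<bar>?Y n\<bar> * \<bar>c y\<bar>" by (metis abs_ge_self abs_mult)
        also have "\<dots> \<le> (\<bar>r\<bar> + 1) * \<bar>c y\<bar>" using Yn by (intro mult_right_mono) auto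
        finally have m1: "?Y n * c y \<le> (\<bar>r\<bar> + 1) * \<bar>c y\<bar>" .
        have "r * c y \<le> \<bar>r\<bar> * \<bar>c y\<bar>" by (metis abs_ge_self abs_mult)
        also have "\<dots> \<le> (\<bar>r\<bar> + 1) * \<bar>c y\<bar>" by (intro mult_right_mono) auto
        finally have m2: "r * c y \<le> (\<bar>r\<bar> + 1) * \<bar>c y\<bar>" .
        have "\<bar>(exp (?Y n * c y) - exp (r * c y)) / (?Y n - r)\<bar> \<le> (\<bar>?Y n * c y - r * c y\<bar> * exp (max (?Y n * c y) (r * c y))) / \<bar>?Y n - r\<bar>"
          unfolding abs_divide by (intro divide_right_mono abs_exp_diff_le) auto
        also have "\<dots> = \<bar>c y\<bar> * exp (max (?Y n * c y) (r * c y))"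
          using Yr[of n] by (simp add: left_diff_distrib[symmetric] abs_mult)
        also have "\<dots> \<le> exp \<bar>c y\<bar> * exp ((\<bar>r\<bar> + 1) * \<bar>c y\<bar>)"
          using m1 m2 by (intro mult_mono) (auto intro: order.trans[OF _ exp_ge_add_one_self])
        also have "\<dots> = exp ((\<bar>r\<bar> + 2) * \<bar>c y\<bar>)" by (simp add: exp_add[symmetric] algebra_simps)
        finally show "norm (w y * ((exp (?Y n * c y) - exp (r * c y)) / (?Y n - r))) \<le> \<bar>w y * exp ((\<bar>r\<bar> + 2) * \<bar>c y\<bar>)\<bar>"
          unfolding real_norm_def abs_mult[of "w y"] by (intro mult_left_mono) auto
      qed
    qed (use int in \<open>auto intro!: integrable_abs\<close>)
    moreover have "((\<integral>y. w y * exp (?Y n * c y) \<partial>M) - (\<integral>y. w y * exp (r * c y) \<partial>M)) / (?Y n - r) =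
        (\<integral>y. w y * ((exp (?Y n * c y) - exp (r * c y)) / (?Y n - r)) \<partial>M)" for n
    proof -
      have "(\<integral>y. w y * ((exp (?Y n * c y) - exp (r * c y)) / (?Y n - r)) \<partial>M) =
          (\<integral>y. (w y * exp (?Y n * c y) - w y * exp (r * c y)) / (?Y n - r) \<partial>M)"
        by (intro Bochner_Integration.integral_cong) (auto simp: right_diff_distrib)
      also have "\<dots> = (\<integral>y. w y * exp (?Y n * c y) - w y * exp (r * c y) \<partial>M) / (?Y n - r)"
        by (rule integral_divide_zero)
      finally show ?thesis unfolding Bochner_Integration.integral_diff[OF i i] by (rule sym)
    qed
    ultimately have "(\<lambda>n. ((\<integral>y. w y * exp (?Y n * c y) \<partial>M) - (\<integral>y. w y * exp (r * c y) \<partial>M)) / (?Y n - r))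
        \<longlonglongrightarrow> (\<integral>y. w y * c y * exp (r * c y) \<partial>M)"
      by (simp only: mult.assoc)
    then show "(\<lambda>n. ((\<integral>y. w y * exp (X n * c y) \<partial>M) - (\<integral>y. w y * exp (r * c y) \<partial>M)) / (X n - r))
        \<longlonglongrightarrow> (\<integral>y. w y * c y * exp (r * c y) \<partial>M)"
      by (rule LIMSEQ_offset)
  qed
qed

section \<open>Test functions of exponential growth\<close>

definition dot :: "nat \<Rightarrow> point \<Rightarrow> point \<Rightarrow> real" where
  "dot d x y = (\<Sum>i<d. x i * y i)"

definition norm1 :: "nat \<Rightarrow> point \<Rightarrow> real" where
  "norm1 d x = (\<Sum>i<d. \<bar>x i\<bar>)"

lemma norm1_nonneg [simp]: "0 \<le> norm1 d x"
  by (simp add: norm1_def sum_nonneg)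

lemma abs_dot_le: "\<bar>dot d x y\<bar> \<le> norm1 d x * norm1 d y"
proof -
  have "\<bar>dot d x y\<bar> \<le> (\<Sum>i<d. \<bar>x i\<bar> * \<bar>y i\<bar>)"
    unfolding dot_def by (rule order.trans[OF sum_abs]) (simp add: abs_mult)
  also have "\<dots> \<le> (\<Sum>i<d. norm1 d x * \<bar>y i\<bar>)"
    by (intro sum_mono mult_right_mono) (auto simp: norm1_def intro: member_le_sum)
  finally show ?thesis by (simp add: norm1_def sum_distrib_left)
qed

lemma dot_add_left: "dot d (\<lambda>i. x i + y i) z = dot d x z + dot d y z"
  and dot_scale_left: "dot d (\<lambda>i. c * x i) y = c * dot d x y"
  and dot_commute: "dot d x y = dot d y x"
  by (simp_all add: dot_def algebra_simps sum.distrib sum_distrib_left)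

lemma coord_measurable [measurable]: "i < d \<Longrightarrow> (\<lambda>y. y i) \<in> borel_measurable (lebesgue_Rd d)"
  unfolding lebesgue_Rd_def
  using measurable_component_singleton[of i "{..<d}" "\<lambda>_. lborel"] by simp

lemma dot_measurable [measurable]: "(\<lambda>y. dot d x y) \<in> borel_measurable (lebesgue_Rd d)"
  and dot_self_measurable [measurable]: "(\<lambda>y. dot d y y) \<in> borel_measurable (lebesgue_Rd d)"
  unfolding dot_def by (auto intro!: borel_measurable_sum borel_measurable_times)

text \<open>A class of test functions closed under products, containing all polynomial and
  exponential functions that occur, and integrable against every Gaussian weight. The sum norm is
  used because the weight is then bounded one coordinate at a time.\<close>

definition exp_bounded :: "nat \<Rightarrow> (point \<Rightarrow> real) \<Rightarrow> bool" where
  "exp_bounded d w \<longleftrightarrow> w \<in> borel_measurable (lebesgue_Rd d) \<and> (\<exists>B C. \<forall>y. \<bar>w y\<bar> \<le> C * exp (B * norm1 d y))"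

lemma exp_boundedI:
  assumes "w \<in> borel_measurable (lebesgue_Rd d)" "\<And>y. \<bar>w y\<bar> \<le> C * exp (B * norm1 d y)"
  shows "exp_bounded d w"
  using assms unfolding exp_bounded_def by blast

lemma exp_bounded_const [simp]: "exp_bounded d (\<lambda>_. c)"
  by (rule exp_boundedI[of _ _ "\<bar>c\<bar>" 0]) auto

lemma exp_bounded_mult:
  assumes "exp_bounded d w" "exp_bounded d w'"
  shows "exp_bounded d (\<lambda>y. w y * w' y)"
proof -
  obtain B C B' C' where 1: "\<And>y. \<bar>w y\<bar> \<le> C * exp (B * norm1 d y)" and 2: "\<And>y. \<bar>w' y\<bar> \<le> C' * exp (B' * norm1 d y)"
    using assms unfolding exp_bounded_def by blast
  have "\<bar>w y * w' y\<bar> \<le> (C * C') * exp ((B + B') * norm1 d y)" for y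
  proof -
    have "\<bar>w y * w' y\<bar> \<le> (C * exp (B * norm1 d y)) * (C' * exp (B' * norm1 d y))"
      unfolding abs_mult using 1[of y] 2[of y] by (intro mult_mono) (auto intro: order.trans[OF abs_ge_zero])
    then show ?thesis by (simp add: exp_add algebra_simps)
  qed
  then show ?thesis using assms unfolding exp_bounded_def by (blast intro: borel_measurable_times)
qed

lemma exp_bounded_exp_dot: "exp_bounded d (\<lambda>y. exp (R * \<bar>dot d v y\<bar>))"
proof -
  have *: "exp (R * \<bar>dot d v y\<bar>) \<le> 1 * exp ((\<bar>R\<bar> * norm1 d v) * norm1 d y)" for y
  proof -
    have "R * \<bar>dot d v y\<bar> \<le> \<bar>R\<bar> * (norm1 d v * norm1 d y)"
      by (intro mult_mono abs_dot_le) auto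
    then show ?thesis by (simp add: mult.assoc)
  qed
  show ?thesis
  proof (rule exp_boundedI)
    show "\<bar>exp (R * \<bar>dot d v y\<bar>)\<bar> \<le> 1 * exp ((\<bar>R\<bar> * norm1 d v) * norm1 d y)" for y
      using *[of y] by simp
  qed measurable
qed

lemma exp_bounded_dot: "exp_bounded d (dot d v)"
proof -
  have "\<bar>dot d v y\<bar> \<le> norm1 d v * exp (1 * norm1 d y)" for y
    by (rule order.trans[OF abs_dot_le], intro mult_left_mono)
      (auto intro: order.trans[OF _ exp_ge_add_one_self])
  then show ?thesis by (intro exp_boundedI dot_measurable)
qed

lemma dot_unit: "i < d \<Longrightarrow> dot d (\<lambda>k. if k = i then b else 0) y = b * y i"
  unfolding dot_def by (simp add: if_distrib[of "\<lambda>x. x * _"] cong: if_cong)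

lemma exp_bounded_coord:
  assumes "i < d"
  shows "exp_bounded d (\<lambda>y. y i)"
proof -
  have "dot d (\<lambda>k. if k = i then 1 else 0) = (\<lambda>y. y i)"
    by (rule ext) (simp add: dot_unit[OF assms])
  then show ?thesis using exp_bounded_dot[of d "\<lambda>k. if k = i then 1 else 0"] by simp
qed

text \<open>Completing the square in each coordinate. The bound grows with \<open>d\<close>, but it
  serves only integrability and dominated convergence and never enters the constant of the
  theorem.\<close>

lemma gaussian_tail_bound:
  assumes A: "A > 0"
  shows "exp (- A * dot d y y + B * norm1 d y) \<le> exp (real d * (B\<^sup>2 / (4 * A)))"
proof -
  have "- A * dot d y y + B * norm1 d y = (\<Sum>i<d. - A * (y i * y i) + B * \<bar>y i\<bar>)"
    by (simp add: dot_def norm1_def sum_subtractf sum_negf sum_distrib_left)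
  also have "\<dots> \<le> (\<Sum>i<d. B\<^sup>2 / (4 * A))"
  proof (intro sum_mono)
    fix i
    have "0 \<le> (2 * A * \<bar>y i\<bar> - B)\<^sup>2" by simp
    then have "4 * A * (- A * (y i * y i) + B * \<bar>y i\<bar>) \<le> B\<^sup>2"
      by (simp add: power2_eq_square algebra_simps)
    then show "- A * (y i * y i) + B * \<bar>y i\<bar> \<le> B\<^sup>2 / (4 * A)" using A by (simp add: field_simps)
  qed
  finally show ?thesis by simp
qed

section \<open>Gaussian-weighted moments of an arbitrary probability density\<close>

locale Rd_density =
  fixes d :: nat and p :: "point \<Rightarrow> real"
  assumes density: "prob_density d p"
begin

definition \<mu> :: "point measure" where
  "\<mu> = density (lebesgue_Rd d) (\<lambda>x. ennreal (p x))"

lemma p_measurable [measurable]: "p \<in> borel_measurable (lebesgue_Rd d)"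
  and p_nonneg: "x \<in> Rd d \<Longrightarrow> 0 \<le> p x"
  and p_integral: "(\<integral>\<^sup>+x. ennreal (p x) \<partial>lebesgue_Rd d) = 1"
  using density unfolding prob_density_def by auto

lemma sets_\<mu> [measurable_cong]: "sets \<mu> = sets (lebesgue_Rd d)"
  by (simp add: \<mu>_def)

sublocale \<mu>: prob_space \<mu>
  by (rule prob_spaceI) (simp add: \<mu>_def emeasure_density p_integral cong: nn_integral_cong)

text \<open>For \<open>A = t\<^sup>2 / (2 * (1 - t\<^sup>2))\<close> and \<theta> = t x / (1 - t^2)
  this is the likelihood of \<open>y\<close> given X_t = x, up to a factor free of \<open>y\<close>.
  Accordingly \<open>mom A \<theta> w / mom A \<theta> (\<lambda>_. 1)\<close> is the posterior
  expectation of \<open>w\<close>.\<close>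

definition weight :: "real \<Rightarrow> point \<Rightarrow> point \<Rightarrow> real" where
  "weight A \<theta> y = exp (- A * dot d y y + dot d \<theta> y)"

definition mom :: "real \<Rightarrow> point \<Rightarrow> (point \<Rightarrow> real) \<Rightarrow> real" where
  "mom A \<theta> w = (\<integral>y. w y * weight A \<theta> y \<partial>\<mu>)"

lemma weight_measurable [measurable]: "weight A \<theta> \<in> borel_measurable (lebesgue_Rd d)"
  unfolding weight_def by measurable

text \<open>The bound is uniform in \<open>A\<close> and \<theta> because both move with the time
  \<open>t\<close> when \<open>tendsto_mom\<close> applies dominated convergence.\<close>

lemma weighted_bound:
  assumes w: "exp_bounded d w" and A: "A0 > 0"
  shows "\<exists>K. \<forall>A \<theta> y. A0 \<le> A \<longrightarrow> norm1 d \<theta> \<le> T \<longrightarrow> \<bar>w y * weight A \<theta> y\<bar> \<le> K"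
proof -
  obtain B C where w: "\<And>y. \<bar>w y\<bar> \<le> C * exp (B * norm1 d y)"
    using w unfolding exp_bounded_def by blast
  have C: "C \<ge> 0"
    using order.trans[OF abs_ge_zero w[of undefined]] by (simp add: zero_le_mult_iff)
  have "\<bar>w y * weight A \<theta> y\<bar> \<le> C * exp (real d * ((B + T)\<^sup>2 / (4 * A0)))"
    if "A0 \<le> A" "norm1 d \<theta> \<le> T" for A \<theta> y
  proof -
    have dd: "dot d y y \<ge> 0" by (simp add: dot_def sum_nonneg)
    have "dot d \<theta> y \<le> norm1 d \<theta> * norm1 d y" using abs_dot_le[of d \<theta> y] by simp
    also have "\<dots> \<le> T * norm1 d y" using that by (intro mult_right_mono) auto
    finally have "weight A \<theta> y \<le> exp (- A0 * dot d y y + T * norm1 d y)"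
      using that mult_right_mono[OF that(1) dd] unfolding weight_def by simp
    then have "\<bar>w y * weight A \<theta> y\<bar> \<le> (C * exp (B * norm1 d y)) * exp (- A0 * dot d y y + T * norm1 d y)"
      unfolding abs_mult using w[of y] by (intro mult_mono) (auto simp: weight_def intro: order.trans[OF abs_ge_zero])
    also have "\<dots> = C * exp (- A0 * dot d y y + (B + T) * norm1 d y)"
      by (simp add: exp_add[symmetric] algebra_simps)
    also have "\<dots> \<le> C * exp (real d * ((B + T)\<^sup>2 / (4 * A0)))"
      using C gaussian_tail_bound[OF A] by (intro mult_left_mono) auto
    finally show ?thesis .
  qed
  then show ?thesis by blast
qed

lemma mom_integrable:
  assumes w: "exp_bounded d w" and A: "A > 0"
  shows "integrable \<mu> (\<lambda>y. w y * weight A \<theta> y)"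
proof -
  obtain K where "\<And>y. \<bar>w y * weight A \<theta> y\<bar> \<le> K"
    using weighted_bound[OF w A, of "norm1 d \<theta>"] by blast
  moreover have [measurable]: "w \<in> borel_measurable (lebesgue_Rd d)" using w unfolding exp_bounded_def by simp
  ultimately show ?thesis by (intro \<mu>.integrable_const_bound[of _ K]) auto
qed

text \<open>Prepares continuity in \<open>t\<close> at a fixed \<open>x\<close>, where the tilt is
  always a multiple of that \<open>x\<close>.\<close>

lemma tendsto_mom:
  assumes w: "exp_bounded d w" and A: "a \<longlonglongrightarrow> A" "A > 0" and s: "s \<longlonglongrightarrow> S"
  shows "(\<lambda>n. mom (a n) (\<lambda>i. s n * x i) w) \<longlonglongrightarrow> mom A (\<lambda>i. S * x i) w"
proof -
  have "\<forall>\<^sub>F n in sequentially. A / 2 < a n" using A by (intro order_tendstoD) auto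
  moreover have "\<forall>\<^sub>F n in sequentially. \<bar>s n\<bar> < \<bar>S\<bar> + 1"
    by (rule order_tendstoD(2)[OF tendsto_rabs[OF s]]) simp
  ultimately have "\<forall>\<^sub>F n in sequentially. A / 2 < a n \<and> \<bar>s n\<bar> < \<bar>S\<bar> + 1" by (rule eventually_conj)
  then obtain N where N: "\<And>n. n \<ge> N \<Longrightarrow> A / 2 < a n \<and> \<bar>s n\<bar> < \<bar>S\<bar> + 1"
    unfolding eventually_sequentially by blast
  have A2: "A / 2 > 0" using A by simp
  obtain K where K: "\<And>A' \<theta> y. A / 2 \<le> A' \<Longrightarrow> norm1 d \<theta> \<le> (\<bar>S\<bar> + 1) * norm1 d x \<Longrightarrow> \<bar>w y * weight A' \<theta> y\<bar> \<le> K"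
    using weighted_bound[OF w A2, of "(\<bar>S\<bar> + 1) * norm1 d x"] by blast
  have n1: "norm1 d (\<lambda>i. r * x i) = \<bar>r\<bar> * norm1 d x" for r
    by (simp add: norm1_def abs_mult sum_distrib_left)
  have [measurable]: "w \<in> borel_measurable (lebesgue_Rd d)" using w unfolding exp_bounded_def by simp
  have "(\<lambda>n. mom (a (n + N)) (\<lambda>i. s (n + N) * x i) w) \<longlonglongrightarrow> mom A (\<lambda>i. S * x i) w"
    unfolding mom_def
  proof (rule integral_dominated_convergence[where w = "\<lambda>_. K"])
    show "AE y in \<mu>. (\<lambda>n. w y * weight (a (n + N)) (\<lambda>i. s (n + N) * x i) y) \<longlonglongrightarrow> w y * weight A (\<lambda>i. S * x i) y"
      using LIMSEQ_ignore_initial_segment[OF A(1), of N] LIMSEQ_ignore_initial_segment[OF s, of N]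
      unfolding weight_def dot_scale_left by (intro AE_I2 tendsto_intros)
    show "AE y in \<mu>. norm (w y * weight (a (n + N)) (\<lambda>i. s (n + N) * x i) y) \<le> K" for n
      using N[of "n + N"] unfolding real_norm_def
      by (intro AE_I2 K) (auto simp: n1 intro!: mult_right_mono)
  qed auto
  then show ?thesis by (rule LIMSEQ_offset)
qed

lemma weight_line: "weight A (\<lambda>i. \<theta> i + r * v i) y = weight A \<theta> y * exp (r * dot d v y)"
  by (simp add: weight_def dot_add_left dot_scale_left exp_add[symmetric] algebra_simps)

lemma mom_has_derivative:
  assumes w: "exp_bounded d w" and A: "A > 0"
  shows "((\<lambda>r. mom A (\<lambda>i. \<theta> i + r * v i) w) has_real_derivative
    mom A (\<lambda>i. \<theta> i + r * v i) (\<lambda>y. w y * dot d v y)) (at r)"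
proof -
  have [measurable]: "w \<in> borel_measurable (lebesgue_Rd d)" using w unfolding exp_bounded_def by simp
  have "((\<lambda>r. \<integral>y. (w y * weight A \<theta> y) * exp (r * dot d v y) \<partial>\<mu>) has_real_derivative
      (\<integral>y. (w y * weight A \<theta> y) * dot d v y * exp (r * dot d v y) \<partial>\<mu>)) (at r)"
  proof (rule has_real_derivative_integral_exp)
    fix R
    show "integrable \<mu> (\<lambda>y. w y * weight A \<theta> y * exp (R * \<bar>dot d v y\<bar>))"
      using mom_integrable[OF exp_bounded_mult[OF w exp_bounded_exp_dot] A, of R v \<theta>]
      by (simp add: mult_ac)
  qed auto
  then show ?thesis unfolding mom_def weight_line by (simp add: mult_ac)
qed

lemma mom_one_pos:
  assumes A: "A > 0"
  shows "mom A \<theta> (\<lambda>_. 1) > 0"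
proof -
  have "0 \<le> mom A \<theta> (\<lambda>_. 1)" unfolding mom_def by (simp add: weight_def)
  moreover have "mom A \<theta> (\<lambda>_. 1) \<noteq> 0"
  proof
    assume "mom A \<theta> (\<lambda>_. 1) = 0"
    then have "AE y in \<mu>. 1 * weight A \<theta> y = 0"
      unfolding mom_def using mom_integrable[OF exp_bounded_const A, of 1 \<theta>]
      by (subst (asm) integral_nonneg_eq_0_iff_AE) (auto simp: weight_def)
    then have "AE y in \<mu>. False" by (simp add: weight_def)
    then show False using \<mu>.AE_False by blast
  qed
  ultimately show ?thesis by simp
qed

lemma mom_cmult: "mom A \<theta> (\<lambda>y. c * w y) = c * mom A \<theta> w"
  unfolding mom_def by (simp add: mult.assoc)

lemma mom_sum:
  assumes "\<And>i. i \<in> I \<Longrightarrow> exp_bounded d (w i)" "A > 0"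
  shows "mom A \<theta> (\<lambda>y. \<Sum>i\<in>I. w i y) = (\<Sum>i\<in>I. mom A \<theta> (w i))"
  unfolding mom_def using mom_integrable[OF assms(1) assms(2)]
  by (simp add: sum_distrib_right)

end

subsection \<open>The density of the noised variable\<close>

lemma abs_std_normal_density_diff_le:
  "\<bar>std_normal_density a - std_normal_density b\<bar> \<le> \<bar>a - b\<bar>"
proof -
  have "norm (std_normal_density a - std_normal_density b) \<le> 1 * norm (a - b)"
  proof (rule field_differentiable_bound[where S = UNIV and f' = "\<lambda>x. - x * std_normal_density x"])
    fix x :: real
    show "(std_normal_density has_field_derivative - x * std_normal_density x) (at x within UNIV)"
    proof -
      define c where "c = 1 / sqrt (2 * pi)"
      have "std_normal_density = (\<lambda>x. c * exp (- x\<^sup>2 / 2))"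
        by (simp add: std_normal_density_def c_def fun_eq_iff)
      then show ?thesis by (auto intro!: derivative_eq_intros)
    qed
    have "\<bar>x\<bar> \<le> 1 + x\<^sup>2 / 2" using zero_le_power2[of "\<bar>x\<bar> - 1"] by (simp add: power2_eq_square algebra_simps)
    also have "\<dots> \<le> exp (x\<^sup>2 / 2)" by (rule exp_ge_add_one_self)
    finally have "\<bar>x\<bar> * exp (- (x\<^sup>2 / 2)) \<le> 1" by (simp add: exp_minus field_simps)
    moreover have "1 / sqrt (2 * pi) \<le> 1" using pi_ge_two by simp
    ultimately have "(1 / sqrt (2 * pi)) * (\<bar>x\<bar> * exp (- (x\<^sup>2 / 2))) \<le> 1 * 1" by (intro mult_mono) auto
    then show "norm (- x * std_normal_density x) \<le> 1"
      by (simp add: std_normal_density_def abs_mult mult_ac)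
  qed auto
  then show ?thesis by simp
qed

lemma std_normal_density_le_1: "std_normal_density x \<le> 1"
proof -
  have "1 / sqrt (2 * pi) \<le> 1" using pi_ge_two by simp
  then have "(1 / sqrt (2 * pi)) * exp (- x\<^sup>2 / 2) \<le> 1 * 1" by (intro mult_mono) auto
  then show ?thesis by (simp add: std_normal_density_def)
qed

lemma prob_space_std_gaussian: "prob_space (std_gaussian d)"
proof (rule prob_spaceI)
  interpret product_sigma_finite "\<lambda>_. lborel" by standard
  have "emeasure (std_gaussian d) (space (std_gaussian d)) = (\<integral>\<^sup>+x. (\<Prod>i<d. ennreal (std_normal_density (x i))) \<partial>lebesgue_Rd d)"
    unfolding std_gaussian_def
    by (subst emeasure_density) (auto simp: prod_ennreal intro!: nn_integral_cong)
  also have "\<dots> = (\<Prod>i<d. \<integral>\<^sup>+x. ennreal (std_normal_density x) \<partial>lborel)"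
    unfolding lebesgue_Rd_def by (subst product_nn_integral_prod) auto
  also have "(\<integral>\<^sup>+x. ennreal (std_normal_density x) \<partial>lborel) = 1"
    by (subst nn_integral_eq_integral) (auto simp: integral_normal_density integrable_normal_density)
  finally show "emeasure (std_gaussian d) (space (std_gaussian d)) = 1" by simp
qed

lemma sets_std_gaussian [measurable_cong]: "sets (std_gaussian d) = sets (lebesgue_Rd d)"
  by (simp add: std_gaussian_def)

lemma continuous_map_Rd_lipschitz:
  fixes f :: "point \<Rightarrow> real"
  assumes C: "C \<ge> 0" and f: "\<And>x y. x \<in> Rd d \<Longrightarrow> y \<in> Rd d \<Longrightarrow> \<bar>f x - f y\<bar> \<le> C * (\<Sum>i<d. \<bar>x i - y i\<bar>)"
  shows "continuous_map (Rd_top d) euclideanreal f"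
  unfolding continuous_map_def
proof (intro conjI allI impI)
  fix U :: "real set" assume "openin euclideanreal U"
  then have U: "open U" by simp
  show "openin (Rd_top d) {x \<in> topspace (Rd_top d). f x \<in> U}"
    unfolding openin_Rd_top
  proof (intro conjI ballI)
    fix x assume x: "x \<in> {x \<in> topspace (Rd_top d). f x \<in> U}"
    then have xR: "x \<in> Rd d" by (simp add: topspace_Rd_top)
    obtain e where e: "e > 0" "\<And>v. \<bar>v - f x\<bar> < e \<Longrightarrow> v \<in> U"
      using U x unfolding open_dist dist_real_def by blast
    \<comment> \<open>The added ones cover \<open>C = 0\<close> and \<open>d = 0\<close> and make
      the final estimate strict.\<close>
    define \<delta> where "\<delta> = e / ((C + 1) * (real d + 1))"
    have \<delta>: "\<delta> > 0" using e C by (simp add: \<delta>_def)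
    have "cube {..<d} x \<delta> \<subseteq> {x \<in> topspace (Rd_top d). f x \<in> U}"
    proof
      fix y assume y: "y \<in> cube {..<d} x \<delta>"
      have yR: "y \<in> Rd d" using y by (simp add: cube_Rd)
      have "\<bar>f y - f x\<bar> \<le> C * (\<Sum>i<d. \<bar>y i - x i\<bar>)" by (rule f[OF yR xR])
      also have "\<dots> \<le> C * (\<Sum>i<d. \<delta>)"
        using y C by (intro mult_left_mono sum_mono) (auto simp: cube_Rd intro: less_imp_le)
      also have "\<dots> \<le> C * ((real d + 1) * \<delta>)" using C \<delta> by (intro mult_left_mono) auto
      also have "\<dots> < (C + 1) * ((real d + 1) * \<delta>)" using \<delta> by (intro mult_strict_right_mono) auto
      also have "\<dots> = e" using C by (simp add: \<delta>_def)
      finally show "y \<in> {x \<in> topspace (Rd_top d). f x \<in> U}"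
        using e(2) yR by (simp add: topspace_Rd_top)
    qed
    then show "\<exists>e>0. cube {..<d} x e \<subseteq> {x \<in> topspace (Rd_top d). f x \<in> U}" using \<delta> by blast
  qed (auto simp: topspace_Rd_top)
qed auto

text \<open>The set where the two functions differ is open, and a nonempty open set has positive
  measure.\<close>

lemma continuous_map_Rd_AE_eq:
  fixes f g :: "point \<Rightarrow> real"
  assumes f: "continuous_map (Rd_top d) euclideanreal f" and g: "continuous_map (Rd_top d) euclideanreal g"
    and ae: "AE x in lebesgue_Rd d. f x = g x" and x: "x \<in> Rd d"
  shows "f x = g x"
proof (rule ccontr)
  assume ne: "f x \<noteq> g x"
  let ?U = "{x \<in> topspace (Rd_top d). f x - g x \<in> - {0}}"
  have "continuous_map (Rd_top d) euclideanreal (\<lambda>x. f x - g x)"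
    using f g by (rule continuous_map_diff)
  then have op: "openin (Rd_top d) ?U"
    by (rule openin_continuous_map_preimage) auto
  have "x \<in> ?U" using ne x by (simp add: topspace_Rd_top)
  then have "emeasure (lebesgue_Rd d) ?U > 0" using openin_Rd_top_emeasure_pos[OF op] by blast
  moreover have "?U = {x \<in> space (lebesgue_Rd d). f x \<noteq> g x}"
    by (auto simp: topspace_Rd_top space_lebesgue_Rd)
  moreover have "emeasure (lebesgue_Rd d) {x \<in> space (lebesgue_Rd d). f x \<noteq> g x} = 0"
    using openin_Rd_top_measurable[OF op] ae unfolding \<open>?U = _\<close> by (subst (asm) AE_iff_measurable[OF _ refl]) auto
  ultimately show False by simp
qed

section \<open>The transition kernel and the explicit noised density\<close>

context Rd_density
begin

text \<open>The transition density of X_t at \<open>x\<close> given Y = \<open>y\<close>: a Gaussian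
  with mean t y and covariance (1 - t^2) Id.\<close>

definition kernel :: "real \<Rightarrow> point \<Rightarrow> point \<Rightarrow> real" where
  "kernel t x y = (1 / sqrt (1 - t\<^sup>2)) ^ d * (\<Prod>i<d. std_normal_density ((x i - t * y i) / sqrt (1 - t\<^sup>2)))"

text \<open>The square in the exponent of \<open>kernel\<close> is multiplied out. Then
  \<open>x\<close> enters only through an explicit factor and through the tilt of
  \<open>mom\<close>, so that derivatives in \<open>x\<close> turn into posterior moments.\<close>

definition noised_density :: "real \<Rightarrow> point \<Rightarrow> real" where
  "noised_density t x = (1 / sqrt (2 * pi * (1 - t\<^sup>2))) ^ d * exp (- dot d x x / (2 * (1 - t\<^sup>2)))
    * mom (t\<^sup>2 / (2 * (1 - t\<^sup>2))) (\<lambda>i. t / (1 - t\<^sup>2) * x i) (\<lambda>_. 1)"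

lemma kernel_eq:
  assumes t: "0 < t" "t < 1"
  shows "kernel t x y = (1 / sqrt (2 * pi * (1 - t\<^sup>2))) ^ d * exp (- dot d x x / (2 * (1 - t\<^sup>2)))
    * weight (t\<^sup>2 / (2 * (1 - t\<^sup>2))) (\<lambda>i. t / (1 - t\<^sup>2) * x i) y"
proof -
  have s: "1 - t\<^sup>2 > 0" using t by (simp add: power_less_one_iff abs_square_less_1)
  have e: "std_normal_density ((x i - t * y i) / sqrt (1 - t\<^sup>2)) =
    1 / sqrt (2 * pi) * exp (- (x i * x i) / (2 * (1 - t\<^sup>2)) - t\<^sup>2 / (2 * (1 - t\<^sup>2)) * (y i * y i) + t / (1 - t\<^sup>2) * x i * y i)" for i
  proof -
    have "- ((x i - t * y i) / sqrt (1 - t\<^sup>2))\<^sup>2 / 2 = - (x i - t * y i)\<^sup>2 / (2 * (1 - t\<^sup>2))"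
      using s by (simp add: power_divide)
    also have "\<dots> = - (x i * x i) / (2 * (1 - t\<^sup>2)) - t\<^sup>2 / (2 * (1 - t\<^sup>2)) * (y i * y i) + t / (1 - t\<^sup>2) * x i * y i"
    proof -
      have "- (X - t * Y)\<^sup>2 / (2 * u) = - (X * X) / (2 * u) - t\<^sup>2 / (2 * u) * (Y * Y) + t / u * X * Y"
        if "u > 0" for X Y u :: real
        using that by (simp add: field_simps power2_eq_square)
      then show ?thesis using s by blast
    qed
    finally show ?thesis by (simp add: std_normal_density_def)
  qed
  have "kernel t x y = (1 / sqrt (1 - t\<^sup>2)) ^ d * ((1 / sqrt (2 * pi)) ^ d *
      exp (\<Sum>i<d. - (x i * x i) / (2 * (1 - t\<^sup>2)) - t\<^sup>2 / (2 * (1 - t\<^sup>2)) * (y i * y i) + t / (1 - t\<^sup>2) * x i * y i))"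
    unfolding kernel_def e by (simp only: prod.distrib prod_constant card_lessThan exp_sum finite_lessThan)
  also have "(\<Sum>i<d. - (x i * x i) / (2 * (1 - t\<^sup>2)) - t\<^sup>2 / (2 * (1 - t\<^sup>2)) * (y i * y i) + t / (1 - t\<^sup>2) * x i * y i) =
     - dot d x x / (2 * (1 - t\<^sup>2)) + (- (t\<^sup>2 / (2 * (1 - t\<^sup>2))) * dot d y y + dot d (\<lambda>i. t / (1 - t\<^sup>2) * x i) y)"
    by (simp only: dot_def sum.distrib sum_subtractf sum_distrib_left sum_divide_distrib sum_negf)
      (simp add: sum_negf sum_divide_distrib)
  also have "(1 / sqrt (1 - t\<^sup>2)) ^ d * ((1 / sqrt (2 * pi)) ^ d * exp (- dot d x x / (2 * (1 - t\<^sup>2)) + (- (t\<^sup>2 / (2 * (1 - t\<^sup>2))) * dot d y y + dot d (\<lambda>i. t / (1 - t\<^sup>2) * x i) y)))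
     = (1 / sqrt (1 - t\<^sup>2) * (1 / sqrt (2 * pi))) ^ d * exp (- dot d x x / (2 * (1 - t\<^sup>2))) * weight (t\<^sup>2 / (2 * (1 - t\<^sup>2))) (\<lambda>i. t / (1 - t\<^sup>2) * x i) y"
    unfolding weight_def exp_add power_mult_distrib by simp
  also have "1 / sqrt (1 - t\<^sup>2) * (1 / sqrt (2 * pi)) = 1 / sqrt (2 * pi * (1 - t\<^sup>2))"
  proof -
    have "1 / a * (1 / c) = 1 / (c * a)" for a c :: real by simp
    then show ?thesis unfolding real_sqrt_mult[of "2 * pi"] .
  qed
  finally show ?thesis .
qed

lemma one_minus_sq_pos: "0 < t \<Longrightarrow> t < 1 \<Longrightarrow> 1 - t\<^sup>2 > (0::real)"
  by (simp add: abs_square_less_1)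

lemma exponent_pos: "0 < t \<Longrightarrow> t < 1 \<Longrightarrow> t\<^sup>2 / (2 * (1 - t\<^sup>2)) > (0::real)"
  using one_minus_sq_pos[of t] by simp

lemma kernel_nonneg: "0 < t \<Longrightarrow> t < 1 \<Longrightarrow> 0 \<le> kernel t x y"
  unfolding kernel_def using one_minus_sq_pos[of t] by (intro mult_nonneg_nonneg prod_nonneg) auto

lemma noised_density_eq_integral:
  assumes t: "0 < t" "t < 1"
  shows "integrable \<mu> (kernel t x)" "noised_density t x = (\<integral>y. kernel t x y \<partial>\<mu>)"
proof -
  have k: "kernel t x = (\<lambda>y. (1 / sqrt (2 * pi * (1 - t\<^sup>2))) ^ d * exp (- dot d x x / (2 * (1 - t\<^sup>2)))
    * (1 * weight (t\<^sup>2 / (2 * (1 - t\<^sup>2))) (\<lambda>i. t / (1 - t\<^sup>2) * x i) y))"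
    by (rule ext) (simp add: kernel_eq[OF t])
  have i: "integrable \<mu> (\<lambda>y. 1 * weight (t\<^sup>2 / (2 * (1 - t\<^sup>2))) (\<lambda>i. t / (1 - t\<^sup>2) * x i) y)"
    by (rule mom_integrable[OF exp_bounded_const exponent_pos[OF t]])
  show "integrable \<mu> (kernel t x)" unfolding k by (rule integrable_mult_right[OF i])
  show "noised_density t x = (\<integral>y. kernel t x y \<partial>\<mu>)"
    unfolding noised_density_def k mom_def by (rule integral_mult_right_zero[symmetric])
qed

lemma noised_density_pos: "0 < t \<Longrightarrow> t < 1 \<Longrightarrow> noised_density t x > 0"
  unfolding noised_density_def using one_minus_sq_pos[of t] mom_one_pos[OF exponent_pos] by simp

lemma nn_integral_noised_law:
  assumes [measurable]: "h \<in> borel_measurable (lebesgue_Rd d)"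
  shows "(\<integral>\<^sup>+x. h x \<partial>noised_law d p t) =
    (\<integral>\<^sup>+y. (\<integral>\<^sup>+\<xi>. h (lincomb d t y (sqrt (1 - t\<^sup>2)) \<xi>) \<partial>std_gaussian d) \<partial>\<mu>)"
proof -
  interpret G: prob_space "std_gaussian d" by (rule prob_space_std_gaussian)
  have m [measurable]: "(\<lambda>(y, \<xi>). lincomb d t y (sqrt (1 - t\<^sup>2)) \<xi>) \<in> \<mu> \<Otimes>\<^sub>M std_gaussian d \<rightarrow>\<^sub>M lebesgue_Rd d"
    by measurable
  have "(\<integral>\<^sup>+x. h x \<partial>noised_law d p t) =
      (\<integral>\<^sup>+z. h (case z of (y, \<xi>) \<Rightarrow> lincomb d t y (sqrt (1 - t\<^sup>2)) \<xi>) \<partial>(\<mu> \<Otimes>\<^sub>M std_gaussian d))"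
    unfolding noised_law_def \<mu>_def[symmetric] by (rule nn_integral_distr) measurable
  also have "\<dots> = (\<integral>\<^sup>+y. (\<integral>\<^sup>+\<xi>. h (case (y, \<xi>) of (y, \<xi>) \<Rightarrow> lincomb d t y (sqrt (1 - t\<^sup>2)) \<xi>) \<partial>std_gaussian d) \<partial>\<mu>)"
    by (rule G.nn_integral_fst[symmetric]) measurable
  finally show ?thesis by simp
qed

lemma kernel_measurable [measurable]:
  "(\<lambda>(x, y). kernel t x y) \<in> borel_measurable (lebesgue_Rd d \<Otimes>\<^sub>M \<mu>)"
proof -
  have 1 [measurable]: "(\<lambda>z. fst z i) \<in> borel_measurable (lebesgue_Rd d \<Otimes>\<^sub>M \<mu>)" if "i < d" for i
    using measurable_compose[OF measurable_fst coord_measurable[OF that]] .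
  have 2 [measurable]: "(\<lambda>z. snd z i) \<in> borel_measurable (lebesgue_Rd d \<Otimes>\<^sub>M \<mu>)" if "i < d" for i
    by (rule measurable_compose[OF measurable_snd]) (use that in measurable)
  show ?thesis unfolding kernel_def split_beta
    by (intro borel_measurable_times borel_measurable_prod borel_measurable_const
      measurable_compose[OF _ borel_measurable_normal_density] borel_measurable_divide borel_measurable_diff) auto
qed

text \<open>For fixed \<open>y\<close>, substituting x = t y + s \<xi> with s = sqrt (1 - t^2) turns
  the standard Gaussian into \<open>kernel t x y\<close>; exchanging the two integrals then exhibits
  the density.\<close>

lemma noised_law_eq_density:
  assumes t: "0 < t" "t < 1"
  shows "noised_law d p t = density (lebesgue_Rd d) (\<lambda>x. ennreal (noised_density t x))"
    and "noised_density t \<in> borel_measurable (lebesgue_Rd d)"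
proof -
  define s where "s = sqrt (1 - t\<^sup>2)"
  have s: "s > 0" using one_minus_sq_pos[OF t] by (simp add: s_def)
  interpret L: sigma_finite_measure "lebesgue_Rd d"
  proof -
    interpret product_sigma_finite "\<lambda>_. lborel" by standard
    show "sigma_finite_measure (lebesgue_Rd d)" unfolding lebesgue_Rd_def by (rule sigma_finite) simp
  qed
  interpret P: pair_sigma_finite "lebesgue_Rd d" \<mu> by standard
  have nd: "ennreal (noised_density t x) = (\<integral>\<^sup>+y. ennreal (kernel t x y) \<partial>\<mu>)" for x
    unfolding noised_density_eq_integral(2)[OF t]
    by (rule nn_integral_eq_integral[symmetric, OF noised_density_eq_integral(1)[OF t]]) (simp add: kernel_nonneg[OF t])
  show meas [measurable]: "noised_density t \<in> borel_measurable (lebesgue_Rd d)"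
  proof -
    have "noised_density t = (\<lambda>x. \<integral>y. kernel t x y \<partial>\<mu>)"
      by (rule ext) (rule noised_density_eq_integral(2)[OF t])
    then show ?thesis by (simp del: noised_density_def) measurable
  qed
  show "noised_law d p t = density (lebesgue_Rd d) (\<lambda>x. ennreal (noised_density t x))"
  proof (rule measure_eqI)
    show "sets (noised_law d p t) = sets (density (lebesgue_Rd d) (\<lambda>x. ennreal (noised_density t x)))"
      by (simp add: noised_law_def)
    fix B assume "B \<in> sets (noised_law d p t)"
    then have B [measurable]: "B \<in> sets (lebesgue_Rd d)" by (simp add: noised_law_def)
    have inner: "(\<integral>\<^sup>+\<xi>. indicator B (lincomb d t y s \<xi>) \<partial>std_gaussian d) =
        (\<integral>\<^sup>+x. ennreal (kernel t x y) * indicator B x \<partial>lebesgue_Rd d)" for y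
    proof -
      let ?F = "\<lambda>x. ennreal (\<Prod>i<d. std_normal_density ((x i - t * y i) / s)) * indicator B x"
      have "(\<integral>\<^sup>+x. ?F x \<partial>lebesgue_Rd d) = ennreal (\<bar>s\<bar> ^ card {..<d}) * (\<integral>\<^sup>+\<xi>. ?F (\<lambda>i\<in>{..<d}. t * y i + s * \<xi> i) \<partial>lebesgue_Rd d)"
        unfolding lebesgue_Rd_def
      proof (rule nn_integral_PiM_affine)
        show "?F \<in> borel_measurable (PiM {..<d} (\<lambda>_. lborel))"
          unfolding lebesgue_Rd_def[symmetric] by measurable
      qed (use s in auto)
      also have "(\<integral>\<^sup>+\<xi>. ?F (\<lambda>i\<in>{..<d}. t * y i + s * \<xi> i) \<partial>lebesgue_Rd d) =
          (\<integral>\<^sup>+\<xi>. ennreal (\<Prod>i<d. std_normal_density (\<xi> i)) * indicator B (lincomb d t y s \<xi>) \<partial>lebesgue_Rd d)"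
        using s by (intro nn_integral_cong) (simp add: lincomb_def)
      also have "\<dots> = (\<integral>\<^sup>+\<xi>. indicator B (lincomb d t y s \<xi>) \<partial>std_gaussian d)"
        unfolding std_gaussian_def
      proof (rule nn_integral_density[symmetric])
        have "(\<lambda>\<xi>. lincomb d t y s \<xi>) \<in> lebesgue_Rd d \<rightarrow>\<^sub>M lebesgue_Rd d"
          unfolding lincomb_def lebesgue_Rd_def by measurable
        then show "(\<lambda>\<xi>. indicator B (lincomb d t y s \<xi>)) \<in> borel_measurable (lebesgue_Rd d)"
          by measurable
      qed measurable
      finally have e: "(\<integral>\<^sup>+x. ?F x \<partial>lebesgue_Rd d) = ennreal (s ^ d) * (\<integral>\<^sup>+\<xi>. indicator B (lincomb d t y s \<xi>) \<partial>std_gaussian d)"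
        using s by simp
      have "(\<integral>\<^sup>+x. ennreal (kernel t x y) * indicator B x \<partial>lebesgue_Rd d) =
          (\<integral>\<^sup>+x. ennreal ((1 / s) ^ d) * ?F x \<partial>lebesgue_Rd d)"
        using s by (intro nn_integral_cong) (simp add: kernel_def s_def[symmetric] ennreal_mult'' prod_nonneg mult_ac)
      also have "\<dots> = ennreal ((1 / s) ^ d) * (\<integral>\<^sup>+x. ?F x \<partial>lebesgue_Rd d)"
        by (rule nn_integral_cmult) measurable
      also have "\<dots> = (ennreal ((1 / s) ^ d) * ennreal (s ^ d)) * (\<integral>\<^sup>+\<xi>. indicator B (lincomb d t y s \<xi>) \<partial>std_gaussian d)"
        unfolding e by (simp add: mult.assoc)
      also have "ennreal ((1 / s) ^ d) * ennreal (s ^ d) = 1"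
        using s by (simp add: ennreal_mult''[symmetric] power_divide)
      finally show ?thesis by simp
    qed
    have "emeasure (noised_law d p t) B = (\<integral>\<^sup>+x. indicator B x \<partial>noised_law d p t)"
      using \<open>B \<in> sets (noised_law d p t)\<close> by simp
    also have "\<dots> = (\<integral>\<^sup>+y. (\<integral>\<^sup>+x. ennreal (kernel t x y) * indicator B x \<partial>lebesgue_Rd d) \<partial>\<mu>)"
      by (subst nn_integral_noised_law) (simp_all add: s_def[symmetric] inner)
    also have "\<dots> = (\<integral>\<^sup>+x. (\<integral>\<^sup>+y. ennreal (kernel t x y) * indicator B x \<partial>\<mu>) \<partial>lebesgue_Rd d)"
      by (rule P.Fubini') measurable
    also have "\<dots> = (\<integral>\<^sup>+x. ennreal (noised_density t x) * indicator B x \<partial>lebesgue_Rd d)"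
      unfolding nd by (intro nn_integral_cong nn_integral_multc) measurable
    also have "\<dots> = emeasure (density (lebesgue_Rd d) (\<lambda>x. ennreal (noised_density t x))) B"
      by (rule emeasure_density[symmetric]) measurable
    finally show "emeasure (noised_law d p t) B = emeasure (density (lebesgue_Rd d) (\<lambda>x. ennreal (noised_density t x))) B" .
  qed
qed

text \<open>\<open>kernel\<close> is Lipschitz in \<open>x\<close> uniformly in \<open>y\<close>:
  all factors are at most 1, so the difference of two products is at most the sum of the
  differences.\<close>

lemma continuous_map_noised_density:
  assumes t: "0 < t" "t < 1"
  shows "continuous_map (Rd_top d) euclideanreal (noised_density t)"
proof (rule continuous_map_Rd_lipschitz)
  define s where "s = sqrt (1 - t\<^sup>2)"
  have s: "s > 0" using one_minus_sq_pos[OF t] by (simp add: s_def)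
  show "0 \<le> (1 / s) ^ d * (1 / s)" using s by simp
  fix x x' :: point
  have ker: "\<bar>kernel t x y - kernel t x' y\<bar> \<le> (1 / s) ^ d * (1 / s) * (\<Sum>i<d. \<bar>x i - x' i\<bar>)" for y
  proof -
    have "\<bar>(\<Prod>i<d. std_normal_density ((x i - t * y i) / s)) - (\<Prod>i<d. std_normal_density ((x' i - t * y i) / s))\<bar>
        \<le> (\<Sum>i<d. \<bar>std_normal_density ((x i - t * y i) / s) - std_normal_density ((x' i - t * y i) / s)\<bar>)"
      using norm_prod_diff[of "{..<d}" "\<lambda>i. std_normal_density ((x i - t * y i) / s)" "\<lambda>i. std_normal_density ((x' i - t * y i) / s)"]
      by (simp add: std_normal_density_le_1)
    also have "\<dots> \<le> (\<Sum>i<d. (1 / s) * \<bar>x i - x' i\<bar>)"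
    proof (intro sum_mono order.trans[OF abs_std_normal_density_diff_le])
      fix i
      have "(x i - t * y i) / s - (x' i - t * y i) / s = (1 / s) * (x i - x' i)" by (simp add: diff_divide_distrib)
      then show "\<bar>(x i - t * y i) / s - (x' i - t * y i) / s\<bar> \<le> (1 / s) * \<bar>x i - x' i\<bar>"
        using s by (simp add: abs_mult)
    qed
    finally have "(1 / s) ^ d * \<bar>(\<Prod>i<d. std_normal_density ((x i - t * y i) / s)) - (\<Prod>i<d. std_normal_density ((x' i - t * y i) / s))\<bar>
        \<le> (1 / s) ^ d * (\<Sum>i<d. (1 / s) * \<bar>x i - x' i\<bar>)" using s by (intro mult_left_mono) auto
    moreover have "\<bar>kernel t x y - kernel t x' y\<bar> = (1 / s) ^ d * \<bar>(\<Prod>i<d. std_normal_density ((x i - t * y i) / s)) - (\<Prod>i<d. std_normal_density ((x' i - t * y i) / s))\<bar>"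
      using s unfolding kernel_def s_def[symmetric] right_diff_distrib[symmetric] abs_mult by simp
    ultimately show ?thesis by (simp add: sum_distrib_left mult_ac)
  qed
  have "\<bar>noised_density t x - noised_density t x'\<bar> = \<bar>\<integral>y. kernel t x y - kernel t x' y \<partial>\<mu>\<bar>"
    unfolding noised_density_eq_integral(2)[OF t]
    by (subst Bochner_Integration.integral_diff[OF noised_density_eq_integral(1)[OF t] noised_density_eq_integral(1)[OF t]]) simp
  also have "\<dots> \<le> (\<integral>y. \<bar>kernel t x y - kernel t x' y\<bar> \<partial>\<mu>)" by (rule integral_abs_bound)
  also have "\<dots> \<le> (\<integral>y. (1 / s) ^ d * (1 / s) * (\<Sum>i<d. \<bar>x i - x' i\<bar>) \<partial>\<mu>)"
    by (intro integral_mono ker integrable_abs Bochner_Integration.integrable_diff noised_density_eq_integral(1)[OF t]) simp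
  also have "\<dots> = (1 / s) ^ d * (1 / s) * (\<Sum>i<d. \<bar>x i - x' i\<bar>)" by (simp add: \<mu>.prob_space)
  finally show "\<bar>noised_density t x - noised_density t x'\<bar> \<le> (1 / s) ^ d * (1 / s) * (\<Sum>i<d. \<bar>x i - x' i\<bar>)" .
qed

text \<open>Identifies the given density of X_t with the explicit formula at every point of
  \<open>Rd d\<close>, not just almost everywhere, as needed before differentiating.\<close>

lemma continuous_density_eq_noised_density:
  assumes t: "0 < t" "t < 1" and f: "continuous_density d (noised_law d p t) f" and x: "x \<in> Rd d"
  shows "f x = noised_density t x"
proof (rule continuous_map_Rd_AE_eq[OF _ continuous_map_noised_density[OF t] _ x])
  show "continuous_map (Rd_top d) euclideanreal f" using f unfolding continuous_density_def by blast
  interpret L: sigma_finite_measure "lebesgue_Rd d"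
  proof -
    interpret product_sigma_finite "\<lambda>_. lborel" by standard
    show "sigma_finite_measure (lebesgue_Rd d)" unfolding lebesgue_Rd_def by (rule sigma_finite) simp
  qed
  have [measurable]: "f \<in> borel_measurable (lebesgue_Rd d)" and nn: "\<And>x. x \<in> Rd d \<Longrightarrow> 0 \<le> f x"
    using f unfolding continuous_density_def prob_density_def by auto
  note [measurable] = noised_law_eq_density(2)[OF t]
  have "density (lebesgue_Rd d) (\<lambda>x. ennreal (f x)) = density (lebesgue_Rd d) (\<lambda>x. ennreal (noised_density t x))"
    using f noised_law_eq_density(1)[OF t] unfolding continuous_density_def by simp
  then have "AE x in lebesgue_Rd d. ennreal (f x) = ennreal (noised_density t x)"
    by (intro L.density_unique) auto
  then show "AE x in lebesgue_Rd d. f x = noised_density t x"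
    using AE_space by eventually_elim (auto simp: space_lebesgue_Rd nn less_imp_le[OF noised_density_pos[OF t]])
qed

end

subsection \<open>The score and its Jacobian\<close>

text \<open>This is 2 cosh x = 2 + (2 sinh (x/2))^2 combined with sinh u \<ge> u for u \<ge> 0. The
  constants 2 and 1 are what keeps the leading constant of the variance bound equal to 1.\<close>

lemma exp_plus_exp_minus_ge: "2 + x\<^sup>2 \<le> exp x + exp (- x)" for x :: real
proof -
  have half: "2 * u \<le> exp u - exp (- u)" if u: "0 \<le> u" for u :: real
  proof -
    \<comment> \<open>For this quadratic Taylor polynomial, q - 1/q \<ge> 2 u is a polynomial
      inequality, and x - 1/x increases from \<open>q\<close> to \<open>exp u\<close>.\<close>
    define q where "q = 1 + u + u\<^sup>2 / 2"
    have q1: "q \<ge> 1" using u by (simp add: q_def)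
    have qe: "q \<le> exp u" using exp_lower_Taylor_quadratic[OF u] by (simp add: q_def)
    have "q\<^sup>2 - 1 - 2 * u * q = u ^ 4 / 4"
      by (simp add: q_def power2_eq_square field_simps) (simp add: algebra_simps power4_eq_xxxx)
    moreover have "u ^ 4 / 4 \<ge> 0" using u by simp
    ultimately have "2 * u * q \<le> q\<^sup>2 - 1" by linarith
    then have "2 * u \<le> q - 1 / q" using q1 by (simp add: field_simps power2_eq_square)
    also have "\<dots> \<le> exp u - 1 / exp u" using qe q1 by (intro diff_mono divide_left_mono) auto
    finally show ?thesis by (simp add: exp_minus inverse_eq_divide)
  qed
  have "(2 * \<bar>x / 2\<bar>)\<^sup>2 \<le> (exp \<bar>x / 2\<bar> - exp (- \<bar>x / 2\<bar>))\<^sup>2"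
    by (intro power_mono half) auto
  also have "\<dots> = exp \<bar>x\<bar> + exp (- \<bar>x\<bar>) - 2"
  proof -
    have "(exp a - exp (- a))\<^sup>2 = exp (2 * a) + exp (- (2 * a)) - 2" for a :: real
    proof -
      have "exp (2 * a) = exp a * exp a" "exp (- (2 * a)) = exp (- a) * exp (- a)" "exp a * exp (- a) = 1"
        by (simp_all add: exp_add[symmetric])
      then show ?thesis by (simp add: power2_eq_square algebra_simps)
    qed
    from this[of "\<bar>x / 2\<bar>"] show ?thesis by simp
  qed
  also have "exp \<bar>x\<bar> + exp (- \<bar>x\<bar>) = exp x + exp (- x)" by (simp add: abs_if)
  finally show ?thesis by simp
qed

text \<open>Since \<open>mid\<close> only involves the distance of \<open>y\<close> and \<open>z\<close> in the applications, \<open>E\<close> does not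
  depend on the dimension.\<close>

lemma prekopa_leindler_mgf:
  fixes f :: "point \<Rightarrow> real"
  assumes [measurable]: "f \<in> borel_measurable (lebesgue_Rd d)"
    and nn: "\<And>y. y \<in> Rd d \<Longrightarrow> 0 \<le> f y"
    and mid: "\<And>y z. y \<in> Rd d \<Longrightarrow> z \<in> Rd d \<Longrightarrow>
      f y * f z * exp (dot d v y - dot d v z) \<le> exp E * (f (\<lambda>i\<in>{..<d}. (y i + z i) / 2))\<^sup>2"
  shows "(\<integral>\<^sup>+y. ennreal (f y * exp (dot d v y)) \<partial>lebesgue_Rd d) * (\<integral>\<^sup>+y. ennreal (f y * exp (- dot d v y)) \<partial>lebesgue_Rd d)
    \<le> ennreal (exp E) * (\<integral>\<^sup>+y. ennreal (f y) \<partial>lebesgue_Rd d)\<^sup>2"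
proof -
  have meas: "(\<lambda>y. ennreal (f y * exp (dot d v y))) \<in> borel_measurable (lebesgue_Rd d)"
    "(\<lambda>y. ennreal (f y * exp (- dot d v y))) \<in> borel_measurable (lebesgue_Rd d)"
    "(\<lambda>y. ennreal (exp (E / 2) * f y)) \<in> borel_measurable (lebesgue_Rd d)"
    by measurable
  have "(\<integral>\<^sup>+y. ennreal (f y * exp (dot d v y)) \<partial>lebesgue_Rd d) * (\<integral>\<^sup>+y. ennreal (f y * exp (- dot d v y)) \<partial>lebesgue_Rd d)
    \<le> (\<integral>\<^sup>+y. ennreal (exp (E / 2) * f y) \<partial>lebesgue_Rd d)\<^sup>2"
    unfolding lebesgue_Rd_def
  proof (rule prekopa_leindler_PiM)
    fix y z :: point assume yz: "y \<in> PiE {..<d} (\<lambda>_. UNIV)" "z \<in> PiE {..<d} (\<lambda>_. UNIV)"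
    then have yz': "y \<in> Rd d" "z \<in> Rd d" by (simp_all add: Rd_def)
    let ?m = "\<lambda>i\<in>{..<d}. (y i + z i) / 2"
    have "(f y * exp (dot d v y)) * (f z * exp (- dot d v z)) = f y * f z * exp (dot d v y - dot d v z)"
      by (simp add: exp_diff exp_minus field_simps)
    also have "\<dots> \<le> exp E * (f ?m)\<^sup>2" by (rule mid[OF yz'])
    also have "\<dots> = (exp (E / 2) * f ?m)\<^sup>2"
      by (simp add: power_mult_distrib power2_eq_square exp_add[symmetric])
    finally show "ennreal (f y * exp (dot d v y)) * ennreal (f z * exp (- dot d v z)) \<le> (ennreal (exp (E / 2) * f ?m))\<^sup>2"
      using nn[OF yz'(1)] nn[OF yz'(2)] nn[OF restrict_in_Rd]
      by (simp add: ennreal_mult''[symmetric] ennreal_power ennreal_leI)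
  qed (use meas in \<open>simp_all add: lebesgue_Rd_def\<close>)
  also have "(\<integral>\<^sup>+y. ennreal (exp (E / 2) * f y) \<partial>lebesgue_Rd d) = ennreal (exp (E / 2)) * (\<integral>\<^sup>+y. ennreal (f y) \<partial>lebesgue_Rd d)"
    by (subst nn_integral_cmult[symmetric]) (auto simp: ennreal_mult' intro!: nn_integral_cong)
  also have "\<dots>\<^sup>2 = ennreal (exp E) * (\<integral>\<^sup>+y. ennreal (f y) \<partial>lebesgue_Rd d)\<^sup>2"
  proof -
    have "(ennreal (exp (E / 2)))\<^sup>2 = ennreal (exp E)"
      by (simp add: power2_eq_square ennreal_mult''[symmetric] exp_add[symmetric])
    then show ?thesis by (simp only: power_mult_distrib)
  qed
  finally show ?thesis .
qed

text \<open>Off its coordinate it is 0, not \<open>undefined\<close>; thus the update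
  \<open>x(i := r)\<close> is a point of a line in direction \<open>unit_pt i\<close>, as an
  equation between functions.\<close>

definition unit_pt :: "nat \<Rightarrow> point" where
  "unit_pt i = (\<lambda>k. if k = i then 1 else 0)"

lemma dot_unit_pt: "i < d \<Longrightarrow> dot d (unit_pt i) y = y i" "i < d \<Longrightarrow> dot d y (unit_pt i) = y i"
  by (simp_all add: unit_pt_def dot_unit dot_commute[of d y])

lemma upd_eq_line: "x(i := r) = (\<lambda>k. x k + (r - x i) * unit_pt i k)"
  by (auto simp: unit_pt_def fun_eq_iff)

context Rd_density
begin

text \<open>The right-hand side is the integral of exp (l(y) - l(z)) over two independent copies, l
  being \<open>dot d v\<close>. Symmetrising gives cosh (l(y) - l(z)), which is at least 1 + (l(y) -
  l(z))^2 / 2, and the square integrates to twice the unnormalised variance.\<close>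

lemma mom_mgf_ge:
  assumes A: "A > 0"
  shows "(mom A \<theta> (\<lambda>_. 1))\<^sup>2 + (mom A \<theta> (\<lambda>y. (dot d v y)\<^sup>2) * mom A \<theta> (\<lambda>_. 1) - (mom A \<theta> (dot d v))\<^sup>2)
    \<le> mom A (\<lambda>i. \<theta> i + v i) (\<lambda>_. 1) * mom A (\<lambda>i. \<theta> i - v i) (\<lambda>_. 1)"
proof -
  let ?W = "weight A \<theta>" and ?l = "dot d v"
  define m0 where "m0 = mom A \<theta> (\<lambda>_. 1)"
  define m1 where "m1 = mom A \<theta> ?l"
  define m2 where "m2 = mom A \<theta> (\<lambda>y. (?l y)\<^sup>2)"
  define P where "P = mom A (\<lambda>i. \<theta> i + v i) (\<lambda>_. 1)"
  define N where "N = mom A (\<lambda>i. \<theta> i - v i) (\<lambda>_. 1)"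
  have e2: "exp_bounded d (\<lambda>y. (?l y)\<^sup>2)"
    using exp_bounded_mult[OF exp_bounded_dot exp_bounded_dot, of d v v] by (simp add: power2_eq_square)
  have Wp: "weight A (\<lambda>i. \<theta> i + v i) y = ?W y * exp (?l y)"
    and Wn: "weight A (\<lambda>i. \<theta> i - v i) y = ?W y * exp (- ?l y)" for y
    using weight_line[of A \<theta> 1 v y] weight_line[of A \<theta> "-1" v y] by simp_all
  have i0: "integrable \<mu> ?W" and i1: "integrable \<mu> (\<lambda>y. ?l y * ?W y)" and i2: "integrable \<mu> (\<lambda>y. (?l y)\<^sup>2 * ?W y)"
    using mom_integrable[OF exp_bounded_const A, of 1 \<theta>] mom_integrable[OF exp_bounded_dot A, of v \<theta>] mom_integrable[OF e2 A, of \<theta>]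
    by simp_all
  have ip: "integrable \<mu> (\<lambda>y. ?W y * exp (?l y))" and "in": "integrable \<mu> (\<lambda>y. ?W y * exp (- ?l y))"
    using mom_integrable[OF exp_bounded_const A, of 1 "\<lambda>i. \<theta> i + v i"] mom_integrable[OF exp_bounded_const A, of 1 "\<lambda>i. \<theta> i - v i"]
    by (simp_all add: Wp Wn)
  have Pd: "P = (\<integral>y. ?W y * exp (?l y) \<partial>\<mu>)" and Nd: "N = (\<integral>y. ?W y * exp (- ?l y) \<partial>\<mu>)"
    unfolding P_def N_def mom_def by (simp_all add: Wp Wn)
  have md: "m0 = (\<integral>y. ?W y \<partial>\<mu>)" "m1 = (\<integral>y. ?l y * ?W y \<partial>\<mu>)" "m2 = (\<integral>y. (?l y)\<^sup>2 * ?W y \<partial>\<mu>)"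
    unfolding m0_def m1_def m2_def mom_def by simp_all
  \<comment> \<open>\<open>q\<close> stands for the value of \<open>dot d v\<close> at the second
    copy. Integrating one copy at a time avoids the product measure.\<close>
  have inner: "2 * m0 + (m2 - 2 * q * m1 + q\<^sup>2 * m0) \<le> exp (- q) * P + exp q * N" for q
  proof -
    have "2 * m0 + (m2 - 2 * q * m1 + q\<^sup>2 * m0) = (\<integral>y. 2 * ?W y + ((?l y)\<^sup>2 * ?W y - 2 * q * (?l y * ?W y) + q\<^sup>2 * ?W y) \<partial>\<mu>)"
      unfolding md by (simp add: i0 i1 i2)
    also have "\<dots> \<le> (\<integral>y. exp (- q) * (?W y * exp (?l y)) + exp q * (?W y * exp (- ?l y)) \<partial>\<mu>)"
    proof (intro integral_mono)
      fix y
      have "2 * ?W y + ((?l y)\<^sup>2 * ?W y - 2 * q * (?l y * ?W y) + q\<^sup>2 * ?W y) = ?W y * (2 + (?l y - q)\<^sup>2)"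
        by (simp add: power2_eq_square algebra_simps)
      also have "\<dots> \<le> ?W y * (exp (?l y - q) + exp (- (?l y - q)))"
        by (intro mult_left_mono exp_plus_exp_minus_ge) (simp add: weight_def)
      also have "\<dots> = exp (- q) * (?W y * exp (?l y)) + exp q * (?W y * exp (- ?l y))"
        by (simp add: exp_diff exp_minus field_simps)
      finally show "2 * ?W y + ((?l y)\<^sup>2 * ?W y - 2 * q * (?l y * ?W y) + q\<^sup>2 * ?W y)
        \<le> exp (- q) * (?W y * exp (?l y)) + exp q * (?W y * exp (- ?l y))" .
    qed (intro Bochner_Integration.integrable_add Bochner_Integration.integrable_diff integrable_mult_right i0 i1 i2 ip "in")+
    also have "\<dots> = exp (- q) * P + exp q * N" unfolding Pd Nd by (simp add: ip "in")
    finally show ?thesis .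
  qed
  have "2 * m0 * m0 + (m2 * m0 - 2 * m1 * m1 + m0 * m2) = (\<integral>y. (2 * m0) * ?W y + (m2 * ?W y - (2 * m1) * (?l y * ?W y) + m0 * ((?l y)\<^sup>2 * ?W y)) \<partial>\<mu>)"
    by (simp add: i0 i1 i2 md[symmetric])
  also have "\<dots> \<le> (\<integral>y. P * (?W y * exp (- ?l y)) + N * (?W y * exp (?l y)) \<partial>\<mu>)"
  proof (intro integral_mono)
    fix y
    have "(2 * m0) * ?W y + (m2 * ?W y - (2 * m1) * (?l y * ?W y) + m0 * ((?l y)\<^sup>2 * ?W y)) =
       ?W y * (2 * m0 + (m2 - 2 * ?l y * m1 + (?l y)\<^sup>2 * m0))" by (simp add: algebra_simps)
    also have "\<dots> \<le> ?W y * (exp (- ?l y) * P + exp (?l y) * N)"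
      by (intro mult_left_mono inner) (simp add: weight_def)
    finally show "(2 * m0) * ?W y + (m2 * ?W y - (2 * m1) * (?l y * ?W y) + m0 * ((?l y)\<^sup>2 * ?W y))
        \<le> P * (?W y * exp (- ?l y)) + N * (?W y * exp (?l y))" by (simp add: algebra_simps)
  qed (intro Bochner_Integration.integrable_add Bochner_Integration.integrable_diff integrable_mult_right i0 i1 i2 ip "in")+
  also have "\<dots> = P * N + N * P" unfolding Pd Nd by (simp add: ip "in")
  finally show ?thesis unfolding m0_def[symmetric] m1_def[symmetric] m2_def[symmetric] P_def[symmetric] N_def[symmetric]
    by (simp add: power2_eq_square algebra_simps)
qed

text \<open>Prekopa--Leindler is applied to a modification \<open>g\<close> of \<open>p\<close> that
  satisfies the midpoint inequality everywhere; the moments do not see the difference.\<close>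

lemma mom_eq_nn_integral:
  assumes A: "A > 0" and ae: "AE y in lebesgue_Rd d. p y = g y" and [measurable]: "g \<in> borel_measurable (lebesgue_Rd d)"
  shows "(\<integral>\<^sup>+y. ennreal (g y * weight A \<theta> y) \<partial>lebesgue_Rd d) = ennreal (mom A \<theta> (\<lambda>_. 1))"
proof -
  have "(\<integral>\<^sup>+y. ennreal (g y * weight A \<theta> y) \<partial>lebesgue_Rd d) = (\<integral>\<^sup>+y. ennreal (p y) * ennreal (weight A \<theta> y) \<partial>lebesgue_Rd d)"
    using ae by (intro nn_integral_cong_AE) (auto simp: ennreal_mult'' weight_def)
  also have "\<dots> = (\<integral>\<^sup>+y. ennreal (weight A \<theta> y) \<partial>\<mu>)"
    unfolding \<mu>_def by (rule nn_integral_density[symmetric]) measurable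
  also have "\<dots> = ennreal (\<integral>y. weight A \<theta> y \<partial>\<mu>)"
    using mom_integrable[OF exp_bounded_const A, of 1 \<theta>]
    by (intro nn_integral_eq_integral) (auto simp: weight_def)
  finally show ?thesis by (simp add: mom_def)
qed

text \<open>Tweedie's formula for the score in direction \<open>u\<close>: - x / (1 - t^2) plus t /
  (1 - t^2) times the posterior mean.\<close>

definition drift :: "real \<Rightarrow> point \<Rightarrow> point \<Rightarrow> real" where
  "drift t x u = - dot d x u / (1 - t\<^sup>2) + t / (1 - t\<^sup>2) *
    (mom (t\<^sup>2 / (2 * (1 - t\<^sup>2))) (\<lambda>i. t / (1 - t\<^sup>2) * x i) (dot d u) /
     mom (t\<^sup>2 / (2 * (1 - t\<^sup>2))) (\<lambda>i. t / (1 - t\<^sup>2) * x i) (\<lambda>_. 1))"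

text \<open>The second derivative of the log-density in directions \<open>u\<close> and
  \<open>v\<close>: the Gaussian part plus (t / (1 - t^2))^2 times the posterior covariance of the
  two linear forms.\<close>

definition log_hess :: "real \<Rightarrow> point \<Rightarrow> point \<Rightarrow> point \<Rightarrow> real" where
  "log_hess t x u v = - dot d u v / (1 - t\<^sup>2) + (t / (1 - t\<^sup>2))\<^sup>2 *
    (let m = mom (t\<^sup>2 / (2 * (1 - t\<^sup>2))) (\<lambda>i. t / (1 - t\<^sup>2) * x i) in
     m (\<lambda>y. dot d u y * dot d v y) / m (\<lambda>_. 1) - m (dot d u) * m (dot d v) / (m (\<lambda>_. 1))\<^sup>2)"

lemma mom_line_derivative:
  assumes w: "exp_bounded d w" and A: "A > 0"
  shows "((\<lambda>r. mom A (\<lambda>i. b * (x i + r * v i)) w) has_real_derivative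
    b * mom A (\<lambda>i. b * (x i + r * v i)) (\<lambda>y. w y * dot d v y)) (at r)"
proof -
  have eq: "(\<lambda>i. b * (x i + r * v i)) = (\<lambda>i. b * x i + r * (b * v i))" for r
    by (simp add: algebra_simps)
  have "(\<lambda>y. w y * dot d (\<lambda>i. b * v i) y) = (\<lambda>y. b * (w y * dot d v y))"
    by (simp add: dot_scale_left mult_ac)
  then show ?thesis
    using mom_has_derivative[OF w A, of "\<lambda>i. b * x i" "\<lambda>i. b * v i" r] by (simp add: eq mom_cmult)
qed

text \<open>Coordinate directions \<open>v\<close> yield the score; general directions yield strong
  log-concavity in \<open>noised_density_midpoint\<close>.\<close>

lemma ln_noised_density_derivative:
  assumes t: "0 < t" "t < 1"
  shows "((\<lambda>r. ln (noised_density t (\<lambda>i. x i + r * v i))) has_real_derivative drift t (\<lambda>i. x i + r * v i) v) (at r)"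
proof -
  define A where "A = t\<^sup>2 / (2 * (1 - t\<^sup>2))"
  define b where "b = t / (1 - t\<^sup>2)"
  define u where "u = 1 - t\<^sup>2"
  have u: "u > 0" using one_minus_sq_pos[OF t] by (simp add: u_def)
  have A: "A > 0" using exponent_pos[OF t] by (simp add: A_def)
  define c where "c = (1 / sqrt (2 * pi * u)) ^ d"
  have c: "c > 0" using u by (simp add: c_def)
  let ?m = "\<lambda>r. mom A (\<lambda>i. b * (x i + r * v i)) (\<lambda>_. 1)" and ?m' = "mom A (\<lambda>i. b * (x i + r * v i))"
  have mp: "?m r > 0" for r by (rule mom_one_pos[OF A])
  have "ln (noised_density t (\<lambda>i. x i + r * v i)) =
      ln c - (dot d x x + 2 * r * dot d x v + r\<^sup>2 * dot d v v) / (2 * u) + ln (?m r)" for r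
  proof -
    have "dot d (\<lambda>i. x i + r * v i) (\<lambda>i. x i + r * v i) = dot d x x + 2 * r * dot d x v + r\<^sup>2 * dot d v v"
      by (simp add: dot_def power2_eq_square algebra_simps sum.distrib sum_distrib_left)
    then have "noised_density t (\<lambda>i. x i + r * v i) = c * exp (- (dot d x x + 2 * r * dot d x v + r\<^sup>2 * dot d v v) / (2 * u)) * ?m r"
      by (simp add: noised_density_def A_def b_def c_def u_def)
    moreover have "ln (c * exp (- q / (2 * u)) * ?m r) = ln c - q / (2 * u) + ln (?m r)" for q
      using c mp[of r] by (simp add: ln_mult_pos)
    ultimately show ?thesis by (simp only:)
  qed
  moreover have "((\<lambda>r. ln c - (dot d x x + 2 * r * dot d x v + r\<^sup>2 * dot d v v) / (2 * u) + ln (?m r)) has_real_derivative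
      - (dot d x v + r * dot d v v) / u + (b * mom A (\<lambda>i. b * (x i + r * v i)) (\<lambda>y. 1 * dot d v y)) / ?m r) (at r)"
  proof (rule DERIV_add)
    show "((\<lambda>r. ln c - (dot d x x + 2 * r * dot d x v + r\<^sup>2 * dot d v v) / (2 * u)) has_real_derivative
        - (dot d x v + r * dot d v v) / u) (at r)"
      using u by (auto intro!: derivative_eq_intros simp: field_simps)
    have "(?m has_real_derivative b * ?m' (\<lambda>y. 1 * dot d v y)) (at r)"
      by (rule mom_line_derivative[OF exp_bounded_const A])
    from DERIV_chain2[OF DERIV_ln_divide[OF mp] this]
    show "((\<lambda>r. ln (?m r)) has_real_derivative (b * ?m' (\<lambda>y. 1 * dot d v y)) / ?m r) (at r)" by simp
  qed
  moreover have "dot d (\<lambda>i. x i + r * v i) v = dot d x v + r * dot d v v"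
    by (simp add: dot_add_left dot_scale_left)
  ultimately show ?thesis by (simp add: drift_def A_def b_def u_def)
qed

lemma drift_derivative:
  assumes t: "0 < t" "t < 1"
  shows "((\<lambda>r. drift t (\<lambda>i. x i + r * v i) u) has_real_derivative log_hess t (\<lambda>i. x i + r * v i) u v) (at r)"
proof -
  define A where "A = t\<^sup>2 / (2 * (1 - t\<^sup>2))"
  define b where "b = t / (1 - t\<^sup>2)"
  define s where "s = 1 - t\<^sup>2"
  have s: "s > 0" using one_minus_sq_pos[OF t] by (simp add: s_def)
  have A: "A > 0" using exponent_pos[OF t] by (simp add: A_def)
  let ?m = "\<lambda>r. mom A (\<lambda>i. b * (x i + r * v i))"
  have mp: "?m r (\<lambda>_. 1) > 0" for r by (rule mom_one_pos[OF A])
  have "drift t (\<lambda>i. x i + r * v i) u = - (dot d x u + r * dot d v u) / s + b * (?m r (dot d u) / ?m r (\<lambda>_. 1))" for r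
    by (simp add: drift_def dot_add_left dot_scale_left A_def b_def s_def)
  moreover have "((\<lambda>r. - (dot d x u + r * dot d v u) / s + b * (?m r (dot d u) / ?m r (\<lambda>_. 1))) has_real_derivative
      - dot d v u / s + b * ((b * ?m r (\<lambda>y. dot d u y * dot d v y) * ?m r (\<lambda>_. 1) - ?m r (dot d u) * (b * ?m r (\<lambda>y. 1 * dot d v y)))
        / (?m r (\<lambda>_. 1) * ?m r (\<lambda>_. 1)))) (at r)"
  proof (rule DERIV_add[OF _ DERIV_cmult[OF DERIV_divide]])
    show "((\<lambda>r. - (dot d x u + r * dot d v u) / s) has_real_derivative - dot d v u / s) (at r)"
      using s by (auto intro!: derivative_eq_intros)
    show "((\<lambda>r. ?m r (dot d u)) has_real_derivative b * ?m r (\<lambda>y. dot d u y * dot d v y)) (at r)"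
      by (rule mom_line_derivative[OF exp_bounded_dot A])
    show "((\<lambda>r. ?m r (\<lambda>_. 1)) has_real_derivative b * ?m r (\<lambda>y. 1 * dot d v y)) (at r)"
      by (rule mom_line_derivative[OF exp_bounded_const A])
    show "?m r (\<lambda>_. 1) \<noteq> 0" using mp[of r] by simp
  qed
  moreover have "- dot d v u / s + b * ((b * ?m r (\<lambda>y. dot d u y * dot d v y) * ?m r (\<lambda>_. 1) - ?m r (dot d u) * (b * ?m r (\<lambda>y. 1 * dot d v y)))
        / (?m r (\<lambda>_. 1) * ?m r (\<lambda>_. 1))) = log_hess t (\<lambda>i. x i + r * v i) u v"
    using mp[of r] unfolding log_hess_def Let_def A_def[symmetric] b_def[symmetric]
    unfolding s_def[symmetric]
    by (simp add: dot_commute[of d u v] power2_eq_square diff_divide_distrib right_diff_distrib mult_ac)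
  ultimately show ?thesis by simp
qed

lemma log_hess_commute: "log_hess t x u v = log_hess t x v u"
  by (simp add: log_hess_def Let_def dot_commute[of d u v] mult.commute)

text \<open>Bilinearity of the posterior covariance links the matrix entries, which define the
  eigenvalues, to the variance of a single linear form, which is what can be estimated.\<close>

lemma log_hess_quadratic:
  assumes t: "0 < t" "t < 1"
  shows "(\<Sum>i<d. \<Sum>j<d. v i * v j * log_hess t x (unit_pt i) (unit_pt j)) = log_hess t x v v"
proof -
  define A where "A = t\<^sup>2 / (2 * (1 - t\<^sup>2))"
  define b where "b = t / (1 - t\<^sup>2)"
  define s where "s = 1 - t\<^sup>2"
  have A: "A > 0" using exponent_pos[OF t] by (simp add: A_def)
  let ?m = "mom A (\<lambda>i. b * x i)"
  have du: "dot d (unit_pt i) = (\<lambda>y. y i)" if "i < d" for i using that by (simp add: dot_unit_pt fun_eq_iff)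
  have uu: "dot d (unit_pt i) (unit_pt j) = (if i = j then 1 else 0)" if "i < d" for i j
    using that by (subst dot_unit_pt) (auto simp: unit_pt_def)
  have m1: "?m (dot d v) = (\<Sum>i<d. v i * ?m (\<lambda>y. y i))"
  proof -
    have "?m (dot d v) = ?m (\<lambda>y. \<Sum>i<d. v i * y i)" by (simp add: dot_def[abs_def])
    also have "\<dots> = (\<Sum>i<d. ?m (\<lambda>y. v i * y i))"
      using A by (intro mom_sum exp_bounded_mult exp_bounded_const exp_bounded_coord) auto
    finally show ?thesis by (simp add: mom_cmult)
  qed
  have m2: "?m (\<lambda>y. dot d v y * dot d v y) = (\<Sum>i<d. \<Sum>j<d. v i * v j * ?m (\<lambda>y. y i * y j))"
  proof -
    have "?m (\<lambda>y. dot d v y * dot d v y) = ?m (\<lambda>y. \<Sum>i<d. dot d v y * (v i * y i))"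
      by (subst (2) dot_def) (simp add: sum_distrib_left)
    also have "\<dots> = (\<Sum>i<d. ?m (\<lambda>y. dot d v y * (v i * y i)))"
      using A by (intro mom_sum exp_bounded_mult exp_bounded_const exp_bounded_coord exp_bounded_dot) auto
    also have "\<dots> = (\<Sum>i<d. \<Sum>j<d. v i * v j * ?m (\<lambda>y. y i * y j))"
    proof (intro sum.cong refl)
      fix i assume "i \<in> {..<d}"
      then have i: "i < d" by simp
      have "?m (\<lambda>y. dot d v y * (v i * y i)) = ?m (\<lambda>y. \<Sum>j<d. (v i * v j) * (y i * y j))"
      proof -
        have "dot d v y * (v i * y i) = (\<Sum>j<d. (v i * v j) * (y i * y j))" for y
          unfolding dot_def sum_distrib_right by (intro sum.cong) (simp_all add: mult_ac)
        then show ?thesis by simp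
      qed
      also have "\<dots> = (\<Sum>j<d. ?m (\<lambda>y. (v i * v j) * (y i * y j)))"
        using A i by (intro mom_sum exp_bounded_mult exp_bounded_const exp_bounded_coord) auto
      finally show "?m (\<lambda>y. dot d v y * (v i * y i)) = (\<Sum>j<d. v i * v j * ?m (\<lambda>y. y i * y j))"
        by (simp only: mom_cmult)
    qed
    finally show ?thesis .
  qed
  have "(\<Sum>i<d. \<Sum>j<d. v i * v j * log_hess t x (unit_pt i) (unit_pt j)) =
     (\<Sum>i<d. \<Sum>j<d. (- 1 / s) * (v i * v j * (if i = j then 1 else 0)) + (b\<^sup>2 / ?m (\<lambda>_. 1)) * (v i * v j * ?m (\<lambda>y. y i * y j))
       - (b\<^sup>2 / (?m (\<lambda>_. 1))\<^sup>2) * ((v i * ?m (\<lambda>y. y i)) * (v j * ?m (\<lambda>y. y j))))"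
  proof (intro sum.cong refl)
    fix i j assume "i \<in> {..<d}" "j \<in> {..<d}"
    then show "v i * v j * log_hess t x (unit_pt i) (unit_pt j) =
      (- 1 / s) * (v i * v j * (if i = j then 1 else 0)) + (b\<^sup>2 / ?m (\<lambda>_. 1)) * (v i * v j * ?m (\<lambda>y. y i * y j))
       - (b\<^sup>2 / (?m (\<lambda>_. 1))\<^sup>2) * ((v i * ?m (\<lambda>y. y i)) * (v j * ?m (\<lambda>y. y j)))"
      unfolding log_hess_def Let_def A_def[symmetric] b_def[symmetric]
    unfolding s_def[symmetric]
      by (simp add: du uu algebra_simps) (simp add: unit_pt_def)
  qed
  also have "\<dots> = (- 1 / s) * (\<Sum>i<d. \<Sum>j<d. v i * v j * (if i = j then 1 else 0)) + (b\<^sup>2 / ?m (\<lambda>_. 1)) * (\<Sum>i<d. \<Sum>j<d. v i * v j * ?m (\<lambda>y. y i * y j))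
       - (b\<^sup>2 / (?m (\<lambda>_. 1))\<^sup>2) * (\<Sum>i<d. \<Sum>j<d. (v i * ?m (\<lambda>y. y i)) * (v j * ?m (\<lambda>y. y j)))"
    by (simp only: sum.distrib sum_subtractf sum_distrib_left)
  also have "(\<Sum>i<d. \<Sum>j<d. v i * v j * (if i = j then 1 else 0)) = dot d v v"
    by (simp add: dot_def if_distrib[of "\<lambda>x. _ * x"] cong: if_cong)
  also have "(\<Sum>i<d. \<Sum>j<d. (v i * ?m (\<lambda>y. y i)) * (v j * ?m (\<lambda>y. y j))) = ?m (dot d v) * ?m (dot d v)"
    unfolding m1 sum_product ..
  also have "(- 1 / s) * dot d v v + (b\<^sup>2 / ?m (\<lambda>_. 1)) * (\<Sum>i<d. \<Sum>j<d. v i * v j * ?m (\<lambda>y. y i * y j))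
     - (b\<^sup>2 / (?m (\<lambda>_. 1))\<^sup>2) * (?m (dot d v) * ?m (dot d v)) = log_hess t x v v"
    unfolding m2[symmetric] log_hess_def Let_def A_def[symmetric] b_def[symmetric]
    unfolding s_def[symmetric]
    by (simp add: algebra_simps)
  finally show ?thesis .
qed

lemma score_eq_drift:
  assumes t: "0 < t" "t < 1" and f: "\<And>x. x \<in> Rd d \<Longrightarrow> f x = noised_density t x"
    and x: "x \<in> Rd d" and i: "i < d"
  shows "score d f x i = drift t x (unit_pt i)"
proof -
  have "(\<lambda>r. ln (f (x(i := r)))) = (\<lambda>r. ln (noised_density t (\<lambda>k. x k + (r - x i) * unit_pt i k)))"
    using f[OF upd_in_Rd[OF x i]] by (simp add: upd_eq_line[symmetric])
  moreover have "((\<lambda>r. ln (noised_density t (\<lambda>k. x k + (r + - x i) * unit_pt i k))) has_real_derivative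
      drift t (\<lambda>k. x k + 0 * unit_pt i k) (unit_pt i)) (at (x i))"
    using ln_noised_density_derivative[OF t, of x "unit_pt i" 0]
    using DERIV_shift[of "\<lambda>r. ln (noised_density t (\<lambda>k. x k + r * unit_pt i k))" _ "x i" "- x i"] by simp
  ultimately show ?thesis using i
    by (simp add: score_def grad_def partial_def DERIV_imp_deriv)
qed

lemma jacobian_score:
  assumes t: "0 < t" "t < 1" and f: "\<And>x. x \<in> Rd d \<Longrightarrow> f x = noised_density t x"
    and x: "x \<in> Rd d"
  shows "1\<^sub>m d + jacobian_mat d (score d f) x =
    mat d d (\<lambda>(i, j). (if i = j then 1 else 0) + log_hess t x (unit_pt i) (unit_pt j))"
proof -
  have "partial j (\<lambda>y. score d f y i) x = log_hess t x (unit_pt i) (unit_pt j)" if ij: "i < d" "j < d" for i j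
  proof -
    have "(\<lambda>r. score d f (x(j := r)) i) = (\<lambda>r. drift t (\<lambda>k. x k + (r - x j) * unit_pt j k) (unit_pt i))"
      using score_eq_drift[OF t f upd_in_Rd[OF x ij(2)] ij(1)] by (simp add: upd_eq_line[symmetric])
    moreover have "((\<lambda>r. drift t (\<lambda>k. x k + (r + - x j) * unit_pt j k) (unit_pt i)) has_real_derivative
        log_hess t (\<lambda>k. x k + 0 * unit_pt j k) (unit_pt i) (unit_pt j)) (at (x j))"
      using drift_derivative[OF t, of x "unit_pt j" "unit_pt i" 0]
      using DERIV_shift[of "\<lambda>r. drift t (\<lambda>k. x k + r * unit_pt j k) (unit_pt i)" _ "x j" "- x j"] by simp
    ultimately show ?thesis by (simp add: partial_def DERIV_imp_deriv)
  qed
  then show ?thesis unfolding jacobian_mat_def by (intro eq_matI) auto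
qed

text \<open>Continuity in time at a fixed point and fixed directions, the source of measurability of
  the integrand.\<close>

lemma log_hess_tendsto:
  assumes t: "0 < t" "t < 1" and X: "X \<longlonglongrightarrow> t"
  shows "(\<lambda>n. log_hess (X n) x u v) \<longlonglongrightarrow> log_hess t x u v"
proof -
  have s: "1 - t\<^sup>2 \<noteq> 0" using one_minus_sq_pos[OF t] by simp
  have A: "(\<lambda>n. (X n)\<^sup>2 / (2 * (1 - (X n)\<^sup>2))) \<longlonglongrightarrow> t\<^sup>2 / (2 * (1 - t\<^sup>2))"
    using s by (intro tendsto_intros X) auto
  have b: "(\<lambda>n. X n / (1 - (X n)\<^sup>2)) \<longlonglongrightarrow> t / (1 - t\<^sup>2)"
    using s by (intro tendsto_intros X) auto
  have m: "(\<lambda>n. mom ((X n)\<^sup>2 / (2 * (1 - (X n)\<^sup>2))) (\<lambda>i. X n / (1 - (X n)\<^sup>2) * x i) w)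
      \<longlonglongrightarrow> mom (t\<^sup>2 / (2 * (1 - t\<^sup>2))) (\<lambda>i. t / (1 - t\<^sup>2) * x i) w" if "exp_bounded d w" for w
    by (rule tendsto_mom[OF that A exponent_pos[OF t] b])
  have mp: "mom (t\<^sup>2 / (2 * (1 - t\<^sup>2))) (\<lambda>i. t / (1 - t\<^sup>2) * x i) (\<lambda>_. 1) \<noteq> 0"
    using mom_one_pos[OF exponent_pos[OF t]] by (metis less_irrefl)
  show ?thesis
    unfolding log_hess_def Let_def
    using s mp by (intro tendsto_intros X m exp_bounded_mult exp_bounded_dot exp_bounded_const) auto
qed

end

subsection \<open>Variance bounds\<close>

lemma dist_Rd_half:
  "(dist_Rd d y z / 2)\<^sup>2 = (\<Sum>i<d. ((y i - z i) / 2)\<^sup>2)"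
  by (simp add: dist_Rd_def power_divide real_sqrt_pow2 sum_nonneg sum_divide_distrib)

lemma dist_Rd_nonneg [simp]: "0 \<le> dist_Rd d y z"
  by (simp add: dist_Rd_def sum_nonneg)

lemma dist_Rd_midpoint:
  "dist_Rd d y (\<lambda>i\<in>{..<d}. (y i + z i) / 2) = dist_Rd d y z / 2"
  "dist_Rd d z (\<lambda>i\<in>{..<d}. (y i + z i) / 2) = dist_Rd d y z / 2"
proof -
  have "(\<Sum>i<d. (y i - (y i + z i) / 2)\<^sup>2) = (\<Sum>i<d. ((y i - z i) / 2)\<^sup>2)"
    "(\<Sum>i<d. (z i - (y i + z i) / 2)\<^sup>2) = (\<Sum>i<d. ((y i - z i) / 2)\<^sup>2)"
  proof -
    have e: "z i - (y i + z i) / 2 = - ((y i - z i) / 2)" "y i - (y i + z i) / 2 = (y i - z i) / 2" for i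
      by (simp_all add: field_simps)
    then show "(\<Sum>i<d. (y i - (y i + z i) / 2)\<^sup>2) = (\<Sum>i<d. ((y i - z i) / 2)\<^sup>2)"
      "(\<Sum>i<d. (z i - (y i + z i) / 2)\<^sup>2) = (\<Sum>i<d. ((y i - z i) / 2)\<^sup>2)"
      by (simp_all only: e power2_minus)
  qed
  then have "dist_Rd d y (\<lambda>i\<in>{..<d}. (y i + z i) / 2) = sqrt ((dist_Rd d y z / 2)\<^sup>2)"
    "dist_Rd d z (\<lambda>i\<in>{..<d}. (y i + z i) / 2) = sqrt ((dist_Rd d y z / 2)\<^sup>2)"
    unfolding dist_Rd_half by (simp_all add: dist_Rd_def)
  then show "dist_Rd d y (\<lambda>i\<in>{..<d}. (y i + z i) / 2) = dist_Rd d y z / 2"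
    "dist_Rd d z (\<lambda>i\<in>{..<d}. (y i + z i) / 2) = dist_Rd d y z / 2" by simp_all
qed

text \<open>\<open>g\<close> is \<open>p\<close> cut off outside the interior of the convex set \<open>{p \<noteq> 0}\<close>: on the frontier, \<open>u\<close> may be
  any convex function and need not be strongly convex.\<close>

lemma weakly_log_concave_midpoint:
  assumes wlc: "weakly_log_concave d \<alpha> \<beta> K p"
  obtains g where "g \<in> borel_measurable (lebesgue_Rd d)" "\<And>y. y \<in> Rd d \<Longrightarrow> 0 \<le> g y"
    "AE y in lebesgue_Rd d. p y = g y"
    "\<And>y z. y \<in> Rd d \<Longrightarrow> z \<in> Rd d \<Longrightarrow> g y * g z \<le> (g (\<lambda>i\<in>{..<d}. (y i + z i) / 2))\<^sup>2 *
      exp (- \<alpha> * (dist_Rd d y z / 2)\<^sup>2 + 2 * K * (dist_Rd d y z / 2) powr \<beta>)"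
proof -
  obtain u :: "point \<Rightarrow> ereal" and a :: "point \<Rightarrow> real" where
    pd: "prob_density d p" and
    pu: "\<And>x. x \<in> Rd d \<Longrightarrow> p x = (if u x = \<infinity> then 0 else exp (- real_of_ereal (u x) + a x))" and
    cu: "convex_ext d u" and
    ck: "Ck_on 2 d (Rd_top d interior_of supp d p) (\<lambda>x. real_of_ereal (u x))" and
    he: "\<And>x. x \<in> Rd_top d interior_of supp d p \<Longrightarrow> loewner_le (\<alpha> \<cdot>\<^sub>m 1\<^sub>m d) (hessian d (\<lambda>x. real_of_ereal (u x)) x)" and
    ho: "\<And>x y. x \<in> Rd d \<Longrightarrow> y \<in> Rd d \<Longrightarrow> \<bar>a x - a y\<bar> \<le> K * dist_Rd d x y powr \<beta>"
    using wlc unfolding weakly_log_concave_def Let_def by blast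
  interpret Rd_density d p by standard (rule pd)
  define D where "D = {x \<in> Rd d. p x \<noteq> 0}"
  have Du: "x \<in> D \<longleftrightarrow> x \<in> Rd d \<and> u x \<noteq> \<infinity>" for x using pu[of x] by (auto simp: D_def)
  have Dm: "D \<in> sets (lebesgue_Rd d)"
  proof -
    have "{x \<in> space (lebesgue_Rd d). p x \<noteq> 0} \<in> sets (lebesgue_Rd d)" by measurable
    then show ?thesis by (simp add: D_def space_lebesgue_Rd)
  qed
  have Dc: "convex_Rd {..<d} D"
    unfolding convex_Rd_def
  proof (intro ballI allI impI)
    fix x y and r :: real assume xy: "x \<in> D" "y \<in> D" and r: "0 < r \<and> r < 1"
    obtain q1 q2 where q: "u x = ereal q1" "u y = ereal q2"
      using xy cu unfolding Du convex_ext_def by (metis ereal_cases)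
    have "u (lincomb d (1 - r) x r y) \<le> ereal (1 - r) * u x + ereal r * u y"
      using cu xy r unfolding convex_ext_def Du by blast
    then have "u (lincomb d (1 - r) x r y) \<noteq> \<infinity>" unfolding q by auto
    then have "lincomb d (1 - r) x r y \<in> D" unfolding Du by (simp add: lincomb_in_Rd)
    then show "(\<lambda>i\<in>{..<d}. (1 - r) * x i + r * y i) \<in> D" by (simp add: lincomb_def)
  qed
  define U where "U = Rd_top d interior_of D"
  define S where "S = Rd_top d interior_of supp d p"
  \<comment> \<open>The Hessian bound is given on \<open>S\<close>, the interior of the closed
    support; on the smaller set \<open>U\<close> it is also known that \<open>u\<close> is
    finite.\<close>
  have US: "U \<subseteq> S" unfolding U_def S_def supp_def D_def[symmetric]
    by (intro interior_of_mono closure_of_subset) (auto simp: D_def topspace_Rd_top)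
  have UD: "U \<subseteq> D" unfolding U_def by (rule interior_of_subset)
  have UR: "U \<subseteq> Rd d" using UD by (auto simp: D_def)
  have Um [measurable]: "U \<in> sets (lebesgue_Rd d)" unfolding U_def by (intro openin_Rd_top_measurable openin_interior_of)
  have seg: "(\<lambda>i\<in>{..<d}. (1 - r) * y i + r * z i) \<in> U" if "y \<in> U" "z \<in> U" "0 \<le> r" "r < 1" for y z r
    using interior_of_segment[OF Dc, of y z r] that UD UR unfolding U_def[symmetric] lincomb_def by blast
  define g where "g = (\<lambda>y. indicator U y * p y)"
  show ?thesis
  proof (rule that[of g])
    show "g \<in> borel_measurable (lebesgue_Rd d)" unfolding g_def by measurable
    show "0 \<le> g y" if "y \<in> Rd d" for y using p_nonneg[OF that] by (simp add: g_def)
    show "AE y in lebesgue_Rd d. p y = g y"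
      using convex_AE_interior[OF Dm Dc, folded U_def] AE_space
    proof eventually_elim
      fix y assume y: "y \<in> D \<longrightarrow> y \<in> U" "y \<in> space (lebesgue_Rd d)"
      then have "y \<in> U \<or> p y = 0" by (auto simp: D_def space_lebesgue_Rd)
      then show "p y = g y" by (auto simp: g_def indicator_def)
    qed
    fix y z assume yz: "y \<in> Rd d" "z \<in> Rd d"
    let ?m = "\<lambda>i\<in>{..<d}. (y i + z i) / 2"
    let ?R = "dist_Rd d y z / 2"
    show "g y * g z \<le> (g ?m)\<^sup>2 * exp (- \<alpha> * ?R\<^sup>2 + 2 * K * ?R powr \<beta>)"
    proof (cases "y \<in> U \<and> z \<in> U")
      case False
      then show ?thesis by (auto simp: g_def)
    next
      case True
      have mU: "?m \<in> U"
      proof -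
        have "?m = (\<lambda>i\<in>{..<d}. (1 - 1 / 2) * y i + 1 / 2 * z i)" by (auto simp: fun_eq_iff restrict_def field_simps)
        then show ?thesis using seg[of y z "1/2"] True by simp
      qed
      let ?v = "\<lambda>x. real_of_ereal (u x)"
      let ?x = "\<lambda>i. (y i + z i) / 2" and ?w = "\<lambda>i. (y i - z i) / 2"
      have ends: "(\<lambda>i\<in>{..<d}. ?x i + 1 * ?w i) = y" "(\<lambda>i\<in>{..<d}. ?x i + (-1) * ?w i) = z" "(\<lambda>i\<in>{..<d}. ?x i + 0 * ?w i) = ?m"
        using yz by (auto intro!: Rd_eqI[OF restrict_in_Rd] simp: restrict_in_Rd field_simps)
      have "\<alpha> * (\<Sum>i<d. (?w i)\<^sup>2) \<le> ?v (\<lambda>i\<in>{..<d}. ?x i + 1 * ?w i) + ?v (\<lambda>i\<in>{..<d}. ?x i + (-1) * ?w i) - 2 * ?v (\<lambda>i\<in>{..<d}. ?x i + 0 * ?w i)"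
      proof (rule Ck_on_2_second_difference_ge[where S = S])
        show "openin (Rd_top d) S" unfolding S_def by (rule openin_interior_of)
        show "Ck_on 2 d S ?v" unfolding S_def by (rule ck)
        show "loewner_le (\<alpha> \<cdot>\<^sub>m 1\<^sub>m d) (hessian d ?v x)" if "x \<in> S" for x using he that unfolding S_def .
        fix r :: real assume r: "-1 \<le> r" "r \<le> 1"
        have eq: "(\<lambda>i\<in>{..<d}. ?x i + r * ?w i) = (\<lambda>i\<in>{..<d}. (1 - (1 - r) / 2) * y i + ((1 - r) / 2) * z i)"
          by (auto simp: fun_eq_iff restrict_def field_simps)
        show "(\<lambda>i\<in>{..<d}. ?x i + r * ?w i) \<in> S"
        \<comment> \<open>At \<open>r = -1\<close> the parameter of \<open>seg\<close> is 1, which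
          \<open>seg\<close> excludes; the point is then the endpoint \<open>z\<close>
          itself.\<close>
        proof (cases "r = -1")
          case r1: True
          show ?thesis unfolding r1 ends(2) using True US by blast
        next
          case False
          then have "(\<lambda>i\<in>{..<d}. ?x i + r * ?w i) \<in> U" unfolding eq using True r by (intro seg) auto
          then show ?thesis using US by blast
        qed
      qed
      then have conv: "\<alpha> * ?R\<^sup>2 \<le> ?v y + ?v z - 2 * ?v ?m" unfolding ends dist_Rd_half .
      have mR: "?m \<in> Rd d" by (rule restrict_in_Rd)
      \<comment> \<open>Both points lie at distance \<open>?R\<close> from the midpoint, so the
        Hoelder condition is used once for each.\<close>
      have hoelder: "a y + a z - 2 * a ?m \<le> 2 * K * ?R powr \<beta>"
        using ho[OF yz(1) mR] ho[OF yz(2) mR] unfolding dist_Rd_midpoint by linarith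
      have val: "g x = exp (- ?v x + a x)" if "x \<in> U" for x
      proof -
        have "x \<in> D" using that UD by blast
        then show ?thesis using that pu[of x] by (auto simp: g_def Du)
      qed
      have "g y * g z = exp ((- ?v y + a y) + (- ?v z + a z))" using True by (simp add: val exp_add)
      also have "\<dots> \<le> exp (2 * (- ?v ?m + a ?m) + (- \<alpha> * ?R\<^sup>2 + 2 * K * ?R powr \<beta>))"
        using conv hoelder by simp
      also have "\<dots> = (g ?m)\<^sup>2 * exp (- \<alpha> * ?R\<^sup>2 + 2 * K * ?R powr \<beta>)"
        unfolding val[OF mU] exp_add[of "2 * _"] exp_double ..
      finally show ?thesis .
    qed
  qed
qed

lemma dot_diff_le_dist:
  assumes "dot d v v = 1" "h \<ge> 0"
  shows "dot d (\<lambda>i. h * v i) y - dot d (\<lambda>i. h * v i) z \<le> 2 * h * (dist_Rd d y z / 2)"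
proof -
  have "(\<Sum>i<d. v i * (y i - z i))\<^sup>2 \<le> (\<Sum>i<d. (v i)\<^sup>2) * (\<Sum>i<d. (y i - z i)\<^sup>2)"
    by (rule Cauchy_Schwarz_ineq_sum)
  also have "(\<Sum>i<d. (v i)\<^sup>2) = 1" using assms(1) by (simp add: dot_def power2_eq_square)
  finally have "\<bar>\<Sum>i<d. v i * (y i - z i)\<bar> \<le> dist_Rd d y z"
    unfolding dist_Rd_def using real_le_rsqrt[of "\<bar>\<Sum>i<d. v i * (y i - z i)\<bar>"] by simp
  moreover have "dot d v y - dot d v z = (\<Sum>i<d. v i * (y i - z i))"
    by (simp add: dot_def right_diff_distrib sum_subtractf)
  ultimately have "h * (dot d v y - dot d v z) \<le> h * dist_Rd d y z"
    using assms(2) by (intro mult_left_mono) auto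
  then show ?thesis by (simp add: dot_scale_left right_diff_distrib)
qed

text \<open>The parallelogram law: it is the source of the term \<open>2 * A\<close> that the
  Gaussian weight adds to \<alpha> in \<open>variance_le\<close>.\<close>

lemma dot_parallelogram:
  "dot d y y + dot d z z = 2 * dot d (\<lambda>i\<in>{..<d}. (y i + z i) / 2) (\<lambda>i\<in>{..<d}. (y i + z i) / 2) + 2 * (dist_Rd d y z / 2)\<^sup>2"
  unfolding dist_Rd_half dot_def sum_distrib_left sum.distrib[symmetric]
  by (intro sum.cong) (auto simp: power2_eq_square field_simps)

context Rd_density
begin

lemma variance_nonneg:
  assumes A: "A > 0"
  shows "(mom A \<theta> (dot d v))\<^sup>2 \<le> mom A \<theta> (\<lambda>y. (dot d v y)\<^sup>2) * mom A \<theta> (\<lambda>_. 1)"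
proof -
  let ?m = "mom A \<theta>"
  define m0 where "m0 = ?m (\<lambda>_. 1)"
  define m1 where "m1 = ?m (dot d v)"
  define m2 where "m2 = ?m (\<lambda>y. (dot d v y)\<^sup>2)"
  have m0: "m0 > 0" using mom_one_pos[OF A] by (simp add: m0_def)
  have e2: "exp_bounded d (\<lambda>y. (dot d v y)\<^sup>2)"
    using exp_bounded_mult[OF exp_bounded_dot exp_bounded_dot, of d v v] by (simp add: power2_eq_square)
  let ?W = "weight A \<theta>" and ?l = "dot d v"
  have i0: "integrable \<mu> ?W" and i1: "integrable \<mu> (\<lambda>y. ?l y * ?W y)" and i2: "integrable \<mu> (\<lambda>y. (?l y)\<^sup>2 * ?W y)"
    using mom_integrable[OF exp_bounded_const A, of 1 \<theta>] mom_integrable[OF exp_bounded_dot A, of v \<theta>] mom_integrable[OF e2 A, of \<theta>]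
    by simp_all
  have md: "(\<integral>y. ?W y \<partial>\<mu>) = m0" "(\<integral>y. ?l y * ?W y \<partial>\<mu>) = m1" "(\<integral>y. (?l y)\<^sup>2 * ?W y \<partial>\<mu>) = m2"
    unfolding m0_def m1_def m2_def mom_def by simp_all
  have "0 \<le> (\<integral>y. (m0 * ?l y - m1)\<^sup>2 * ?W y \<partial>\<mu>)"
    by (intro integral_nonneg_AE) (simp add: weight_def)
  also have "(\<lambda>y. (m0 * ?l y - m1)\<^sup>2 * ?W y) = (\<lambda>y. m0\<^sup>2 * ((?l y)\<^sup>2 * ?W y) - (2 * m0 * m1) * (?l y * ?W y) + m1\<^sup>2 * ?W y)"
    by (simp add: power2_eq_square algebra_simps)
  also have "(\<integral>y. m0\<^sup>2 * ((?l y)\<^sup>2 * ?W y) - (2 * m0 * m1) * (?l y * ?W y) + m1\<^sup>2 * ?W y \<partial>\<mu>) = m0\<^sup>2 * m2 - (2 * m0 * m1) * m1 + m1\<^sup>2 * m0"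
    by (simp add: i0 i1 i2 md)
  also have "\<dots> = m0 * (m2 * m0 - m1\<^sup>2)" by (simp add: power2_eq_square algebra_simps)
  finally show ?thesis using m0 unfolding m0_def[symmetric] m1_def[symmetric] m2_def[symmetric]
    by (simp add: zero_le_mult_iff)
qed

text \<open>All terms of the midpoint condition depend on the half distance R alone: - \<alpha> R^2
  + \<omega>(R) from the density, - 2 A R^2 from the weight, and at most 2 h R from the tilt by
  Cauchy--Schwarz. Their supremum is a scalar problem whatever \<open>d\<close> is.
  Prekopa--Leindler bounds the product of the tilted masses from above, \<open>mom_mgf_ge\<close>
  from below.\<close>

lemma variance_le:
  assumes A: "A > 0" and v: "dot d v v = 1" and h: "h \<ge> 0"
    and g [measurable]: "g \<in> borel_measurable (lebesgue_Rd d)" and gnn: "\<And>y. y \<in> Rd d \<Longrightarrow> 0 \<le> g y"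
    and ae: "AE y in lebesgue_Rd d. p y = g y"
    and mid: "\<And>y z. y \<in> Rd d \<Longrightarrow> z \<in> Rd d \<Longrightarrow> g y * g z \<le> (g (\<lambda>i\<in>{..<d}. (y i + z i) / 2))\<^sup>2 *
      exp (- \<alpha> * (dist_Rd d y z / 2)\<^sup>2 + \<omega> (dist_Rd d y z / 2))"
    and E: "\<And>R. R \<ge> 0 \<Longrightarrow> 2 * h * R - (\<alpha> + 2 * A) * R\<^sup>2 + \<omega> R \<le> E"
  shows "h\<^sup>2 * (mom A \<theta> (\<lambda>y. (dot d v y)\<^sup>2) * mom A \<theta> (\<lambda>_. 1) - (mom A \<theta> (dot d v))\<^sup>2) \<le> (exp E - 1) * (mom A \<theta> (\<lambda>_. 1))\<^sup>2"
proof -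
  let ?f = "\<lambda>y. g y * weight A \<theta> y" and ?hv = "\<lambda>i. h * v i"
  have "(\<integral>\<^sup>+y. ennreal (?f y * exp (dot d ?hv y)) \<partial>lebesgue_Rd d) * (\<integral>\<^sup>+y. ennreal (?f y * exp (- dot d ?hv y)) \<partial>lebesgue_Rd d)
    \<le> ennreal (exp E) * (\<integral>\<^sup>+y. ennreal (?f y) \<partial>lebesgue_Rd d)\<^sup>2"
  proof (rule prekopa_leindler_mgf)
    show "0 \<le> ?f y" if "y \<in> Rd d" for y using gnn[OF that] by (simp add: weight_def)
    fix y z assume yz: "y \<in> Rd d" "z \<in> Rd d"
    let ?m = "\<lambda>i\<in>{..<d}. (y i + z i) / 2"
    let ?R = "dist_Rd d y z / 2"
    have lin: "dot d \<theta> y + dot d \<theta> z = 2 * dot d \<theta> ?m"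
      unfolding dot_def sum_distrib_left sum.distrib[symmetric] by (intro sum.cong) (auto simp: field_simps)
    have W: "weight A \<theta> y * weight A \<theta> z = (weight A \<theta> ?m)\<^sup>2 * exp (- 2 * A * ?R\<^sup>2)"
    proof -
      have "weight A \<theta> y * weight A \<theta> z = exp (- A * (dot d y y + dot d z z) + (dot d \<theta> y + dot d \<theta> z))"
        by (simp add: weight_def exp_add[symmetric] algebra_simps)
      also have "\<dots> = exp (2 * (- A * dot d ?m ?m + dot d \<theta> ?m) + (- 2 * A * ?R\<^sup>2))"
        unfolding lin dot_parallelogram by (simp add: algebra_simps)
      also have "\<dots> = (weight A \<theta> ?m)\<^sup>2 * exp (- 2 * A * ?R\<^sup>2)"
        unfolding weight_def exp_add[of "2 * _"] exp_double ..
      finally show ?thesis .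
    qed
    have "?f y * ?f z * exp (dot d ?hv y - dot d ?hv z) = (g y * g z) * (weight A \<theta> y * weight A \<theta> z) * exp (dot d ?hv y - dot d ?hv z)"
      by (simp add: mult_ac)
    also have "\<dots> \<le> ((g ?m)\<^sup>2 * exp (- \<alpha> * ?R\<^sup>2 + \<omega> ?R)) * ((weight A \<theta> ?m)\<^sup>2 * exp (- 2 * A * ?R\<^sup>2)) * exp (2 * h * ?R)"
      unfolding W using dot_diff_le_dist[OF v h, of y z]
      by (intro mult_mono[OF mult_right_mono[OF mid[OF yz]]]) auto
    also have "\<dots> = (?f ?m)\<^sup>2 * (exp (- \<alpha> * ?R\<^sup>2 + \<omega> ?R) * exp (- 2 * A * ?R\<^sup>2) * exp (2 * h * ?R))"
      by (simp only: power_mult_distrib mult_ac)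
    also have "exp (- \<alpha> * ?R\<^sup>2 + \<omega> ?R) * exp (- 2 * A * ?R\<^sup>2) * exp (2 * h * ?R) = exp (2 * h * ?R - (\<alpha> + 2 * A) * ?R\<^sup>2 + \<omega> ?R)"
      unfolding exp_add[symmetric] by (simp add: algebra_simps)
    also have "(?f ?m)\<^sup>2 * exp (2 * h * ?R - (\<alpha> + 2 * A) * ?R\<^sup>2 + \<omega> ?R) \<le> (?f ?m)\<^sup>2 * exp E" using E[of ?R] by (intro mult_left_mono) auto
    finally show "?f y * ?f z * exp (dot d ?hv y - dot d ?hv z) \<le> exp E * (?f ?m)\<^sup>2" by (simp add: mult.commute)
  qed measurable
  moreover have "?f y * exp (dot d ?hv y) = g y * weight A (\<lambda>i. \<theta> i + ?hv i) y" "?f y * exp (- dot d ?hv y) = g y * weight A (\<lambda>i. \<theta> i - ?hv i) y" for y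
    using weight_line[of A \<theta> 1 ?hv y] weight_line[of A \<theta> "-1" ?hv y] by simp_all
  ultimately have "ennreal (mom A (\<lambda>i. \<theta> i + ?hv i) (\<lambda>_. 1)) * ennreal (mom A (\<lambda>i. \<theta> i - ?hv i) (\<lambda>_. 1)) \<le> ennreal (exp E) * (ennreal (mom A \<theta> (\<lambda>_. 1)))\<^sup>2"
    by (simp only: mom_eq_nn_integral[OF A ae g])
  then have "mom A (\<lambda>i. \<theta> i + ?hv i) (\<lambda>_. 1) * mom A (\<lambda>i. \<theta> i - ?hv i) (\<lambda>_. 1) \<le> exp E * (mom A \<theta> (\<lambda>_. 1))\<^sup>2"
    using mom_one_pos[OF A] by (simp add: ennreal_mult''[symmetric] ennreal_power less_imp_le ennreal_le_iff)
  moreover have "mom A \<theta> (\<lambda>y. (dot d ?hv y)\<^sup>2) = h\<^sup>2 * mom A \<theta> (\<lambda>y. (dot d v y)\<^sup>2)"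
    by (simp add: dot_scale_left power_mult_distrib mom_cmult)
  moreover have "mom A \<theta> (dot d ?hv) = h * mom A \<theta> (dot d v)"
    using mom_cmult[of A \<theta> h "dot d v"] by (simp add: dot_scale_left[abs_def])
  ultimately show ?thesis using mom_mgf_ge[OF A, of \<theta> ?hv] by (simp add: power_mult_distrib algebra_simps)
qed

end

section \<open>Scalar estimates of the exponent\<close>

lemma exp_minus_1_le:
  fixes x B :: real
  assumes "0 \<le> x" "x \<le> B"
  shows "exp x - 1 \<le> x + x\<^sup>2 * exp B"
proof -
  have 1: "exp y - 1 \<le> y * exp y" for y :: real
  proof -
    have "1 - y \<le> exp (- y)" using exp_ge_add_one_self[of "- y"] by simp
    then have "exp y * (1 - y) \<le> exp y * exp (- y)" by (intro mult_left_mono) auto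
    then show ?thesis by (simp add: exp_minus algebra_simps)
  qed
  have "exp x - 1 - x \<le> x * (exp x - 1)" using 1[of x] by (simp add: algebra_simps)
  also have "\<dots> \<le> x * (x * exp x)" using assms 1[of x] by (intro mult_left_mono) auto
  also have "\<dots> \<le> x * (x * exp B)" using assms by (intro mult_left_mono) auto
  finally show ?thesis by (simp add: power2_eq_square)
qed

text \<open>Expands exp E - 1 with leading term exactly w^2. The coefficient \<open>L\<close> of w^4
  in E collects 2 K from the explicit summand, 2 K + K^2 from the square of 1 + K w^3, 1 / \<alpha>
  from 1 / \<rho>, and the product of the last two; higher powers are reduced using w \<le>
  1.\<close>

lemma excess_bound:
  fixes w K \<rho> \<alpha> :: real
  assumes \<alpha>: "0 < \<alpha>" and K: "0 < K" and w: "0 < w" "w \<le> 1" and \<rho>: "0 < \<rho>" "1 / \<rho> \<le> 1 + w\<^sup>2 / \<alpha>"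
  defines "L \<equiv> 2 * K + (2 * K + K\<^sup>2) + 1 / \<alpha> + (2 * K + K\<^sup>2) * (1 / \<alpha>)"
  shows "exp (2 * (K * w ^ 4) + (w + K * w ^ 4)\<^sup>2 / \<rho>) - 1 \<le> w\<^sup>2 + (L + (1 + L)\<^sup>2 * exp (1 + L)) * w ^ 4"
proof -
  define a where "a = 2 * K + K\<^sup>2"
  define b where "b = 1 / \<alpha>"
  have ab: "a > 0" "b > 0" using \<alpha> K by (simp_all add: a_def b_def add_pos_pos)
  have L: "L = 2 * K + a + b + a * b" by (simp add: L_def a_def b_def)
  have L0: "L > 0" unfolding L using K ab by (simp add: add_pos_pos)
  define E where "E = 2 * (K * w ^ 4) + (w + K * w ^ 4)\<^sup>2 / \<rho>"
  have wp: "w ^ n \<le> w ^ m" if "m \<le> n" for m n using w that by (intro power_decreasing) auto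
  have w01: "w ^ n \<le> 1" for n using w by (simp add: power_le_one)
  have "(w + K * w ^ 4)\<^sup>2 = w\<^sup>2 * (1 + (2 * K * w ^ 3 + K\<^sup>2 * w ^ 6))"
    by (simp add: power2_eq_square algebra_simps eval_nat_numeral)
  also have "\<dots> \<le> w\<^sup>2 * (1 + (2 * K * w\<^sup>2 + K\<^sup>2 * w\<^sup>2))"
    using K wp[of 2 3] wp[of 2 6] by (intro mult_left_mono add_mono) auto
  also have "\<dots> = w\<^sup>2 * (1 + a * w\<^sup>2)" by (simp add: a_def algebra_simps)
  finally have 1: "(w + K * w ^ 4)\<^sup>2 \<le> w\<^sup>2 * (1 + a * w\<^sup>2)" .
  have "(w + K * w ^ 4)\<^sup>2 / \<rho> = (w + K * w ^ 4)\<^sup>2 * (1 / \<rho>)" by simp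
  also have "\<dots> \<le> (w\<^sup>2 * (1 + a * w\<^sup>2)) * (1 + b * w\<^sup>2)"
    using 1 \<rho> ab by (intro mult_mono) (auto simp: b_def)
  also have "\<dots> = w\<^sup>2 + (a + b) * w ^ 4 + (a * b) * w ^ 6"
    by (simp add: algebra_simps eval_nat_numeral)
  also have "\<dots> \<le> w\<^sup>2 + (a + b) * w ^ 4 + (a * b) * w ^ 4"
    using ab wp[of 4 6] by (intro add_left_mono mult_left_mono) auto
  finally have E1: "E \<le> w\<^sup>2 + L * w ^ 4" unfolding E_def L by (simp add: algebra_simps)
  have E0: "0 \<le> E" unfolding E_def using K \<rho> w by simp
  have "L * w ^ 4 \<le> L * w\<^sup>2" using L0 wp[of 2 4] by (intro mult_left_mono) auto
  then have E2: "E \<le> (1 + L) * w\<^sup>2" using E1 by (simp add: algebra_simps)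
  also have "\<dots> \<le> (1 + L) * 1" using L0 w01 by (intro mult_left_mono) auto
  finally have E3: "E \<le> 1 + L" by simp
  have "E\<^sup>2 \<le> ((1 + L) * w\<^sup>2)\<^sup>2" using E0 E2 by (intro power_mono) auto
  also have "\<dots> = (1 + L)\<^sup>2 * w ^ 4" by (simp add: power_mult_distrib flip: power_mult)
  finally have "E\<^sup>2 * exp (1 + L) \<le> (1 + L)\<^sup>2 * w ^ 4 * exp (1 + L)" by (intro mult_right_mono) auto
  then have "exp E - 1 \<le> w\<^sup>2 + L * w ^ 4 + (1 + L)\<^sup>2 * w ^ 4 * exp (1 + L)"
    using exp_minus_1_le[OF E0 E3] E1 by linarith
  then show ?thesis unfolding E_def by (simp add: algebra_simps)
qed

text \<open>In the scale R = sqrt s * r the Hoelder term becomes 2 K w^4 r^\<beta>. The bound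
  r^\<beta> \<le> 1 + r, valid since \<beta> \<le> 1, makes the exponent a quadratic polynomial in
  r, and completing the square gives the maximum.\<close>

lemma transport_exponent_bound:
  fixes \<rho> s w K \<beta> R :: real
  assumes s: "0 < s" and \<rho>: "\<rho> > 0" and K: "K > 0" and \<beta>: "0 < \<beta>" "\<beta> \<le> 1" and w: "w > 0" "w ^ 4 = s powr (\<beta> / 2)" and R: "R \<ge> 0"
  shows "2 * (w / sqrt s) * R - (\<rho> / s) * R\<^sup>2 + 2 * K * R powr \<beta> \<le> 2 * (K * w ^ 4) + (w + K * w ^ 4)\<^sup>2 / \<rho>"
proof -
  define r where "r = R / sqrt s"
  define k where "k = K * w ^ 4"
  have r: "r \<ge> 0" using R s by (simp add: r_def)
  have k: "k > 0" using K w(1) unfolding k_def by (intro mult_pos_pos zero_less_power)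
  have "R powr \<beta> = (sqrt s * r) powr \<beta>" using s by (simp add: r_def)
  also have "\<dots> = sqrt s powr \<beta> * r powr \<beta>" using s r by (simp add: powr_mult)
  also have "sqrt s powr \<beta> = w ^ 4" using s by (simp add: w powr_half_sqrt[symmetric] powr_powr)
  finally have Rr: "R powr \<beta> = w ^ 4 * r powr \<beta>" .
  have "r powr \<beta> \<le> 1 + r"
  proof (cases "r \<le> 1")
    case True
    then have "r powr \<beta> \<le> 1" using r \<beta> by (intro powr_le1) auto
    then show ?thesis using r by simp
  next
    case False
    then have "r powr \<beta> \<le> r powr 1" using \<beta> by (intro powr_mono) auto
    then show ?thesis using False by simp
  qed
  then have "K * R powr \<beta> \<le> K * (w ^ 4 * (1 + r))"
    unfolding Rr using K w(1) by (intro mult_left_mono) auto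
  then have p: "2 * K * R powr \<beta> \<le> 2 * k * (1 + r)" by (simp add: k_def)
  have q: "2 * (w / sqrt s) * R = 2 * w * r" "(\<rho> / s) * R\<^sup>2 = \<rho> * r\<^sup>2" using s by (simp_all add: r_def power_divide)
  have "0 \<le> (\<rho> * r - (w + k))\<^sup>2 / \<rho>" using \<rho> by simp
  also have "\<dots> = \<rho> * r\<^sup>2 - 2 * (w + k) * r + (w + k)\<^sup>2 / \<rho>"
    using \<rho> by (simp add: field_simps power2_eq_square)
  finally have "2 * (w + k) * r - \<rho> * r\<^sup>2 \<le> (w + k)\<^sup>2 / \<rho>" by simp
  then show ?thesis using p unfolding q k_def[symmetric] by (simp add: algebra_simps)
qed

text \<open>Cauchy--Schwarz with an explicit remainder: if q is the expectation of exp X, the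
  product equals 1 plus the expectation of (exp X - q)^2 / (q exp X), which vanishes only for almost
  surely constant X. Working in \<open>ennreal\<close> admits infinite expectations.\<close>

lemma (in prob_space) mgf_product:
  fixes X :: "'a \<Rightarrow> real"
  assumes [measurable]: "X \<in> borel_measurable M"
  shows "1 \<le> (\<integral>\<^sup>+x. ennreal (exp (X x)) \<partial>M) * (\<integral>\<^sup>+x. ennreal (exp (- X x)) \<partial>M)"
    and "(\<And>c. \<not> (AE x in M. X x = c)) \<Longrightarrow> 1 < (\<integral>\<^sup>+x. ennreal (exp (X x)) \<partial>M) * (\<integral>\<^sup>+x. ennreal (exp (- X x)) \<partial>M)"
proof -
  let ?P = "\<integral>\<^sup>+x. ennreal (exp (X x)) \<partial>M" and ?N = "\<integral>\<^sup>+x. ennreal (exp (- X x)) \<partial>M"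
  have pos: "(\<integral>\<^sup>+x. ennreal (exp (h x)) \<partial>M) \<noteq> 0" if [measurable]: "h \<in> borel_measurable M" for h :: "'a \<Rightarrow> real"
  proof
    assume "(\<integral>\<^sup>+x. ennreal (exp (h x)) \<partial>M) = 0"
    then have "AE x in M. ennreal (exp (h x)) = 0" by (subst (asm) nn_integral_0_iff_AE) auto
    then have "AE x in M. False" by simp
    then show False using AE_False by blast
  qed
  have "1 \<le> ?P * ?N \<and> ((\<forall>c. \<not> (AE x in M. X x = c)) \<longrightarrow> 1 < ?P * ?N)"
  proof (cases "?P = \<infinity>")
    case True
    then have "?P * ?N = \<infinity>" using pos[of "\<lambda>x. - X x"] by (simp add: ennreal_mult_eq_top_iff)
    then show ?thesis by simp
  next
    case False
    define q where "q = enn2real ?P"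
    have q: "?P = ennreal q" using False by (simp add: q_def less_top)
    have q0: "q > 0" using pos[OF assms] unfolding q by (metis ennreal_eq_0_iff not_le)
    define \<delta> where "\<delta> x = exp (X x) / q + q * exp (- X x) - 2" for x
    have \<delta>: "\<delta> x = (exp (X x) - q)\<^sup>2 / (q * exp (X x))" for x
      using q0 by (simp add: \<delta>_def power2_eq_square field_simps exp_minus)
    have [measurable]: "\<delta> \<in> borel_measurable M" unfolding \<delta>_def by measurable
    have \<delta>nn: "0 \<le> \<delta> x" for x unfolding \<delta> using q0 by simp
    have "ennreal (1 / q) * ?P + ennreal q * ?N = (\<integral>\<^sup>+x. ennreal (1 / q) * ennreal (exp (X x)) + ennreal q * ennreal (exp (- X x)) \<partial>M)"
      by (simp add: nn_integral_add nn_integral_cmult)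
    also have "\<dots> = (\<integral>\<^sup>+x. 2 + ennreal (\<delta> x) \<partial>M)"
    proof (intro nn_integral_cong)
      fix x
      have "ennreal (1 / q) * ennreal (exp (X x)) + ennreal q * ennreal (exp (- X x)) = ennreal (exp (X x) / q + q * exp (- X x))"
        using q0 by (simp add: ennreal_mult''[symmetric] ennreal_plus[symmetric] del: ennreal_plus)
      also have "\<dots> = ennreal (2 + \<delta> x)" by (simp add: \<delta>_def)
      also have "\<dots> = 2 + ennreal (\<delta> x)" using \<delta>nn[of x] by (subst ennreal_plus) auto
      finally show "ennreal (1 / q) * ennreal (exp (X x)) + ennreal q * ennreal (exp (- X x)) = 2 + ennreal (\<delta> x)" .
    qed
    also have "\<dots> = 2 + (\<integral>\<^sup>+x. ennreal (\<delta> x) \<partial>M)"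
      by (subst nn_integral_add) (auto simp: emeasure_space_1)
    also have "ennreal (1 / q) * ?P = 1" unfolding q using q0 by (simp add: ennreal_mult''[symmetric])
    finally have "1 + ennreal q * ?N = 1 + (1 + (\<integral>\<^sup>+x. ennreal (\<delta> x) \<partial>M))"
      by (simp add: add.assoc[symmetric])
    then have eq: "?P * ?N = 1 + (\<integral>\<^sup>+x. ennreal (\<delta> x) \<partial>M)"
      unfolding q by (subst (asm) ennreal_add_left_cancel) auto
    have nz: "(\<integral>\<^sup>+x. ennreal (\<delta> x) \<partial>M) \<noteq> 0" if ne: "\<forall>c. \<not> (AE x in M. X x = c)"
    proof
      assume "(\<integral>\<^sup>+x. ennreal (\<delta> x) \<partial>M) = 0"
      then have "AE x in M. ennreal (\<delta> x) = 0" by (subst (asm) nn_integral_0_iff_AE) auto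
      then have "AE x in M. X x = ln q"
      proof eventually_elim
        fix x assume "ennreal (\<delta> x) = 0"
        then have "\<delta> x = 0" using \<delta>nn[of x] by (simp add: ennreal_eq_0_iff)
        then have "exp (X x) = q" unfolding \<delta> using q0 by simp
        then show "X x = ln q" by (metis ln_exp)
      qed
      then show False using ne by blast
    qed
    have lt: "1 < 1 + z" if "z \<noteq> 0" for z :: ennreal
      using ennreal_add_left_cancel_less[of 1 0 z] that by (simp add: zero_less_iff_neq_zero)
    show ?thesis
    proof (intro conjI impI)
      show "1 \<le> ?P * ?N" unfolding eq by (simp add: add_increasing2)
      assume "\<forall>c. \<not> (AE x in M. X x = c)"
      then show "1 < ?P * ?N" unfolding eq by (intro lt nz)
    qed
  qed
  then show "1 \<le> ?P * ?N" "(\<And>c. \<not> (AE x in M. X x = c)) \<Longrightarrow> 1 < ?P * ?N" by blast+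
qed

lemma AE_lebesgue_Rd_coord_neq:
  assumes "i < d"
  shows "AE y in lebesgue_Rd d. y i \<noteq> c"
proof -
  interpret product_sigma_finite "\<lambda>_. lborel" by standard
  let ?N = "PiE {..<d} (\<lambda>k. if k = i then {c} else UNIV)"
  have "?N \<in> sets (lebesgue_Rd d)" unfolding lebesgue_Rd_def by (intro sets_PiM_I_finite) auto
  moreover have "emeasure (lebesgue_Rd d) ?N = 0"
    unfolding lebesgue_Rd_def using assms by (subst emeasure_PiM) (auto intro!: bexI[of _ i])
  ultimately have "AE y in lebesgue_Rd d. y \<notin> ?N" by (intro AE_not_in) (simp add: null_sets_def)
  with AE_space show ?thesis
    by eventually_elim (use assms in \<open>auto simp: space_lebesgue_Rd Rd_def PiE_iff split: if_splits\<close>)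
qed

lemma dot_restrict:
  "dot d (\<lambda>i\<in>{..<d}. x i) y = dot d x y" "dot d y (\<lambda>i\<in>{..<d}. x i) = dot d y x"
  by (simp_all add: dot_def)

text \<open>The constant \<open>C'\<close> in \<open>(exp E - 1) / w\<^sup>2 - 1 \<le> C' w\<^sup>2\<close>, see \<open>excess_bound\<close>.\<close>

definition score_const :: "real \<Rightarrow> real \<Rightarrow> real" where
  "score_const \<alpha> K = (let L = 2 * K + (2 * K + K\<^sup>2) + 1 / \<alpha> + (2 * K + K\<^sup>2) * (1 / \<alpha>) in L + (1 + L)\<^sup>2 * exp (1 + L))"

section \<open>The Hessian of the log-density in a fixed direction\<close>

context Rd_density
begin

text \<open>Lines are computed as functions on all of \<open>nat\<close> and leave
  \<open>Rd d\<close>. These lemmas show that entries from \<open>d\<close> on have no influence, so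
  points can be restricted back to \<open>Rd d\<close>.\<close>

lemma weight_restrict: "weight A (\<lambda>i. b * (\<lambda>i\<in>{..<d}. x i) i) = weight A (\<lambda>i. b * x i)"
  by (simp add: weight_def fun_eq_iff dot_def)

lemma noised_density_restrict: "noised_density t (\<lambda>i\<in>{..<d}. x i) = noised_density t x"
  unfolding noised_density_def mom_def weight_restrict dot_restrict ..

lemma log_hess_restrict: "log_hess t (\<lambda>i\<in>{..<d}. x i) u v = log_hess t x u v"
  unfolding log_hess_def mom_def weight_restrict ..

lemma log_hess_unit:
  assumes t: "0 < t" "t < 1" and v: "dot d v v = 1"
  defines "A \<equiv> t\<^sup>2 / (2 * (1 - t\<^sup>2))" and "\<theta> \<equiv> \<lambda>x i. t / (1 - t\<^sup>2) * x i"
  shows "1 + log_hess t x v v = - t\<^sup>2 / (1 - t\<^sup>2) + (t / (1 - t\<^sup>2))\<^sup>2 *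
    ((mom A (\<theta> x) (\<lambda>y. (dot d v y)\<^sup>2) * mom A (\<theta> x) (\<lambda>_. 1) - (mom A (\<theta> x) (dot d v))\<^sup>2) / (mom A (\<theta> x) (\<lambda>_. 1))\<^sup>2)"
proof -
  have s: "1 - t\<^sup>2 > 0" using one_minus_sq_pos[OF t] .
  have m0: "mom A (\<theta> x) (\<lambda>_. 1) > 0" unfolding A_def by (rule mom_one_pos[OF exponent_pos[OF t]])
  define a where "a = mom A (\<theta> x) (\<lambda>y. (dot d v y)\<^sup>2)"
  define b where "b = mom A (\<theta> x) (dot d v)"
  define c where "c = mom A (\<theta> x) (\<lambda>_. 1)"
  have c: "c > 0" using m0 by (simp add: c_def)
  have h1: "log_hess t x v v = - 1 / (1 - t\<^sup>2) + (t / (1 - t\<^sup>2))\<^sup>2 * (a / c - b * b / c\<^sup>2)"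
    unfolding log_hess_def Let_def v a_def b_def c_def by (simp only: A_def \<theta>_def power2_eq_square)
  have h2: "1 + - 1 / (1 - t\<^sup>2) = - t\<^sup>2 / (1 - t\<^sup>2)" using s by (simp add: field_simps)
  have h3: "a / c - b * b / c\<^sup>2 = (a * c - b\<^sup>2) / c\<^sup>2"
    using c by (simp add: power2_eq_square field_simps)
  show ?thesis
    unfolding a_def[symmetric] b_def[symmetric] c_def[symmetric] h1 h3 add.assoc[symmetric] h2 ..
qed

lemma log_hess_lower:
  assumes t: "0 < t" "t < 1" and v: "dot d v v = 1"
  shows "- t\<^sup>2 / (1 - t\<^sup>2) \<le> 1 + log_hess t x v v"
  unfolding log_hess_unit[OF t v]
  using variance_nonneg[OF exponent_pos[OF t]] by simp

text \<open>\<alpha>' is the convexity of the density and \<alpha> a possibly smaller value. With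
  \<alpha> \<le> 1 the effective modulus \<rho> lies between \<alpha> and 1, which controls 1 /
  \<rho>.\<close>

lemma log_hess_upper:
  assumes t: "0 < t" "t < 1" and v: "dot d v v = 1"
    and wlc: "weakly_log_concave d \<alpha>' \<beta> K p"
    and \<alpha>: "0 < \<alpha>" "\<alpha> \<le> 1" "\<alpha> \<le> \<alpha>'" and K: "K > 0" and \<beta>: "0 < \<beta>" "\<beta> \<le> 1"
  shows "1 + log_hess t x v v \<le> score_const \<alpha> K * t\<^sup>2 * (1 - t\<^sup>2) powr (\<beta> / 4 - 1)"
proof -
  define s where "s = 1 - t\<^sup>2"
  have s: "0 < s" "s < 1" using one_minus_sq_pos[OF t] t by (simp_all add: s_def)
  define w where "w = s powr (\<beta> / 8)"
  have w: "0 < w" "w \<le> 1" using s \<beta> by (auto simp: w_def powr_le1)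
  have w4: "w ^ 4 = s powr (\<beta> / 2)" and w2: "w\<^sup>2 = s powr (\<beta> / 4)"
  proof -
    have "w ^ 4 = w powr 4" "w\<^sup>2 = w powr 2" using w by simp_all
    then show "w ^ 4 = s powr (\<beta> / 2)" "w\<^sup>2 = s powr (\<beta> / 4)" by (simp_all only: w_def powr_powr) simp_all
  qed
  \<comment> \<open>By \<open>A\<alpha>\<close> below, \<rho> / s is the strong log-concavity of the
    unperturbed posterior: \<alpha> comes from \<open>u\<close>, and 2 A = t^2 / s from the Gaussian
    weight.\<close>
  define \<rho> where "\<rho> = \<alpha> * s + t\<^sup>2"
  have \<rho>1: "\<rho> = 1 - (1 - \<alpha>) * s" by (simp add: \<rho>_def s_def algebra_simps)
  have "(1 - \<alpha>) * s \<le> (1 - \<alpha>) * 1" using s \<alpha> by (intro mult_left_mono) auto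
  then have \<rho>\<alpha>: "\<alpha> \<le> \<rho>" unfolding \<rho>1 by simp
  have \<rho>: "\<rho> > 0" using \<rho>\<alpha> \<alpha> by simp
  have \<rho>i: "1 / \<rho> \<le> 1 + w\<^sup>2 / \<alpha>"
  proof -
    have "1 / \<rho> = 1 + ((1 - \<alpha>) * s) / \<rho>" using \<rho> by (simp add: \<rho>1 field_simps)
    also have "((1 - \<alpha>) * s) / \<rho> \<le> (1 * s) / \<alpha>"
      using \<rho>\<alpha> \<alpha> s by (intro frac_le mult_right_mono) auto
    also have "s \<le> w\<^sup>2"
    proof -
      have "s powr 1 \<le> s powr (\<beta> / 4)" using s \<beta> by (intro powr_mono') auto
      then show ?thesis using s by (simp add: w2)
    qed
    finally show ?thesis using \<alpha> by (simp add: divide_right_mono)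
  qed
  define A where "A = t\<^sup>2 / (2 * (1 - t\<^sup>2))"
  have A: "A > 0" unfolding A_def by (rule exponent_pos[OF t])
  have A\<alpha>: "\<alpha> + 2 * A = \<rho> / s" using s by (simp add: A_def s_def[symmetric] \<rho>_def field_simps)
  define E where "E = 2 * (K * w ^ 4) + (w + K * w ^ 4)\<^sup>2 / \<rho>"
  define C where "C = score_const \<alpha> K"
  have eE: "exp E - 1 \<le> w\<^sup>2 + C * w ^ 4"
    unfolding E_def C_def score_const_def Let_def by (rule excess_bound[OF \<alpha>(1) K w \<rho> \<rho>i])
  let ?\<theta> = "\<lambda>i. t / (1 - t\<^sup>2) * x i"
  define V where "V = mom A ?\<theta> (\<lambda>y. (dot d v y)\<^sup>2) * mom A ?\<theta> (\<lambda>_. 1) - (mom A ?\<theta> (dot d v))\<^sup>2"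
  define m where "m = mom A ?\<theta> (\<lambda>_. 1)"
  have m: "m > 0" unfolding m_def by (rule mom_one_pos[OF A])
  obtain g where g: "g \<in> borel_measurable (lebesgue_Rd d)" "\<And>y. y \<in> Rd d \<Longrightarrow> 0 \<le> g y"
    "AE y in lebesgue_Rd d. p y = g y"
    "\<And>y z. y \<in> Rd d \<Longrightarrow> z \<in> Rd d \<Longrightarrow> g y * g z \<le> (g (\<lambda>i\<in>{..<d}. (y i + z i) / 2))\<^sup>2 *
      exp (- \<alpha>' * (dist_Rd d y z / 2)\<^sup>2 + 2 * K * (dist_Rd d y z / 2) powr \<beta>)"
    using weakly_log_concave_midpoint[OF wlc] by blast
  have "(w / sqrt s)\<^sup>2 * V \<le> (exp E - 1) * m\<^sup>2"
    unfolding V_def m_def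
  proof (rule variance_le[OF A v _ g(1,2,3), where \<omega> = "\<lambda>R. 2 * K * R powr \<beta>"])
    show "0 \<le> w / sqrt s" using w s by simp
    fix y z assume yz: "y \<in> Rd d" "z \<in> Rd d"
    let ?R = "dist_Rd d y z / 2"
    have "exp (- \<alpha>' * ?R\<^sup>2 + 2 * K * ?R powr \<beta>) \<le> exp (- \<alpha> * ?R\<^sup>2 + 2 * K * ?R powr \<beta>)"
      using \<alpha> by (simp add: mult_right_mono)
    then show "g y * g z \<le> (g (\<lambda>i\<in>{..<d}. (y i + z i) / 2))\<^sup>2 * exp (- \<alpha> * ?R\<^sup>2 + 2 * K * ?R powr \<beta>)"
      by (intro order.trans[OF g(4)[OF yz]] mult_left_mono) auto
  next
    fix R :: real assume "0 \<le> R"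
    then show "2 * (w / sqrt s) * R - (\<alpha> + 2 * A) * R\<^sup>2 + 2 * K * R powr \<beta> \<le> E"
      unfolding A\<alpha> E_def by (intro transport_exponent_bound[OF s(1) \<rho> K \<beta> w(1) w4])
  qed
  also have "\<dots> \<le> (w\<^sup>2 + C * w ^ 4) * m\<^sup>2" using eE by (intro mult_right_mono) auto
  finally have "w\<^sup>2 * (V / m\<^sup>2) \<le> w\<^sup>2 * (s * (1 + C * w\<^sup>2))"
    using m s by (simp add: power_divide field_simps eval_nat_numeral)
  then have V: "V / m\<^sup>2 \<le> s * (1 + C * w\<^sup>2)" by (rule mult_left_le_imp_le) (use w in simp)
  have "1 + log_hess t x v v = - t\<^sup>2 / s + (t / s)\<^sup>2 * (V / m\<^sup>2)"
    unfolding log_hess_unit[OF t v] V_def m_def A_def s_def ..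
  \<comment> \<open>The leading 1 in the variance bound cancels - t^2 / s, and only the correction C
    w^2 is left.\<close>
  also have "\<dots> \<le> - t\<^sup>2 / s + (t / s)\<^sup>2 * (s * (1 + C * w\<^sup>2))"
    using V by (intro add_left_mono mult_left_mono) auto
  also have "\<dots> = C * t\<^sup>2 * (w\<^sup>2 / s)" using s by (simp add: field_simps power2_eq_square)
  also have "w\<^sup>2 / s = s powr (\<beta> / 4 - 1)" using s by (simp add: w2 powr_diff)
  finally show ?thesis by (simp add: C_def s_def)
qed

section \<open>From single directions to the largest eigenvalue\<close>

definition score_mat :: "real \<Rightarrow> point \<Rightarrow> real mat" where
  "score_mat t x = mat d d (\<lambda>(i, j). (if i = j then 1 else 0) + log_hess t x (unit_pt i) (unit_pt j))"

lemma lambda_max_score_mat: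
  assumes d: "1 \<le> d" and t: "0 < t" "t < 1"
  shows "dot d v v + log_hess t x v v \<le> lambda_max (score_mat t x) * dot d v v"
    and "\<exists>v. dot d v v = 1 \<and> 1 + log_hess t x v v = lambda_max (score_mat t x)"
proof -
  let ?A = "\<lambda>(i, j). (if i = j then 1 else 0) + log_hess t x (unit_pt i) (unit_pt j)"
  have sq: "(\<Sum>i<d. (v i)\<^sup>2) = dot d v v" for v by (simp add: dot_def power2_eq_square)
  have quad: "(\<Sum>i<d. \<Sum>j<d. v i * v j * ?A (i, j)) = dot d v v + log_hess t x v v" for v
  proof -
    have "(\<Sum>i<d. \<Sum>j<d. v i * v j * ?A (i, j)) =
      (\<Sum>i<d. \<Sum>j<d. v i * v j * (if i = j then 1 else 0)) + (\<Sum>i<d. \<Sum>j<d. v i * v j * log_hess t x (unit_pt i) (unit_pt j))"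
      by (simp add: distrib_left sum.distrib)
    also have "(\<Sum>i<d. \<Sum>j<d. v i * v j * (if i = j then 1 else 0)) = dot d v v"
      by (simp add: dot_def if_distrib[of "\<lambda>x. _ * x"] cong: if_cong)
    finally show ?thesis by (simp only: log_hess_quadratic[OF t])
  qed
  have sym: "?A (i, j) = ?A (j, i)" for i j by (simp add: log_hess_commute)
  show "dot d v v + log_hess t x v v \<le> lambda_max (score_mat t x) * dot d v v"
    using lambda_max_variational(1)[OF d, of ?A v] sym unfolding quad sq score_mat_def by blast
  show "\<exists>v. dot d v v = 1 \<and> 1 + log_hess t x v v = lambda_max (score_mat t x)"
  proof -
    obtain v where "dot d v v = 1" "dot d v v + log_hess t x v v = lambda_max (score_mat t x)"
      using lambda_max_variational(2)[OF d, of ?A] sym unfolding quad sq score_mat_def by blast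
    then show ?thesis by (intro exI[of _ v]) simp
  qed
qed

lemma noised_density_midpoint:
  assumes t: "0 < t" "t < 1" and \<kappa>: "\<And>x v. \<kappa> * dot d v v \<le> - log_hess t x v v"
    and yz: "y \<in> Rd d" "z \<in> Rd d"
  shows "noised_density t y * noised_density t z \<le>
    (noised_density t (\<lambda>i\<in>{..<d}. (y i + z i) / 2))\<^sup>2 * exp (- \<kappa> * (dist_Rd d y z / 2)\<^sup>2)"
proof -
  let ?x = "\<lambda>i. (y i + z i) / 2" and ?w = "\<lambda>i. (y i - z i) / 2"
  let ?\<phi> = "\<lambda>r. - ln (noised_density t (\<lambda>i. ?x i + r * ?w i))"
  have "\<kappa> * dot d ?w ?w \<le> ?\<phi> 1 + ?\<phi> (-1) - 2 * ?\<phi> 0"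
  proof (rule second_difference_ge)
    fix r :: real
    show "(?\<phi> has_real_derivative - drift t (\<lambda>i. ?x i + r * ?w i) ?w) (at r)"
      by (intro DERIV_minus ln_noised_density_derivative[OF t])
    show "((\<lambda>r. - drift t (\<lambda>i. ?x i + r * ?w i) ?w) has_real_derivative - log_hess t (\<lambda>i. ?x i + r * ?w i) ?w ?w) (at r)"
      by (intro DERIV_minus drift_derivative[OF t])
    show "\<kappa> * dot d ?w ?w \<le> - log_hess t (\<lambda>i. ?x i + r * ?w i) ?w ?w" by (rule \<kappa>)
  qed
  moreover have "(\<lambda>i. ?x i + 1 * ?w i) = y" "(\<lambda>i. ?x i + (-1) * ?w i) = z" "(\<lambda>i. ?x i + 0 * ?w i) = ?x"
    by (simp_all add: fun_eq_iff field_simps)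
  moreover have "dot d ?w ?w = (dist_Rd d y z / 2)\<^sup>2" unfolding dist_Rd_half dot_def by (simp add: power2_eq_square)
  ultimately have le: "ln (noised_density t y) + ln (noised_density t z) \<le> 2 * ln (noised_density t ?x) + - \<kappa> * (dist_Rd d y z / 2)\<^sup>2"
    by simp
  have e: "exp (ln (noised_density t q)) = noised_density t q" for q using noised_density_pos[OF t, of q] by simp
  have "noised_density t y * noised_density t z = exp (ln (noised_density t y) + ln (noised_density t z))"
    by (simp add: exp_add e)
  also have "\<dots> \<le> exp (2 * ln (noised_density t ?x) + - \<kappa> * (dist_Rd d y z / 2)\<^sup>2)" using le by simp
  also have "\<dots> = (noised_density t ?x)\<^sup>2 * exp (- \<kappa> * (dist_Rd d y z / 2)\<^sup>2)"
    unfolding exp_add exp_double e ..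
  finally show ?thesis using noised_density_restrict[of t ?x] by simp
qed

text \<open>With v the first unit vector divided by t, the linear form of X_t is Y_0 + (sqrt (1 -
  t^2) / t) \<xi>_0. By independence the integrals factorise, and the Gaussian factors have product
  at least 1. What remains does not depend on t.\<close>

lemma noised_density_mgf_ge:
  assumes d: "1 \<le> d" and t: "0 < t" "t < 1"
  defines "v \<equiv> \<lambda>i. (1 / t) * unit_pt 0 i"
  shows "(\<integral>\<^sup>+y. ennreal (exp (y 0)) \<partial>\<mu>) * (\<integral>\<^sup>+y. ennreal (exp (- y 0)) \<partial>\<mu>) \<le>
    (\<integral>\<^sup>+y. ennreal (noised_density t y * exp (dot d v y)) \<partial>lebesgue_Rd d) *
    (\<integral>\<^sup>+y. ennreal (noised_density t y * exp (- dot d v y)) \<partial>lebesgue_Rd d)"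
proof -
  interpret G: prob_space "std_gaussian d" by (rule prob_space_std_gaussian)
  define c where "c = sqrt (1 - t\<^sup>2) / t"
  have d0: "0 < d" using d by simp
  have [measurable]: "(\<lambda>y. y 0) \<in> borel_measurable (lebesgue_Rd d)" by (rule coord_measurable[OF d0])
  note [measurable] = noised_law_eq_density(2)[OF t]
  have fac: "(\<integral>\<^sup>+y. ennreal (noised_density t y * exp (\<epsilon> * dot d v y)) \<partial>lebesgue_Rd d) =
      (\<integral>\<^sup>+y. ennreal (exp (\<epsilon> * y 0)) \<partial>\<mu>) * (\<integral>\<^sup>+\<xi>. ennreal (exp (\<epsilon> * (c * \<xi> 0))) \<partial>std_gaussian d)" for \<epsilon> :: real
  proof -
    have "(\<integral>\<^sup>+y. ennreal (noised_density t y * exp (\<epsilon> * dot d v y)) \<partial>lebesgue_Rd d) =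
        (\<integral>\<^sup>+y. ennreal (noised_density t y) * ennreal (exp (\<epsilon> * dot d v y)) \<partial>lebesgue_Rd d)"
      by (simp add: ennreal_mult'')
    also have "\<dots> = (\<integral>\<^sup>+y. ennreal (exp (\<epsilon> * dot d v y)) \<partial>noised_law d p t)"
      unfolding noised_law_eq_density(1)[OF t] by (rule nn_integral_density[symmetric]) measurable
    also have "\<dots> = (\<integral>\<^sup>+y. (\<integral>\<^sup>+\<xi>. ennreal (exp (\<epsilon> * dot d v (lincomb d t y (sqrt (1 - t\<^sup>2)) \<xi>))) \<partial>std_gaussian d) \<partial>\<mu>)"
      by (rule nn_integral_noised_law) measurable
    also have "\<dots> = (\<integral>\<^sup>+y. (\<integral>\<^sup>+\<xi>. ennreal (exp (\<epsilon> * y 0)) * ennreal (exp (\<epsilon> * (c * \<xi> 0))) \<partial>std_gaussian d) \<partial>\<mu>)"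
    proof (intro nn_integral_cong)
      fix y \<xi> :: point
      have "dot d v (lincomb d t y (sqrt (1 - t\<^sup>2)) \<xi>) = y 0 + c * \<xi> 0"
        using d0 t unfolding v_def dot_scale_left by (simp add: dot_unit_pt lincomb_def c_def field_simps)
      then show "ennreal (exp (\<epsilon> * dot d v (lincomb d t y (sqrt (1 - t\<^sup>2)) \<xi>))) = ennreal (exp (\<epsilon> * y 0)) * ennreal (exp (\<epsilon> * (c * \<xi> 0)))"
        by (simp add: ennreal_mult''[symmetric] exp_add[symmetric] distrib_left)
    qed
    also have "\<dots> = (\<integral>\<^sup>+y. ennreal (exp (\<epsilon> * y 0)) * (\<integral>\<^sup>+\<xi>. ennreal (exp (\<epsilon> * (c * \<xi> 0))) \<partial>std_gaussian d) \<partial>\<mu>)"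
      by (intro nn_integral_cong nn_integral_cmult) measurable
    also have "\<dots> = (\<integral>\<^sup>+y. ennreal (exp (\<epsilon> * y 0)) \<partial>\<mu>) * (\<integral>\<^sup>+\<xi>. ennreal (exp (\<epsilon> * (c * \<xi> 0))) \<partial>std_gaussian d)"
      by (rule nn_integral_multc) measurable
    finally show ?thesis .
  qed
  have "1 \<le> (\<integral>\<^sup>+\<xi>. ennreal (exp (c * \<xi> 0)) \<partial>std_gaussian d) * (\<integral>\<^sup>+\<xi>. ennreal (exp (- (c * \<xi> 0))) \<partial>std_gaussian d)"
    by (rule G.mgf_product(1)) measurable
  from mult_left_mono[OF this, of "(\<integral>\<^sup>+y. ennreal (exp (y 0)) \<partial>\<mu>) * (\<integral>\<^sup>+y. ennreal (exp (- y 0)) \<partial>\<mu>)"]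
  show ?thesis using fac[of 1] fac[of "-1"] by (simp add: mult_ac)
qed

text \<open>If \<open>M = 1 - \<kappa>\<close> with \<open>\<kappa> > 0\<close>, then the noised density is \<open>\<kappa>\<close>-strongly log-concave, so the law of
  \<open>Y\<close> would concentrate as \<open>\<kappa> \<rightarrow> \<infinity>\<close>.\<close>

lemma sup_lambda_max_lower:
  assumes d: "1 \<le> d"
  obtains G where "G > 0" "\<And>t M. 0 < t \<Longrightarrow> t < 1 \<Longrightarrow> (\<And>x. x \<in> Rd d \<Longrightarrow> lambda_max (score_mat t x) \<le> M) \<Longrightarrow> 1 - 1 / (t\<^sup>2 * G) \<le> M"
proof -
  have d0: "0 < d" using d by simp
  have c0 [measurable]: "(\<lambda>y. y 0) \<in> borel_measurable (lebesgue_Rd d)" by (rule coord_measurable[OF d0])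
  define \<Gamma> where "\<Gamma> = (\<integral>\<^sup>+y. ennreal (exp (y 0)) \<partial>\<mu>) * (\<integral>\<^sup>+y. ennreal (exp (- y 0)) \<partial>\<mu>)"
  have "1 < \<Gamma>" unfolding \<Gamma>_def
  proof (rule \<mu>.mgf_product(2))
    show "(\<lambda>y. y 0) \<in> borel_measurable \<mu>" by measurable
    fix c
    show "\<not> (AE y in \<mu>. y 0 = c)"
    proof
      assume "AE y in \<mu>. y 0 = c"
      then have "AE y in lebesgue_Rd d. 0 < ennreal (p y) \<longrightarrow> y 0 = c"
        unfolding \<mu>_def by (subst (asm) AE_density) auto
      with AE_lebesgue_Rd_coord_neq[OF d0, of c] have "AE y in lebesgue_Rd d. ennreal (p y) = 0"
        by eventually_elim (auto simp: zero_less_iff_neq_zero)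
      then have "(\<integral>\<^sup>+y. ennreal (p y) \<partial>lebesgue_Rd d) = 0" by (subst nn_integral_0_iff_AE) auto
      then show False using p_integral by simp
    qed
  qed
  \<comment> \<open>\<Gamma> may be infinite here; any finite number strictly between 1 and \<Gamma>
    provides the positive constant \<open>ln r\<close>.\<close>
  then obtain q where q: "1 < q" "q < \<Gamma>" using dense by blast
  define r where "r = enn2real q"
  have "q < \<top>" using q(2) by (rule less_le_trans) simp
  then have qr: "q = ennreal r" by (simp add: r_def)
  have r: "r > 1" using q(1) unfolding qr by (metis ennreal_1 ennreal_less_iff zero_le_one)
  show ?thesis
  proof (rule that[of "ln r"])
    show "ln r > 0" using r by simp
    fix t M assume t: "0 < t" "t < 1" and M: "\<And>x. x \<in> Rd d \<Longrightarrow> lambda_max (score_mat t x) \<le> M"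
    define \<kappa> where "\<kappa> = 1 - M"
    show "1 - 1 / (t\<^sup>2 * ln r) \<le> M"
    proof (cases "\<kappa> > 0")
      case False
      then have "1 \<le> M" by (simp add: \<kappa>_def)
      moreover have "0 \<le> 1 / (t\<^sup>2 * ln r)" using r by simp
      ultimately show ?thesis by linarith
    next
      case True
      have \<kappa>: "\<kappa> * dot d v v \<le> - log_hess t x v v" for x v
      proof -
        let ?x = "\<lambda>i\<in>{..<d}. x i"
        have "dot d v v + log_hess t ?x v v \<le> lambda_max (score_mat t ?x) * dot d v v"
          by (rule lambda_max_score_mat(1)[OF d t])
        also have "\<dots> \<le> M * dot d v v"
          by (intro mult_right_mono M restrict_in_Rd) (simp add: dot_def sum_nonneg)
        finally show ?thesis unfolding log_hess_restrict by (simp add: \<kappa>_def algebra_simps)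
      qed
      note [measurable] = noised_law_eq_density(2)[OF t]
      let ?v = "\<lambda>i. (1 / t) * unit_pt 0 i"
      have one: "(\<integral>\<^sup>+y. ennreal (noised_density t y) \<partial>lebesgue_Rd d) = 1"
      proof -
        interpret G: prob_space "std_gaussian d" by (rule prob_space_std_gaussian)
        have "(\<integral>\<^sup>+y. ennreal (noised_density t y) \<partial>lebesgue_Rd d) = (\<integral>\<^sup>+y. 1 \<partial>noised_law d p t)"
          unfolding noised_law_eq_density(1)[OF t] by (subst nn_integral_density) auto
        also have "\<dots> = 1"
          by (subst nn_integral_noised_law) (auto simp: G.emeasure_space_1 \<mu>.emeasure_space_1)
        finally show ?thesis .
      qed
      have "\<Gamma> \<le> ennreal (exp (1 / (t\<^sup>2 * \<kappa>))) * (\<integral>\<^sup>+y. ennreal (noised_density t y) \<partial>lebesgue_Rd d)\<^sup>2"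
        unfolding \<Gamma>_def
      proof (rule order.trans[OF noised_density_mgf_ge[OF d t] prekopa_leindler_mgf])
        show "0 \<le> noised_density t y" for y using noised_density_pos[OF t, of y] by simp
        fix y z assume yz: "y \<in> Rd d" "z \<in> Rd d"
        let ?R = "dist_Rd d y z / 2" and ?m = "\<lambda>i\<in>{..<d}. (y i + z i) / 2"
        have u: "dot d (unit_pt 0) (unit_pt 0) = 1" using d0 by (simp add: dot_unit_pt) (simp add: unit_pt_def)
        have "noised_density t y * noised_density t z * exp (dot d ?v y - dot d ?v z) \<le>
          ((noised_density t ?m)\<^sup>2 * exp (- \<kappa> * ?R\<^sup>2)) * exp (2 * (1 / t) * ?R)"
          using dot_diff_le_dist[OF u, of "1 / t" y z] t
          by (intro mult_mono[OF noised_density_midpoint[OF t \<kappa> yz]]) auto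
        also have "\<dots> = (noised_density t ?m)\<^sup>2 * exp (2 * (1 / t) * ?R - \<kappa> * ?R\<^sup>2)"
          by (simp only: mult.assoc exp_add[symmetric]) (simp add: algebra_simps)
        also have "\<dots> \<le> (noised_density t ?m)\<^sup>2 * exp (1 / (t\<^sup>2 * \<kappa>))"
        proof (intro mult_left_mono)
          \<comment> \<open>The maximum of 2 R / t - \<kappa> R^2 over R is attained at R = 1 / (t
            \<kappa>).\<close>
          have "0 \<le> (\<kappa> * ?R - 1 / t)\<^sup>2 / \<kappa>" using True by simp
          also have "\<dots> = \<kappa> * ?R\<^sup>2 - 2 * (1 / t) * ?R + 1 / (t\<^sup>2 * \<kappa>)"
            using True t by (simp add: power2_eq_square field_simps)
          finally show "exp (2 * (1 / t) * ?R - \<kappa> * ?R\<^sup>2) \<le> exp (1 / (t\<^sup>2 * \<kappa>))" by simp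
        qed simp
        finally show "noised_density t y * noised_density t z * exp (dot d ?v y - dot d ?v z) \<le> exp (1 / (t\<^sup>2 * \<kappa>)) * (noised_density t ?m)\<^sup>2"
          by (simp add: mult.commute)
      qed measurable
      then have "\<Gamma> \<le> ennreal (exp (1 / (t\<^sup>2 * \<kappa>)))" unfolding one by simp
      then have "ennreal r \<le> ennreal (exp (1 / (t\<^sup>2 * \<kappa>)))"
        by (rule order.trans[OF less_imp_le[OF q(2)[unfolded qr]]])
      then have "r \<le> exp (1 / (t\<^sup>2 * \<kappa>))" by (simp add: ennreal_le_iff)
      then have "ln r \<le> ln (exp (1 / (t\<^sup>2 * \<kappa>)))" using r by (subst ln_le_cancel_iff) auto
      then have "ln r \<le> 1 / (t\<^sup>2 * \<kappa>)" by simp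
      then have "\<kappa> \<le> 1 / (t\<^sup>2 * ln r)" using True r t by (simp add: field_simps)
      then show ?thesis by (simp add: \<kappa>_def)
    qed
  qed
qed

text \<open>The supremum over \<open>x\<close> and unit vectors \<open>v\<close> of functions continuous in \<open>t\<close> is lower semicontinuous.\<close>

lemma sup_lambda_max_measurable:
  assumes d: "1 \<le> d"
    and bdd: "\<And>t. 0 < t \<Longrightarrow> t < 1 \<Longrightarrow> bdd_above ((\<lambda>x. lambda_max (score_mat t x)) ` Rd d)"
  shows "(\<lambda>t. indicator {0<..<1} t * (SUP x\<in>Rd d. lambda_max (score_mat t x))) \<in> borel_measurable borel"
  unfolding borel_measurable_iff_greater
proof
  fix c :: real
  let ?f = "\<lambda>t. indicator {0<..<1} t * (SUP x\<in>Rd d. lambda_max (score_mat t x))"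
  have ne: "Rd d \<noteq> {}" using restrict_in_Rd by blast
  have op: "open {t. 0 < t \<and> t < 1 \<and> c < (SUP x\<in>Rd d. lambda_max (score_mat t x))}" (is "open ?U")
  proof -
    have Ueq: "?U = (\<Union>x\<in>Rd d. \<Union>v\<in>{v. dot d v v = 1}. {t \<in> {0<..<1}. c < 1 + log_hess t x v v})"
    proof (intro equalityI subsetI)
      fix t assume t: "t \<in> ?U"
      then obtain x where x: "x \<in> Rd d" "c < lambda_max (score_mat t x)"
        using less_cSUP_iff[OF ne bdd] by auto
      obtain v where v: "dot d v v = 1" "1 + log_hess t x v v = lambda_max (score_mat t x)"
        using lambda_max_score_mat(2)[OF d] t by blast
      have "c < 1 + log_hess t x v v" using x v by simp
      with v(1) show "t \<in> (\<Union>x\<in>Rd d. \<Union>v\<in>{v. dot d v v = 1}. {t \<in> {0<..<1}. c < 1 + log_hess t x v v})"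
        using x t by auto
    next
      fix t assume "t \<in> (\<Union>x\<in>Rd d. \<Union>v\<in>{v. dot d v v = 1}. {t \<in> {0<..<1}. c < 1 + log_hess t x v v})"
      then obtain x v where xv: "x \<in> Rd d" "dot d v v = 1" "0 < t" "t < 1" "c < 1 + log_hess t x v v" by auto
      then have "c < lambda_max (score_mat t x)" using lambda_max_score_mat(1)[OF d, of t v x] by simp
      then show "t \<in> ?U" using xv less_cSUP_iff[OF ne bdd] by auto
    qed
    have "open {t \<in> {0<..<1}. c < 1 + log_hess t x v v}" for x v
    proof -
      have "continuous_on {0<..<1} (\<lambda>t. log_hess t x v v)"
        unfolding continuous_on_sequentially comp_def
        by (auto intro: log_hess_tendsto)
      then have "continuous_on {0<..<1} (\<lambda>t. 1 + log_hess t x v v)" by (intro continuous_intros)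
      then have "open ((\<lambda>t. 1 + log_hess t x v v) -` {c<..} \<inter> {0<..<1})"
        by (subst (asm) continuous_on_open_vimage) auto
      also have "(\<lambda>t. 1 + log_hess t x v v) -` {c<..} \<inter> {0<..<1} = {t \<in> {0<..<1}. c < 1 + log_hess t x v v}" by auto
      finally show ?thesis .
    qed
    then show ?thesis unfolding Ueq by (intro open_UN ballI)
  qed
  have "{t \<in> space borel. c < ?f t} = ?U \<union> (if c < 0 then - {0<..<1} else {})"
    by (auto simp: indicator_def split: if_splits)
  also have "\<dots> \<in> sets borel" using op by auto
  finally show "{t \<in> space borel. c < ?f t} \<in> sets borel" .
qed

end

section \<open>Integration over time\<close>

lemma score_const_pos: "0 < \<alpha> \<Longrightarrow> 0 < K \<Longrightarrow> 0 < score_const \<alpha> K"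
  unfolding score_const_def Let_def by (intro add_pos_pos mult_pos_pos zero_less_power) (auto intro: add_pos_pos)

text \<open>The integrand may be singular at 1, but its antiderivative - (1 - t^2)^\<gamma> / (2
  \<gamma>) extends continuously there. For \<gamma> = \<beta> / 4 the value is the factor 2 /
  \<beta> of the final constant.\<close>

lemma singular_integral:
  fixes \<gamma> :: real
  assumes \<gamma>: "0 < \<gamma>"
  shows "set_integrable lborel {0<..<1} (\<lambda>t. t * (1 - t\<^sup>2) powr (\<gamma> - 1))"
    and "(LINT t:{0<..<1}|lborel. t * (1 - t\<^sup>2) powr (\<gamma> - 1)) = 1 / (2 * \<gamma>)"
proof -
  let ?f = "\<lambda>t::real. t * (1 - t\<^sup>2) powr (\<gamma> - 1)"
  define F where "F t = - ((1 - t\<^sup>2) powr \<gamma>) / (2 * \<gamma>)" for t :: real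
  have cF: "isCont F 0" "(F \<longlongrightarrow> 0) (at_left 1)"
  proof -
    show "isCont F 0" unfolding F_def using \<gamma> by (intro continuous_intros) auto
    have "((\<lambda>t. (1 - t\<^sup>2) powr \<gamma>) \<longlongrightarrow> 0) (at_left (1::real))"
    proof (rule tendsto_zero_powrI)
      have "((\<lambda>t. 1 - t\<^sup>2) \<longlongrightarrow> 1 - 1\<^sup>2) (at_left (1::real))" by (intro tendsto_intros)
      then show "((\<lambda>t. 1 - t\<^sup>2) \<longlongrightarrow> 0) (at_left (1::real))" by simp
      show "\<forall>\<^sub>F t in at_left (1::real). 0 \<le> 1 - t\<^sup>2"
      proof -
        have "\<forall>\<^sub>F t in at_left (1::real). t \<in> {0<..<1}" by (rule eventually_at_left_real) simp
        then show ?thesis by eventually_elim (auto simp: power_le_one)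
      qed
    qed (use \<gamma> in auto)
    then have "((\<lambda>t. - ((1 - t\<^sup>2) powr \<gamma>) / (2 * \<gamma>)) \<longlongrightarrow> - 0 / (2 * \<gamma>)) (at_left (1::real))"
      using \<gamma> by (intro tendsto_intros) auto
    then show "(F \<longlongrightarrow> 0) (at_left 1)" unfolding F_def[abs_def] by simp
  qed
  have pos: "1 - x\<^sup>2 > 0" if "0 < ereal x" "ereal x < 1" for x
    using that by (simp add: abs_square_less_1 zero_ereal_def one_ereal_def)
  have x01: "0 < x" "x < 1" if "0 < ereal x" "ereal x < 1" for x
    using that by (simp_all add: zero_ereal_def one_ereal_def)
  have D: "DERIV F x :> ?f x" if "0 < ereal x" "ereal x < 1" for x
    unfolding F_def using pos[OF that] \<gamma>
    by (auto intro!: derivative_eq_intros simp: powr_diff field_simps)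
  have C: "isCont ?f x" if "0 < ereal x" "ereal x < 1" for x
    using pos[OF that] by (intro continuous_intros) auto
  have N: "AE x in lborel. 0 < ereal x \<longrightarrow> ereal x < 1 \<longrightarrow> 0 \<le> ?f x"
    using x01 by (intro AE_I2) (auto intro: less_imp_le)
  have A: "((F \<circ> real_of_ereal) \<longlongrightarrow> - 1 / (2 * \<gamma>)) (at_right 0)"
  proof -
    have "(F \<longlongrightarrow> F 0) (at_right 0)" 
      using cF(1) unfolding isCont_def by (rule tendsto_mono[rotated]) (simp add: at_le)
    then show ?thesis by (simp add: ereal_tendsto_simps zero_ereal_def F_def)
  qed
  have B: "((F \<circ> real_of_ereal) \<longlongrightarrow> 0) (at_left 1)"
    using cF(2) by (simp add: ereal_tendsto_simps one_ereal_def)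
  have e: "einterval 0 1 = {0<..<1::real}" by (auto simp: einterval_def zero_ereal_def one_ereal_def)
  show "set_integrable lborel {0<..<1} ?f"
    using interval_integral_FTC_nonneg(1)[OF _ D C N A B] unfolding e by simp
  have "(LBINT t=0..1. ?f t) = 0 - (- 1 / (2 * \<gamma>))"
    by (rule interval_integral_FTC_nonneg(2)[OF _ D C N A B]) simp
  then show "(LINT t:{0<..<1}|lborel. ?f t) = 1 / (2 * \<gamma>)"
    unfolding interval_lebesgue_integral_def e by simp
qed

lemma (in Rd_density) sup_lambda_max_bounds:
  assumes d: "1 \<le> d" and wlc: "weakly_log_concave d \<alpha>' \<beta> K p"
    and \<alpha>: "0 < \<alpha>" "\<alpha> \<le> 1" "\<alpha> \<le> \<alpha>'" and K: "K > 0" and \<beta>: "0 < \<beta>" "\<beta> \<le> 1"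
    and t: "0 < t" "t < 1"
  shows "bdd_above ((\<lambda>x. lambda_max (score_mat t x)) ` Rd d)"
    and "(SUP x\<in>Rd d. lambda_max (score_mat t x)) \<le> score_const \<alpha> K * t\<^sup>2 * (1 - t\<^sup>2) powr (\<beta> / 4 - 1)"
    and "- t\<^sup>2 / (1 - t\<^sup>2) \<le> (SUP x\<in>Rd d. lambda_max (score_mat t x))"
proof -
  have ne: "Rd d \<noteq> {}" using restrict_in_Rd by blast
  have up: "lambda_max (score_mat t x) \<le> score_const \<alpha> K * t\<^sup>2 * (1 - t\<^sup>2) powr (\<beta> / 4 - 1)" for x
  proof -
    obtain v where v: "dot d v v = 1" "1 + log_hess t x v v = lambda_max (score_mat t x)"
      using lambda_max_score_mat(2)[OF d t] by blast
    show ?thesis unfolding v(2)[symmetric] by (rule log_hess_upper[OF t v(1) wlc \<alpha> K \<beta>])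
  qed
  then show bdd: "bdd_above ((\<lambda>x. lambda_max (score_mat t x)) ` Rd d)" by (intro bdd_aboveI2)
  show "(SUP x\<in>Rd d. lambda_max (score_mat t x)) \<le> score_const \<alpha> K * t\<^sup>2 * (1 - t\<^sup>2) powr (\<beta> / 4 - 1)"
    by (rule cSUP_least[OF ne up])
  obtain x where x: "x \<in> Rd d" using ne by blast
  obtain v where v: "dot d v v = 1" "1 + log_hess t x v v = lambda_max (score_mat t x)"
    using lambda_max_score_mat(2)[OF d t] by blast
  have "- t\<^sup>2 / (1 - t\<^sup>2) \<le> lambda_max (score_mat t x)"
    unfolding v(2)[symmetric] by (rule log_hess_lower[OF t v(1)])
  also have "\<dots> \<le> (SUP x\<in>Rd d. lambda_max (score_mat t x))" by (rule cSUP_upper[OF x bdd])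
  finally show "- t\<^sup>2 / (1 - t\<^sup>2) \<le> (SUP x\<in>Rd d. lambda_max (score_mat t x))" .
qed

text \<open>The lower bound involves \<open>G\<close>, which depends on the density and hence on the
  dimension; it is used for integrability only. The value of the integral is bounded through the
  upper estimate alone.\<close>

lemma (in Rd_density) sup_lambda_max_integral:
  assumes d: "1 \<le> d" and wlc: "weakly_log_concave d \<alpha>' \<beta> K p"
    and \<alpha>: "0 < \<alpha>" "\<alpha> \<le> 1" "\<alpha> \<le> \<alpha>'" and K: "K > 0" and \<beta>: "0 < \<beta>" "\<beta> \<le> 1"
    and z: "0 \<le> z"
  shows "set_integrable lborel {z<..<1} (\<lambda>t. 1 / t * (SUP x\<in>Rd d. lambda_max (score_mat t x)))"
    and "(LINT t:{z<..<1}|lborel. 1 / t * (SUP x\<in>Rd d. lambda_max (score_mat t x))) \<le> score_const \<alpha> K * (2 / \<beta>)"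
proof -
  define M where "M t = (SUP x\<in>Rd d. lambda_max (score_mat t x))" for t
  note bounds = sup_lambda_max_bounds[OF d wlc \<alpha> K \<beta>, folded M_def]
  have ne: "Rd d \<noteq> {}" using restrict_in_Rd by blast
  define C where "C = score_const \<alpha> K"
  have C: "C > 0" using score_const_pos[OF \<alpha>(1) K] by (simp add: C_def)
  let ?h = "\<lambda>t. t * (1 - t\<^sup>2) powr (\<beta> / 4 - 1)"
  have \<beta>4: "0 < \<beta> / 4" using \<beta> by simp
  note h = singular_integral[OF \<beta>4]
  have up: "1 / t * M t \<le> C * ?h t" if t: "0 < t" "t < 1" for t
  proof -
    have "1 / t * M t \<le> 1 / t * (C * t\<^sup>2 * (1 - t\<^sup>2) powr (\<beta> / 4 - 1))"
      using bounds(2)[OF t] t by (intro mult_left_mono) (auto simp: C_def)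
    also have "\<dots> = C * ?h t" using t by (simp add: power2_eq_square)
    finally show ?thesis .
  qed
  have "\<exists>G>0. \<forall>t m. 0 < t \<longrightarrow> t < 1 \<longrightarrow> (\<forall>x\<in>Rd d. lambda_max (score_mat t x) \<le> m) \<longrightarrow> 1 - 1 / (t\<^sup>2 * G) \<le> m"
    by (rule sup_lambda_max_lower[OF d]) blast
  then obtain G where G: "G > 0" "\<And>t m. 0 < t \<Longrightarrow> t < 1 \<Longrightarrow> (\<And>x. x \<in> Rd d \<Longrightarrow> lambda_max (score_mat t x) \<le> m) \<Longrightarrow> 1 - 1 / (t\<^sup>2 * G) \<le> m"
    by blast
  \<comment> \<open>Near 0 the bound through \<open>G\<close> degenerates like 1 / t^3, while t / (1
    - t^2) stays below 1; beyond 1/2 the roles are reversed, and 1 / t^3 \<le> 8.\<close>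
  have low: "- (1 + 8 / G) \<le> 1 / t * M t" if t: "0 < t" "t < 1" for t
  proof (cases "t \<le> 1 / 2")
    case True
    have "t * t \<le> 1 / 2 * (1 / 2)" using True t by (intro mult_mono) auto
    then have s: "1 - t\<^sup>2 \<ge> 3 / 4" by (simp add: power2_eq_square)
    have "- 1 \<le> - t / (1 - t\<^sup>2)" using s True by (simp add: field_simps)
    also have "\<dots> = 1 / t * (- t\<^sup>2 / (1 - t\<^sup>2))" using t by (simp add: power2_eq_square)
    also have "\<dots> \<le> 1 / t * M t" using bounds(3)[OF t] t by (intro mult_left_mono) auto
    finally have "- 1 \<le> 1 / t * M t" .
    moreover have "0 \<le> 8 / G" using G(1) by simp
    ultimately show ?thesis by linarith
  next
    case False
    have "1 - 1 / (t\<^sup>2 * G) \<le> M t"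
      unfolding M_def using bounds(1)[OF t] by (intro G(2)[OF t] cSUP_upper)
    have "1 / t ^ 3 \<le> 8"
    proof -
      have "(1 / 2) ^ 3 \<le> t ^ 3" using False by (intro power_mono) auto
      then show ?thesis using t by (simp add: field_simps)
    qed
    then have "(1 / t ^ 3) * (1 / G) \<le> 8 * (1 / G)" using G(1) by (intro mult_right_mono) auto
    moreover have "0 \<le> 1 / t" using t by simp
    moreover have "8 * (1 / G) = 8 / G" by simp
    ultimately have "- (1 + 8 / G) \<le> 1 / t - (1 / t ^ 3) * (1 / G)" by linarith
    also have "\<dots> = 1 / t * (1 - 1 / (t\<^sup>2 * G))" using t G(1) by (simp add: field_simps eval_nat_numeral)
    also have "\<dots> \<le> 1 / t * M t" using \<open>1 - 1 / (t\<^sup>2 * G) \<le> M t\<close> t by (intro mult_left_mono) auto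
    finally show ?thesis .
  qed
  have meas: "(\<lambda>t. indicator {0<..<1} t * M t) \<in> borel_measurable borel"
    unfolding M_def by (rule sup_lambda_max_measurable[OF d bounds(1)])
  have int1: "set_integrable lborel {0<..<1} (\<lambda>t. 1 / t * M t)"
  proof -
    have dom: "integrable lborel (\<lambda>t. indicator {0<..<1} t *\<^sub>R (C * ?h t) + (1 + 8 / G) * indicator {0<..<1::real} t)"
    proof (rule Bochner_Integration.integrable_add)
      show "integrable lborel (\<lambda>t. indicator {0<..<1} t *\<^sub>R (C * ?h t))"
        using set_integrable_mult_right[OF h(1), of C] unfolding set_integrable_def by simp
      show "integrable lborel (\<lambda>t. (1 + 8 / G) * indicator {0<..<1::real} t)" by simp
    qed
    show ?thesis
      unfolding set_integrable_def
    proof (rule Bochner_Integration.integrable_bound[OF dom])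
      have "(\<lambda>t. 1 / t * (indicator {0<..<1} t * M t)) \<in> borel_measurable borel"
        using meas by measurable
      moreover have "(\<lambda>t. 1 / t * (indicator {0<..<1} t * M t)) = (\<lambda>t. indicator {0<..<1} t *\<^sub>R (1 / t * M t))"
        by (simp add: mult_ac)
      ultimately show "(\<lambda>t. indicator {0<..<1} t *\<^sub>R (1 / t * M t)) \<in> borel_measurable lborel" by simp
      show "AE t in lborel. norm (indicator {0<..<1} t *\<^sub>R (1 / t * M t)) \<le>
          norm (indicator {0<..<1} t *\<^sub>R (C * ?h t) + (1 + 8 / G) * indicator {0<..<1} t)"
      proof (rule AE_I2)
        fix t :: real
        show "norm (indicator {0<..<1} t *\<^sub>R (1 / t * M t)) \<le>
          norm (indicator {0<..<1} t *\<^sub>R (C * ?h t) + (1 + 8 / G) * indicator {0<..<1} t)"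
        proof (cases "t \<in> {0<..<1}")
          case True
          then have t: "0 < t" "t < 1" by auto
          have "0 \<le> C * ?h t" "0 \<le> 8 / G" using C t G(1) by auto
          then have "\<bar>1 / t * M t\<bar> \<le> \<bar>C * ?h t + (1 + 8 / G)\<bar>" using up[OF t] low[OF t] by linarith
          then show ?thesis using True by simp
        qed simp
      qed
    qed
  qed
  have sub: "{z<..<1} \<subseteq> {0<..<1}" using z by auto
  show int: "set_integrable lborel {z<..<1} (\<lambda>t. 1 / t * (SUP x\<in>Rd d. lambda_max (score_mat t x)))"
    unfolding M_def[symmetric] by (rule set_integrable_subset[OF int1 _ sub]) simp
  have Ch: "set_integrable lborel {0<..<1} (\<lambda>t. C * ?h t)"
    using set_integrable_mult_right[OF h(1), of C] by simp
  have "(LINT t:{z<..<1}|lborel. 1 / t * M t) \<le> (LINT t:{0<..<1}|lborel. C * ?h t)"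
    unfolding set_lebesgue_integral_def
  proof (rule integral_mono)
    show "integrable lborel (\<lambda>t. indicator {z<..<1} t *\<^sub>R (1 / t * M t))"
      using int unfolding set_integrable_def M_def .
    show "integrable lborel (\<lambda>t. indicator {0<..<1} t *\<^sub>R (C * ?h t))"
      using Ch unfolding set_integrable_def .
    fix t :: real
    show "indicator {z<..<1} t *\<^sub>R (1 / t * M t) \<le> indicator {0<..<1} t *\<^sub>R (C * ?h t)"
    proof (cases "t \<in> {z<..<1}")
      case True
      then show ?thesis using up[of t] z by auto
    next
      case False
      then show ?thesis using C by (auto simp: indicator_def)
    qed
  qed
  also have "\<dots> = C * (LINT t:{0<..<1}|lborel. ?h t)" by (rule set_integral_mult_right)
  also have "\<dots> = C * (2 / \<beta>)" unfolding h(2) using \<beta> by simp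
  finally show "(LINT t:{z<..<1}|lborel. 1 / t * (SUP x\<in>Rd d. lambda_max (score_mat t x))) \<le> score_const \<alpha> K * (2 / \<beta>)"
    unfolding M_def C_def .
qed

text \<open>Boundedness and integrability belong to the conclusion, because \<open>SUP\<close> and
  the integral take arbitrary default values otherwise and the estimate would carry no information.
  For \<open>d = 0\<close> the spectrum is empty and has no maximum.\<close>

theorem corollary3:
  fixes \<alpha> \<beta> K :: real
  assumes "\<alpha> > 0" and "K > 0" and "0 < \<beta>" and "\<beta> \<le> 1"
  shows "\<exists>C>0. \<forall>d\<ge>1. \<forall>(p :: point \<Rightarrow> real) (pt :: real \<Rightarrow> point \<Rightarrow> real) s.
           weakly_log_concave d \<alpha> \<beta> K p \<and>
           (\<forall>t. 0 < t \<and> t < 1 \<longrightarrow>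
              continuous_density d (noised_law d p t) (pt t) \<and> s t = score d (pt t)) \<longrightarrow>
           (\<forall>t. 0 < t \<and> t < 1 \<longrightarrow>
              bdd_above ((\<lambda>x. lambda_max (1\<^sub>m d + jacobian_mat d (s t) x)) ` Rd d)) \<and>
           (\<forall>z. 0 \<le> z \<and> z \<le> 1 \<longrightarrow>
              interval_lebesgue_integrable lborel (ereal z) (ereal 1)
                (\<lambda>t. 1 / t * (SUP x\<in>Rd d. lambda_max (1\<^sub>m d + jacobian_mat d (s t) x))) \<and>
              (LBINT t=ereal z..ereal 1.
                 1 / t * (SUP x\<in>Rd d. lambda_max (1\<^sub>m d + jacobian_mat d (s t) x))) \<le> C)"
proof -
  \<comment> \<open>Lowering \<alpha> to at most 1 weakens the convexity assumption harmlessly and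
    provides the inequality \<alpha> \<le> 1 that \<open>log_hess_upper\<close> asks for.\<close>
  define \<alpha>1 where "\<alpha>1 = min \<alpha> 1"
  have \<alpha>1: "0 < \<alpha>1" "\<alpha>1 \<le> 1" "\<alpha>1 \<le> \<alpha>" using assms(1) by (auto simp: \<alpha>1_def)
  have Cpos: "score_const \<alpha>1 K * (2 / \<beta>) > 0" using score_const_pos[OF \<alpha>1(1) assms(2)] assms(3) by simp
  show ?thesis
  proof (intro exI[of _ "score_const \<alpha>1 K * (2 / \<beta>)"] conjI[OF Cpos] allI impI, elim conjE)
    fix d :: nat and p :: "point \<Rightarrow> real" and pt :: "real \<Rightarrow> point \<Rightarrow> real" and s
    assume d: "1 \<le> d" and wlc: "weakly_log_concave d \<alpha> \<beta> K p"
      and pt: "\<forall>t. 0 < t \<and> t < 1 \<longrightarrow> continuous_density d (noised_law d p t) (pt t) \<and> s t = score d (pt t)"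
    interpret Rd_density d p
      by standard (use wlc in \<open>simp add: weakly_log_concave_def\<close>)
    let ?S = "\<lambda>t. SUP x\<in>Rd d. lambda_max (1\<^sub>m d + jacobian_mat d (s t) x)"
    have mat: "1\<^sub>m d + jacobian_mat d (s t) x = score_mat t x" if t: "0 < t" "t < 1" and x: "x \<in> Rd d" for t x
    proof -
      have cd: "continuous_density d (noised_law d p t) (pt t)" and st: "s t = score d (pt t)" using pt t by auto
      show ?thesis unfolding st score_mat_def
        by (rule jacobian_score[OF t continuous_density_eq_noised_density[OF t cd] x])
    qed
    have S: "?S t = (SUP x\<in>Rd d. lambda_max (score_mat t x))" if t: "0 < t" "t < 1" for t
      by (intro SUP_cong refl) (simp add: mat[OF t])
    have bdd: "bdd_above ((\<lambda>x. lambda_max (1\<^sub>m d + jacobian_mat d (s t) x)) ` Rd d)" if t: "0 < t" "t < 1" for t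
    proof -
      have "(\<lambda>x. lambda_max (1\<^sub>m d + jacobian_mat d (s t) x)) ` Rd d = (\<lambda>x. lambda_max (score_mat t x)) ` Rd d"
        by (intro image_cong refl) (simp add: mat[OF t])
      then show ?thesis using sup_lambda_max_bounds(1)[OF d wlc \<alpha>1 assms(2-4) t] by simp
    qed
    have int: "interval_lebesgue_integrable lborel (ereal z) (ereal 1) (\<lambda>t. 1 / t * ?S t) \<and>
        (LBINT t=ereal z..ereal 1. 1 / t * ?S t) \<le> score_const \<alpha>1 K * (2 / \<beta>)" if z: "0 \<le> z" "z \<le> 1" for z
    proof -
      \<comment> \<open>The interval is open at both ends, so the matrices enter only at times
        strictly between 0 and 1, where the densities are given.\<close>
      have e: "einterval (ereal z) (ereal 1) = {z<..<1}" by (auto simp: einterval_def)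
      note int = sup_lambda_max_integral[OF d wlc \<alpha>1 assms(2-4) z(1)]
      have "set_integrable lborel {z<..<1} (\<lambda>t. 1 / t * ?S t) =
          set_integrable lborel {z<..<1} (\<lambda>t. 1 / t * (SUP x\<in>Rd d. lambda_max (score_mat t x)))"
        using z by (intro set_integrable_cong refl) (simp add: S)
      moreover have "(LINT t:{z<..<1}|lborel. 1 / t * ?S t) =
          (LINT t:{z<..<1}|lborel. 1 / t * (SUP x\<in>Rd d. lambda_max (score_mat t x)))"
        using z by (intro set_lebesgue_integral_cong) (auto simp: S)
      ultimately show ?thesis
        using int z unfolding interval_lebesgue_integrable_def interval_lebesgue_integral_def e by simp
    qed
    show "(\<forall>t. 0 < t \<and> t < 1 \<longrightarrow>
              bdd_above ((\<lambda>x. lambda_max (1\<^sub>m d + jacobian_mat d (s t) x)) ` Rd d)) \<and>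
           (\<forall>z. 0 \<le> z \<and> z \<le> 1 \<longrightarrow>
              interval_lebesgue_integrable lborel (ereal z) (ereal 1) (\<lambda>t. 1 / t * ?S t) \<and>
              (LBINT t=ereal z..ereal 1. 1 / t * ?S t) \<le> score_const \<alpha>1 K * (2 / \<beta>))"
      by (rule conjI; intro allI impI; elim conjE) (rule bdd int; assumption)+
  qed
qed

end
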